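(* Let $k=\mathbb C$, let $\mathcal{D}_H$ be a left $H$-category and $M$ a right-left SAYD module over $H$. Suppose that there is an $H$-linear semifunctor $\upsilon:\mathcal{D}_H\to\mathcal{D}_H$ and an $\eta \in \mathbb U_H(\mathcal{D}_H \otimes M_2(k))$ such that (1) $\upsilon(X)=X$ for all $X \in Ob(\mathcal{D}_H)$; (2) $\Phi_\eta(f \otimes E_{11}+\upsilon(f) \otimes E_{22})=\upsilon(f) \otimes E_{22}$ for all $f \in Hom_{\mathcal{D}_H}(X,Y)$ and $X,Y \in Ob(\mathcal{D}_H)$. Then $HC^\bullet_H(\mathcal{D}_H,M)=0$.
   Context: $k=\mathbb C$; $H$ is a Hopf algebra over $k$ with coproduct $\Delta(h)=h_1\otimes h_2$, counit $\varepsilon$, bijective antipode $S$. A left $H$-category is a small $k$-linear category $\mathcal D_H$ with each $Hom_{\mathcal D_H}(X,Y)$ a left $H$-module, $h(id_X)=\varepsilon(h)id_X$, $h(gf)=(h_1g)(h_2f)$. A semifunctor preserves composition but not necessarily identities. A right-left SAYD module is a right $H$-module and left $H$-comodule $M$, $m\mapsto m_{(-1)}\otimes m_{(0)}$, with $(mh)_{(-1)}\otimes(mh)_{(0)}=S(h_3)m_{(-1)}h_1\otimes m_{(0)}h_2$ and $m_{(0)}m_{(-1)}=m$. $\mathcal D_H\otimes M_2(k)$ is the left $H$-category with the objects of $\mathcal D_H$, $Hom(X,Y)=Hom_{\mathcal D_H}(X,Y)\otimes M_2(k)$, componentwise composition, $h(f\otimes B)=hf\otimes B$. $E_{ij}$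 are elementary matrices. For a left $H$-category $\mathcal E$, $\mathbb U_H(\mathcal E)$ is the set of families $\eta=\{\eta(X)\in Aut_{\mathcal E}(X)\}_{X\in Ob(\mathcal E)}$ with $h(\eta(X))=\varepsilon(h)\eta(X)$ for all $h\in H$ and $X$; for such $\eta$, $\Phi_\eta:\mathcal E\to\mathcal E$ fixes objects and sends $f\in Hom_{\mathcal E}(X,Y)$ to $\eta(Y)\circ f\circ\eta(X)^{-1}$. Hopf-cyclic cohomology: $CN_n(\mathcal D_H)=\bigoplus_{(X_0,\ldots,X_n)}Hom_{\mathcal D_H}(X_1,X_0)\otimes\ldots\otimes Hom_{\mathcal D_H}(X_0,X_n)$ with diagonal $H$-action; $C^n_H(\mathcal D_H,M)$ is the space of $k$-linear $\phi:M\otimes CN_n(\mathcal D_H)\to k$ with $\phi(mh_1\otimes S(h_2)(f^0\otimes\ldots\otimes f^n))=\varepsilon(h)\phi(m\otimes f^0\otimes\ldots\otimes f^n)$; $(\delta_i\phi)(m\otimes f^0\otimes\ldots\otimes f^n)=\phi(m\otimes\ldots\otimes f^if^{i+1}\otimes\ldots\otimes f^n)$ for $0\le i\le n-1$, $(\delta_n\phi)(m\otimes f^0\otimes\ldots\otimes f^n)=\phi(m_{(0)}\otimes(S^{-1}(m_{(-1)})f^n)f^0\otimes f^1\otimes\ldots\otimes f^{n-1})$, $(\tau_n\phi)(m\otimes f^0\otimes\ldots\otimes f^n)=\phi(m_{(0)}\otimes S^{-1}(m_{(-1)})f^n\otimes f^0\otimes\ldots\otimes f^{n-1})$. $HC^\bullet_H(\mathcal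 D_H,M)$ is the cohomology of the complex $\{\phi\in C^n_H(\mathcal D_H,M):\phi=(-1)^n\tau_n\phi\}_{n\ge0}$ with differential $b=\sum_{i=0}^{n+1}(-1)^i\delta_i$. *)

theory Defs
  imports "HOL-Analysis.Analysis" "HOL-Library.Poly_Mapping"
begin

section \<open>Complex vector spaces\<close>

class complex_vector = ab_group_add +
  fixes scaleC :: "complex \<Rightarrow> 'a \<Rightarrow> 'a"  (infixr \<open>*\<^sub>C\<close> 75)
  assumes scaleC_add_right: "c *\<^sub>C (x + y) = c *\<^sub>C x + c *\<^sub>C y"
    and scaleC_add_left: "(c + d) *\<^sub>C x = c *\<^sub>C x + d *\<^sub>C x"
    and scaleC_scaleC: "c *\<^sub>C (d *\<^sub>C x) = (c * d) *\<^sub>C x"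
    and scaleC_one: "1 *\<^sub>C x = x"

class complex_algebra_1 = complex_vector + ring_1 +
  assumes mult_scaleC_left: "(c *\<^sub>C x) * y = c *\<^sub>C (x * y)"
    and mult_scaleC_right: "x * (c *\<^sub>C y) = c *\<^sub>C (x * y)"

global_interpretation cv: vector_space "scaleC :: complex \<Rightarrow> 'a \<Rightarrow> 'a::complex_vector"
  by unfold_locales (simp_all add: scaleC_add_right scaleC_add_left scaleC_scaleC scaleC_one)

abbreviation clinear :: "('a::complex_vector \<Rightarrow> 'b::complex_vector) \<Rightarrow> bool"
  where "clinear \<equiv> Vector_Spaces.linear scaleC scaleC"

lemma clinear_iff:
  "clinear f \<longleftrightarrow> (\<forall>x y. f (x + y) = f x + f y) \<and> (\<forall>c x. f (c *\<^sub>C x) = c *\<^sub>C f x)"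
  by (simp add: Vector_Spaces.linear_iff cv.vector_space_axioms)

definition clinear_on :: "'a::complex_vector set \<Rightarrow> ('a \<Rightarrow> 'b::complex_vector) \<Rightarrow> bool"
  where "clinear_on V f \<longleftrightarrow>
    (\<forall>x\<in>V. \<forall>y\<in>V. f (x + y) = f x + f y) \<and> (\<forall>c. \<forall>x\<in>V. f (c *\<^sub>C x) = c *\<^sub>C f x)"

definition cbilinear ::
  "('a::complex_vector \<Rightarrow> 'b::complex_vector \<Rightarrow> 'c::complex_vector) \<Rightarrow> bool"
  where "cbilinear B \<longleftrightarrow> (\<forall>a. clinear (B a)) \<and> (\<forall>b. clinear (\<lambda>a. B a b))"

definition list_multilinear :: "('a::complex_vector list \<Rightarrow> 'b::complex_vector) \<Rightarrow> bool"
  where "list_multilinear F \<longleftrightarrow> (\<forall>xs ys. clinear (\<lambda>a. F (xs @ a # ys)))"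

instantiation complex :: complex_algebra_1
begin
definition scaleC_complex :: "complex \<Rightarrow> complex \<Rightarrow> complex"
  where "scaleC_complex c x = c * x"
instance by intro_classes (simp_all add: scaleC_complex_def algebra_simps)
end

instantiation vec :: (complex_vector, finite) complex_vector
begin
definition scaleC_vec :: "complex \<Rightarrow> 'a ^ 'b \<Rightarrow> 'a ^ 'b"
  where "scaleC_vec c x = (\<chi> i. c *\<^sub>C x $ i)"
instance
  by intro_classes
    (simp_all add: scaleC_vec_def vec_eq_iff scaleC_add_right scaleC_add_left scaleC_scaleC scaleC_one)
end

instantiation poly_mapping :: (type, complex_vector) complex_vector
begin
definition scaleC_poly_mapping :: "complex \<Rightarrow> ('a \<Rightarrow>\<^sub>0 'b) \<Rightarrow> ('a \<Rightarrow>\<^sub>0 'b)"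
  where "scaleC_poly_mapping c p = Poly_Mapping.map (scaleC c) p"

lemma lookup_scaleC: "Poly_Mapping.lookup (c *\<^sub>C p) k = c *\<^sub>C Poly_Mapping.lookup p k"
  for p :: "'a \<Rightarrow>\<^sub>0 'b"
  by (simp add: scaleC_poly_mapping_def map.rep_eq when_def)

instance
  by intro_classes
    (auto intro!: poly_mapping_eqI simp: lookup_scaleC lookup_add
      scaleC_add_right scaleC_add_left scaleC_scaleC scaleC_one)
end


section \<open>Tensor products\<close>

text \<open>The free complex vector space on \<open>'a\<close> is \<open>'a \<Rightarrow>\<^sub>0 complex\<close>.\<close>

definition free_lift :: "('a \<Rightarrow> 'b::complex_vector) \<Rightarrow> ('a \<Rightarrow>\<^sub>0 complex) \<Rightarrow> 'b"
  where "free_lift F p = (\<Sum>k\<in>Poly_Mapping.keys p. Poly_Mapping.lookup p k *\<^sub>C F k)"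

lemma free_lift_superset:
  assumes "finite A" "Poly_Mapping.keys p \<subseteq> A"
  shows "free_lift F p = (\<Sum>k\<in>A. Poly_Mapping.lookup p k *\<^sub>C F k)"
  unfolding free_lift_def using assms
  by (intro sum.mono_neutral_left) (auto simp: in_keys_iff)

lemma clinear_free_lift: "clinear (free_lift F)"
proof -
  have "free_lift F (p + q) = free_lift F p + free_lift F q" for p q
  proof -
    let ?A = "Poly_Mapping.keys p \<union> Poly_Mapping.keys q"
    have "Poly_Mapping.keys (p + q) \<subseteq> ?A" by (rule keys_add)
    then show ?thesis
      by (simp add: free_lift_superset[of ?A] lookup_add scaleC_add_left sum.distrib)
  qed
  moreover have "free_lift F (c *\<^sub>C p) = c *\<^sub>C free_lift F p" for c p
  proof -
    have "Poly_Mapping.keys (c *\<^sub>C p) \<subseteq> Poly_Mapping.keys p"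
      by (auto simp: in_keys_iff lookup_scaleC scaleC_complex_def)
    then show ?thesis
      by (simp add: free_lift_superset[of "Poly_Mapping.keys p"] lookup_scaleC scaleC_complex_def
          cv.scale_sum_right scaleC_scaleC)
  qed
  ultimately show ?thesis by (simp add: clinear_iff)
qed

lemma free_lift_single: "free_lift F (Poly_Mapping.single k c) = c *\<^sub>C F k"
  by (cases "c = 0") (simp_all add: free_lift_def)

lemma cspan_free: "cv.span (range (\<lambda>k. Poly_Mapping.single k (1::complex))) = UNIV"
proof -
  have "p \<in> cv.span (range (\<lambda>k. Poly_Mapping.single k (1::complex)))" for p :: "'a \<Rightarrow>\<^sub>0 complex"
  proof -
    have "p = (\<Sum>k\<in>Poly_Mapping.keys p.
        Poly_Mapping.lookup p k *\<^sub>C Poly_Mapping.single k (1::complex))"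
      by (rule poly_mapping_eqI)
        (simp add: lookup_sum lookup_scaleC lookup_single scaleC_complex_def when_def
          in_keys_iff if_distrib cong: if_cong)
    also have "\<dots> \<in> cv.span (range (\<lambda>k. Poly_Mapping.single k (1::complex)))"
      by (intro cv.span_sum cv.span_scale cv.span_base) auto
    finally show ?thesis .
  qed
  then show ?thesis by auto
qed

lemma clinear_zero_on_span:
  assumes "clinear f" "\<And>r. r \<in> R \<Longrightarrow> f r = 0" "p \<in> cv.span R"
  shows "f p = 0"
proof -
  interpret f: Vector_Spaces.linear scaleC scaleC f by fact
  show ?thesis
    using assms(3)
    by (induction rule: cv.span_induct_alt) (simp_all add: f.add f.scale assms(2))
qed

lemma clinear_eq_on_span:
  assumes "clinear f" "clinear g" "\<And>r. r \<in> R \<Longrightarrow> f r = g r" "p \<in> cv.span R"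
  shows "f p = g p"
proof -
  have "clinear (\<lambda>x. f x - g x)"
    using assms(1,2) by (simp add: clinear_iff algebra_simps cv.scale_right_diff_distrib)
  from clinear_zero_on_span[OF this _ assms(4)] assms(3) show ?thesis by simp
qed

lemma equivp_mod_span: "equivp (\<lambda>p q. p - q \<in> cv.span R)"
proof (rule equivpI)
  show "reflp (\<lambda>p q. p - q \<in> cv.span R)" by (rule reflpI) (simp add: cv.span_zero)
  show "symp (\<lambda>p q. p - q \<in> cv.span R)" by (rule sympI) (metis cv.span_neg minus_diff_eq)
  show "transp (\<lambda>p q. p - q \<in> cv.span R)"
    by (rule transpI) (metis cv.span_add diff_add_cancel add_diff_eq)
qed

lemma mod_span_plus:
  assumes "p - q \<in> cv.span R" "p' - q' \<in> cv.span R"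
  shows "(p + p') - (q + q') \<in> cv.span R"
  using cv.span_add[OF assms] by (simp add: algebra_simps)

lemma mod_span_minus:
  assumes "p - q \<in> cv.span R" "p' - q' \<in> cv.span R"
  shows "(p - p') - (q - q') \<in> cv.span R"
  using cv.span_diff[OF assms] by (simp add: algebra_simps)

lemma mod_span_uminus:
  assumes "p - q \<in> cv.span R"
  shows "(- p) - (- q) \<in> cv.span R"
  using cv.span_neg[OF assms] by simp

lemma mod_span_scaleC:
  assumes "p - q \<in> cv.span R"
  shows "(c *\<^sub>C p) - (c *\<^sub>C q) \<in> cv.span R"
  using cv.span_scale[OF assms] by (simp add: cv.scale_right_diff_distrib)

subsection \<open>The tensor product of two spaces\<close>

definition tensor_rels :: "('a::complex_vector \<times> 'b::complex_vector \<Rightarrow>\<^sub>0 complex) set"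
  where "tensor_rels =
    {Poly_Mapping.single (a + a', b) 1 - Poly_Mapping.single (a, b) 1
       - Poly_Mapping.single (a', b) 1 | a a' b. True} \<union>
    {Poly_Mapping.single (a, b + b') 1 - Poly_Mapping.single (a, b) 1
       - Poly_Mapping.single (a, b') 1 | a b b'. True} \<union>
    {Poly_Mapping.single (c *\<^sub>C a, b) 1 - Poly_Mapping.single (a, b) c | a b c. True} \<union>
    {Poly_Mapping.single (a, c *\<^sub>C b) 1 - Poly_Mapping.single (a, b) c | a b c. True}"

quotient_type (overloaded) ('a, 'b) tensor =
  "('a::complex_vector \<times> 'b::complex_vector) \<Rightarrow>\<^sub>0 complex" / "\<lambda>p q. p - q \<in> cv.span tensor_rels"
  by (rule equivp_mod_span)

instantiation tensor :: (complex_vector, complex_vector) complex_vector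
begin
lift_definition zero_tensor :: "('a, 'b) tensor" is 0 .
lift_definition plus_tensor :: "('a, 'b) tensor \<Rightarrow> ('a, 'b) tensor \<Rightarrow> ('a, 'b) tensor"
  is "(+)" by (rule mod_span_plus)
lift_definition minus_tensor :: "('a, 'b) tensor \<Rightarrow> ('a, 'b) tensor \<Rightarrow> ('a, 'b) tensor"
  is "(-)" by (rule mod_span_minus)
lift_definition uminus_tensor :: "('a, 'b) tensor \<Rightarrow> ('a, 'b) tensor"
  is uminus by (rule mod_span_uminus)
lift_definition scaleC_tensor :: "complex \<Rightarrow> ('a, 'b) tensor \<Rightarrow> ('a, 'b) tensor"
  is scaleC by (rule mod_span_scaleC)
instance
  by intro_classes
    (transfer; simp add: cv.span_zero algebra_simps scaleC_add_right scaleC_add_left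
       scaleC_scaleC scaleC_one)+
end

lift_definition tens :: "'a::complex_vector \<Rightarrow> 'b::complex_vector \<Rightarrow> ('a, 'b) tensor"
  (infixr \<open>\<otimes>\<close> 76) is "\<lambda>a b. Poly_Mapping.single (a, b) 1" .

text \<open>
  The linear map induced by a bilinear map. Since elements of \<open>H \<otimes> H\<close> and \<open>H \<otimes> M\<close> are only
  sums of pure tensors, a Sweedler expression \<open>B(h\<^sub>1, h\<^sub>2)\<close> is written
  \<open>tensor_lift B (\<Delta> h)\<close>, that is, \<open>tensor_lift (\<lambda>h1 h2. B h1 h2) (\<Delta> h)\<close>.
\<close>

definition tensor_lift ::
  "('a::complex_vector \<Rightarrow> 'b::complex_vector \<Rightarrow> 'c::complex_vector) \<Rightarrow> ('a, 'b) tensor \<Rightarrow> 'c"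
  where "tensor_lift B t = free_lift (\<lambda>(a, b). B a b) (rep_tensor t)"

lemma cbilinear_tens: "cbilinear (\<otimes>)"
proof -
  have "(a + a') \<otimes> b = a \<otimes> b + a' \<otimes> b" for a a' :: 'a and b :: 'b
    by transfer (simp only: diff_diff_eq[symmetric], rule cv.span_base, unfold tensor_rels_def, blast)
  moreover have "a \<otimes> (b + b') = a \<otimes> b + a \<otimes> b'" for a :: 'a and b b' :: 'b
    by transfer (simp only: diff_diff_eq[symmetric], rule cv.span_base, unfold tensor_rels_def, blast)
  moreover have single: "c *\<^sub>C Poly_Mapping.single k (1::complex) = Poly_Mapping.single k c"
    for c and k :: "'a \<times> 'b"
    by (rule poly_mapping_eqI) (simp add: lookup_scaleC lookup_single scaleC_complex_def when_def)
  moreover have "(c *\<^sub>C a) \<otimes> b = c *\<^sub>C (a \<otimes> b)" for a :: 'a and b :: 'b and c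
    by transfer (subst single, rule cv.span_base, unfold tensor_rels_def, blast)
  moreover have "a \<otimes> (c *\<^sub>C b) = c *\<^sub>C (a \<otimes> b)" for a :: 'a and b :: 'b and c
    by transfer (subst single, rule cv.span_base, unfold tensor_rels_def, blast)
  ultimately show ?thesis by (simp add: cbilinear_def clinear_iff)
qed

lemma
  fixes a :: "'a::complex_vector" and b :: "'b::complex_vector"
  shows clinear_tens_right: "clinear (\<lambda>b::'b. a \<otimes> b)"
    and clinear_tens_left: "clinear (\<lambda>a::'a. a \<otimes> b)"
  using cbilinear_tens[where 'a='a and 'b='b] unfolding cbilinear_def by simp_all

lemma
  assumes B: "cbilinear B"
  shows tensor_lift_tens: "tensor_lift B (a \<otimes> b) = B a b"
    and clinear_tensor_lift: "clinear (tensor_lift B)"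
proof -
  let ?L = "free_lift (\<lambda>(a, b). B a b)"
  interpret L: Vector_Spaces.linear scaleC scaleC ?L by (rule clinear_free_lift)
  have "?L r = 0" if "r \<in> tensor_rels" for r
    using that B unfolding tensor_rels_def
    by (auto simp: L.diff free_lift_single scaleC_one cbilinear_def clinear_iff)
  then have van: "?L p = 0" if "p \<in> cv.span tensor_rels" for p
    using clinear_zero_on_span[OF clinear_free_lift] that by blast
  have eq: "tensor_lift B (abs_tensor p) = ?L p" for p
  proof -
    have "rep_tensor (abs_tensor p) - p \<in> cv.span tensor_rels"
      using Quotient3_rep_abs[OF Quotient3_tensor] by (metis cv.span_zero diff_self)
    then have "?L (rep_tensor (abs_tensor p)) - ?L p = 0" using van L.diff by metis
    then show ?thesis by (simp add: tensor_lift_def)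
  qed
  show "tensor_lift B (a \<otimes> b) = B a b"
    by (simp add: tens.abs_eq eq free_lift_single scaleC_one)
  have "tensor_lift B (s + t) = tensor_lift B s + tensor_lift B t" for s t
    by (induction s; induction t) (simp add: plus_tensor.abs_eq eq L.add)
  moreover have "tensor_lift B (c *\<^sub>C t) = c *\<^sub>C tensor_lift B t" for c t
    by (induction t) (simp add: scaleC_tensor.abs_eq eq L.scale)
  ultimately show "clinear (tensor_lift B)" by (simp add: clinear_iff)
qed

lemma clinear_abs_tensor: "clinear abs_tensor"
  by (simp add: clinear_iff plus_tensor.abs_eq scaleC_tensor.abs_eq)

lemma cspan_tens: "cv.span {a \<otimes> b | a b. True} = UNIV"
proof -
  have "t \<in> cv.span {a \<otimes> b | a b. True}" for t :: "('a, 'b) tensor"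
  proof (induction t)
    case (1 p)
    interpret abs: Vector_Spaces.linear scaleC scaleC abs_tensor by (rule clinear_abs_tensor)
    have "p \<in> cv.span (range (\<lambda>k. Poly_Mapping.single k (1::complex)))"
      by (simp add: cspan_free)
    then show ?case
    proof (induction rule: cv.span_induct_alt)
      case base
      then show ?case by (simp add: abs.zero cv.span_zero)
    next
      case (step c x y)
      then obtain a b where "x = Poly_Mapping.single (a, b) 1" by auto
      then have "abs_tensor x \<in> {a \<otimes> b | a b. True}" by (auto simp: tens.abs_eq)
      then show ?case using step(2)
        unfolding abs.add abs.scale by (meson cv.span_add cv.span_scale cv.span_base)
    qed
  qed
  then show ?thesis by auto
qed

subsection \<open>Tensor powers\<close>

text \<open>
  The direct sum of all tensor powers of \<open>'a\<close>. The tensor product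
  \<open>V\<^sub>0 \<otimes> \<dots> \<otimes> V\<^sub>n\<close> of subspaces of \<open>'a\<close> is the span of all
  \<open>tens_list [v\<^sub>0, \<dots>, v\<^sub>n]\<close> with \<open>v\<^sub>i \<in> V\<^sub>i\<close>.
\<close>

definition tensor_power_rels :: "('a::complex_vector list \<Rightarrow>\<^sub>0 complex) set"
  where "tensor_power_rels =
    {Poly_Mapping.single (xs @ (a + b) # ys) 1 - Poly_Mapping.single (xs @ a # ys) 1
       - Poly_Mapping.single (xs @ b # ys) 1 | xs a b ys. True} \<union>
    {Poly_Mapping.single (xs @ (c *\<^sub>C a) # ys) 1 - Poly_Mapping.single (xs @ a # ys) c
       | xs a c ys. True}"

quotient_type (overloaded) 'a tensor_power =
  "'a::complex_vector list \<Rightarrow>\<^sub>0 complex" / "\<lambda>p q. p - q \<in> cv.span tensor_power_rels"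
  by (rule equivp_mod_span)

instantiation tensor_power :: (complex_vector) complex_vector
begin
lift_definition zero_tensor_power :: "'a tensor_power" is 0 .
lift_definition plus_tensor_power :: "'a tensor_power \<Rightarrow> 'a tensor_power \<Rightarrow> 'a tensor_power"
  is "(+)" by (rule mod_span_plus)
lift_definition minus_tensor_power :: "'a tensor_power \<Rightarrow> 'a tensor_power \<Rightarrow> 'a tensor_power"
  is "(-)" by (rule mod_span_minus)
lift_definition uminus_tensor_power :: "'a tensor_power \<Rightarrow> 'a tensor_power"
  is uminus by (rule mod_span_uminus)
lift_definition scaleC_tensor_power :: "complex \<Rightarrow> 'a tensor_power \<Rightarrow> 'a tensor_power"
  is scaleC by (rule mod_span_scaleC)
instance
  by intro_classes
    (transfer; simp add: cv.span_zero algebra_simps scaleC_add_right scaleC_add_left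
       scaleC_scaleC scaleC_one)+
end

lift_definition tens_list :: "'a::complex_vector list \<Rightarrow> 'a tensor_power"
  is "\<lambda>xs. Poly_Mapping.single xs 1" .

definition tensor_power_lift ::
  "('a::complex_vector list \<Rightarrow> 'b::complex_vector) \<Rightarrow> 'a tensor_power \<Rightarrow> 'b"
  where "tensor_power_lift F t = free_lift F (rep_tensor_power t)"

lemma list_multilinear_tens_list: "list_multilinear tens_list"
proof -
  have "tens_list (xs @ (a + b) # ys) = tens_list (xs @ a # ys) + tens_list (xs @ b # ys)"
    for xs ys and a b :: 'a
    by transfer (simp only: diff_diff_eq[symmetric], rule cv.span_base, unfold tensor_power_rels_def, blast)
  moreover have single: "c *\<^sub>C Poly_Mapping.single k (1::complex) = Poly_Mapping.single k c"
    for c and k :: "'a list"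
    by (rule poly_mapping_eqI) (simp add: lookup_scaleC lookup_single scaleC_complex_def when_def)
  moreover have "tens_list (xs @ (c *\<^sub>C a) # ys) = c *\<^sub>C tens_list (xs @ a # ys)"
    for xs ys and a :: 'a and c
    by transfer (subst single, rule cv.span_base, unfold tensor_power_rels_def, blast)
  ultimately show ?thesis by (simp add: list_multilinear_def clinear_iff)
qed

lemma
  assumes F: "list_multilinear F"
  shows tensor_power_lift_tens_list: "tensor_power_lift F (tens_list xs) = F xs"
    and clinear_tensor_power_lift: "clinear (tensor_power_lift F)"
proof -
  let ?L = "free_lift F"
  interpret L: Vector_Spaces.linear scaleC scaleC ?L by (rule clinear_free_lift)
  have "?L r = 0" if "r \<in> tensor_power_rels" for r
    using that F unfolding tensor_power_rels_def
    by (auto simp: L.diff free_lift_single scaleC_one list_multilinear_def clinear_iff)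
  then have van: "?L p = 0" if "p \<in> cv.span tensor_power_rels" for p
    using clinear_zero_on_span[OF clinear_free_lift] that by blast
  have eq: "tensor_power_lift F (abs_tensor_power p) = ?L p" for p
  proof -
    have "rep_tensor_power (abs_tensor_power p) - p \<in> cv.span tensor_power_rels"
      using Quotient3_rep_abs[OF Quotient3_tensor_power] by (metis cv.span_zero diff_self)
    then have "?L (rep_tensor_power (abs_tensor_power p)) - ?L p = 0" using van L.diff by metis
    then show ?thesis by (simp add: tensor_power_lift_def)
  qed
  show "tensor_power_lift F (tens_list xs) = F xs"
    by (simp add: tens_list.abs_eq eq free_lift_single scaleC_one)
  have "tensor_power_lift F (s + t) = tensor_power_lift F s + tensor_power_lift F t" for s t
    by (induction s; induction t) (simp add: plus_tensor_power.abs_eq eq L.add)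
  moreover have "tensor_power_lift F (c *\<^sub>C t) = c *\<^sub>C tensor_power_lift F t" for c t
    by (induction t) (simp add: scaleC_tensor_power.abs_eq eq L.scale)
  ultimately show "clinear (tensor_power_lift F)" by (simp add: clinear_iff)
qed

definition tens_cons :: "'a::complex_vector \<Rightarrow> 'a tensor_power \<Rightarrow> 'a tensor_power"
  where "tens_cons a = tensor_power_lift (\<lambda>xs. tens_list (a # xs))"

lemma tens_cons_tens_list: "tens_cons a (tens_list xs) = tens_list (a # xs)"
proof -
  have "list_multilinear (\<lambda>xs. tens_list (a # xs))"
    unfolding list_multilinear_def
  proof (intro allI)
    fix xs ys
    show "clinear (\<lambda>b. tens_list (a # xs @ b # ys))"
      using list_multilinear_tens_list[unfolded list_multilinear_def, rule_format, of "a # xs" ys] by simp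
  qed
  then show ?thesis by (simp add: tens_cons_def tensor_power_lift_tens_list)
qed


section \<open>Hopf algebras, \<open>H\<close>-categories and SAYD modules\<close>

record (overloaded) ('h::complex_vector) hopf =
  comult :: "'h \<Rightarrow> ('h, 'h) tensor"
  counit :: "'h \<Rightarrow> complex"
  antipode :: "'h \<Rightarrow> 'h"

definition tensor_mult ::
  "('a::complex_algebra_1, 'b::complex_algebra_1) tensor \<Rightarrow> ('a, 'b) tensor \<Rightarrow> ('a, 'b) tensor"
  where "tensor_mult s t = tensor_lift (\<lambda>a b. tensor_lift (\<lambda>c d. (a * c) \<otimes> (b * d)) t) s"

locale hopf_algebra =
  fixes H :: "('h::complex_algebra_1) hopf"
  assumes comult_linear: "clinear (comult H)"
    and counit_linear: "clinear (counit H)"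
    and antipode_linear: "clinear (antipode H)"
    and coassoc:
      "tensor_lift (\<lambda>h1 h2. tensor_lift (\<lambda>h11 h12. h11 \<otimes> (h12 \<otimes> h2)) (comult H h1)) (comult H h)
        = tensor_lift (\<lambda>h1 h2. h1 \<otimes> comult H h2) (comult H h)"
    and counit_left: "tensor_lift (\<lambda>h1 h2. counit H h1 *\<^sub>C h2) (comult H h) = h"
    and counit_right: "tensor_lift (\<lambda>h1 h2. counit H h2 *\<^sub>C h1) (comult H h) = h"
    and comult_mult: "comult H (g * h) = tensor_mult (comult H g) (comult H h)"
    and comult_one: "comult H 1 = 1 \<otimes> 1"
    and counit_mult: "counit H (g * h) = counit H g * counit H h"
    and counit_one: "counit H 1 = 1"
    and antipode_left: "tensor_lift (\<lambda>h1 h2. antipode H h1 * h2) (comult H h) = counit H h *\<^sub>C 1"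
    and antipode_right: "tensor_lift (\<lambda>h1 h2. h1 * antipode H h2) (comult H h) = counit H h *\<^sub>C 1"

text \<open>
  The spaces \<open>Hom X Y\<close> are subspaces of one ambient space \<open>'f\<close>, for instance of the direct sum
  of all of them. They may overlap, hence all operations carry their objects:
  \<open>Comp D X Y Z g f\<close> is the composite \<open>g \<circ> f\<close> of \<open>f \<in> Hom X Y\<close> and \<open>g \<in> Hom Y Z\<close>,
  and \<open>Act D X Y h f\<close> is \<open>h f\<close> for \<open>f \<in> Hom X Y\<close>.
\<close>

record ('o, 'f, 'h) hcat =
  Ob :: "'o set"
  Hom :: "'o \<Rightarrow> 'o \<Rightarrow> 'f set"
  Comp :: "'o \<Rightarrow> 'o \<Rightarrow> 'o \<Rightarrow> 'f \<Rightarrow> 'f \<Rightarrow> 'f"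
  Id :: "'o \<Rightarrow> 'f"
  Act :: "'o \<Rightarrow> 'o \<Rightarrow> 'h \<Rightarrow> 'f \<Rightarrow> 'f"

locale left_H_category =
  fixes H :: "('h::complex_algebra_1) hopf"
    and D :: "('o, 'f::complex_vector, 'h) hcat"
  assumes Hom_subspace: "\<lbrakk>X \<in> Ob D; Y \<in> Ob D\<rbrakk> \<Longrightarrow> cv.subspace (Hom D X Y)"
    and Comp_in_Hom: "\<lbrakk>X \<in> Ob D; Y \<in> Ob D; Z \<in> Ob D; f \<in> Hom D X Y; g \<in> Hom D Y Z\<rbrakk>
      \<Longrightarrow> Comp D X Y Z g f \<in> Hom D X Z"
    and Comp_linear_left: "\<lbrakk>X \<in> Ob D; Y \<in> Ob D; Z \<in> Ob D; f \<in> Hom D X Y\<rbrakk>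
      \<Longrightarrow> clinear_on (Hom D Y Z) (\<lambda>g. Comp D X Y Z g f)"
    and Comp_linear_right: "\<lbrakk>X \<in> Ob D; Y \<in> Ob D; Z \<in> Ob D; g \<in> Hom D Y Z\<rbrakk>
      \<Longrightarrow> clinear_on (Hom D X Y) (\<lambda>f. Comp D X Y Z g f)"
    and Comp_assoc: "\<lbrakk>W \<in> Ob D; X \<in> Ob D; Y \<in> Ob D; Z \<in> Ob D;
        f \<in> Hom D W X; g \<in> Hom D X Y; k \<in> Hom D Y Z\<rbrakk>
      \<Longrightarrow> Comp D W X Z (Comp D X Y Z k g) f = Comp D W Y Z k (Comp D W X Y g f)"
    and Id_in_Hom: "X \<in> Ob D \<Longrightarrow> Id D X \<in> Hom D X X"
    and Id_left: "\<lbrakk>X \<in> Ob D; Y \<in> Ob D; f \<in> Hom D X Y\<rbrakk> \<Longrightarrow> Comp D X Y Y (Id D Y) f = f"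
    and Id_right: "\<lbrakk>X \<in> Ob D; Y \<in> Ob D; f \<in> Hom D X Y\<rbrakk> \<Longrightarrow> Comp D X X Y f (Id D X) = f"
    and Act_in_Hom: "\<lbrakk>X \<in> Ob D; Y \<in> Ob D; f \<in> Hom D X Y\<rbrakk> \<Longrightarrow> Act D X Y h f \<in> Hom D X Y"
    and Act_linear_left: "\<lbrakk>X \<in> Ob D; Y \<in> Ob D; f \<in> Hom D X Y\<rbrakk> \<Longrightarrow> clinear (\<lambda>h. Act D X Y h f)"
    and Act_linear_right: "\<lbrakk>X \<in> Ob D; Y \<in> Ob D\<rbrakk> \<Longrightarrow> clinear_on (Hom D X Y) (Act D X Y h)"
    and Act_one: "\<lbrakk>X \<in> Ob D; Y \<in> Ob D; f \<in> Hom D X Y\<rbrakk> \<Longrightarrow> Act D X Y 1 f = f"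
    and Act_mult: "\<lbrakk>X \<in> Ob D; Y \<in> Ob D; f \<in> Hom D X Y\<rbrakk>
      \<Longrightarrow> Act D X Y (h * h') f = Act D X Y h (Act D X Y h' f)"
    and Act_Id: "X \<in> Ob D \<Longrightarrow> Act D X X h (Id D X) = counit H h *\<^sub>C Id D X"
    and Act_Comp: "\<lbrakk>X \<in> Ob D; Y \<in> Ob D; Z \<in> Ob D; f \<in> Hom D X Y; g \<in> Hom D Y Z\<rbrakk>
      \<Longrightarrow> Act D X Z h (Comp D X Y Z g f)
          = tensor_lift (\<lambda>h1 h2. Comp D X Y Z (Act D Y Z h1 g) (Act D X Y h2 f)) (comult H h)"

locale H_linear_semifunctor =
  fixes D :: "('o, 'f::complex_vector, 'h) hcat"
    and E :: "('p, 'g::complex_vector, 'h) hcat"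
    and Fo :: "'o \<Rightarrow> 'p"
    and F :: "'o \<Rightarrow> 'o \<Rightarrow> 'f \<Rightarrow> 'g"
  assumes F_ob: "X \<in> Ob D \<Longrightarrow> Fo X \<in> Ob E"
    and F_hom: "\<lbrakk>X \<in> Ob D; Y \<in> Ob D; f \<in> Hom D X Y\<rbrakk> \<Longrightarrow> F X Y f \<in> Hom E (Fo X) (Fo Y)"
    and F_linear: "\<lbrakk>X \<in> Ob D; Y \<in> Ob D\<rbrakk> \<Longrightarrow> clinear_on (Hom D X Y) (F X Y)"
    and F_act: "\<lbrakk>X \<in> Ob D; Y \<in> Ob D; f \<in> Hom D X Y\<rbrakk>
      \<Longrightarrow> F X Y (Act D X Y h f) = Act E (Fo X) (Fo Y) h (F X Y f)"
    and F_comp: "\<lbrakk>X \<in> Ob D; Y \<in> Ob D; Z \<in> Ob D; f \<in> Hom D X Y; g \<in> Hom D Y Z\<rbrakk>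
      \<Longrightarrow> F X Z (Comp D X Y Z g f) = Comp E (Fo X) (Fo Y) (Fo Z) (F Y Z g) (F X Y f)"

record (overloaded) ('m::complex_vector, 'h::complex_vector) sayd =
  ract :: "'m \<Rightarrow> 'h \<Rightarrow> 'm"
  coact :: "'m \<Rightarrow> ('h, 'm) tensor"

locale sayd_module =
  fixes H :: "('h::complex_algebra_1) hopf"
    and M :: "('m::complex_vector, 'h) sayd"
  assumes ract_bilinear: "cbilinear (ract M)"
    and ract_one: "ract M m 1 = m"
    and ract_mult: "ract M m (g * h) = ract M (ract M m g) h"
    and coact_linear: "clinear (coact M)"
    and coact_coassoc:
      "tensor_lift (\<lambda>a m0. tensor_lift (\<lambda>a1 a2. a1 \<otimes> (a2 \<otimes> m0)) (comult H a)) (coact M m)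
        = tensor_lift (\<lambda>a m0. a \<otimes> coact M m0) (coact M m)"
    and coact_counit: "tensor_lift (\<lambda>a m0. counit H a *\<^sub>C m0) (coact M m) = m"
    and anti_yetter_drinfeld:
      "coact M (ract M m h) =
        tensor_lift (\<lambda>h1 h'. tensor_lift (\<lambda>h2 h3. tensor_lift (\<lambda>a m0.
          (antipode H h3 * a * h1) \<otimes> ract M m0 h2) (coact M m)) (comult H h')) (comult H h)"
    and stable: "tensor_lift (\<lambda>a m0. ract M m0 a) (coact M m) = m"


section \<open>The category \<open>D \<otimes> M\<^sub>2(k)\<close> and inner automorphisms\<close>

definition matrix_unit :: "2 \<Rightarrow> 2 \<Rightarrow> complex ^ 2 ^ 2"
  where "matrix_unit i j = (\<chi> k l. if k = i \<and> l = j then 1 else 0)"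

definition entry :: "2 \<Rightarrow> 2 \<Rightarrow> ('f::complex_vector, complex ^ 2 ^ 2) tensor \<Rightarrow> 'f"
  where "entry i j = tensor_lift (\<lambda>f B. (B $ i $ j) *\<^sub>C f)"

text \<open>
  Composition and action are written out on components, because composition in \<open>D\<close> is bilinear
  only on the subspaces \<open>Hom\<close>; see \<open>mat2_Comp_tens\<close> and \<open>mat2_Act_tens\<close> for
  \<open>(g \<otimes> B)(f \<otimes> C) = gf \<otimes> BC\<close> and \<open>h(f \<otimes> B) = hf \<otimes> B\<close>.
\<close>

definition mat2 :: "('o, 'f::complex_vector, 'h) hcat
    \<Rightarrow> ('o, ('f, complex ^ 2 ^ 2) tensor, 'h) hcat"
  where "mat2 D =
    \<lparr> Ob = Ob D,
      Hom = (\<lambda>X Y. cv.span {f \<otimes> B | f B. f \<in> Hom D X Y}),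
      Comp = (\<lambda>X Y Z s t. \<Sum>i\<in>UNIV. \<Sum>j\<in>UNIV. \<Sum>l\<in>UNIV.
        Comp D X Y Z (entry i l s) (entry l j t) \<otimes> matrix_unit i j),
      Id = (\<lambda>X. Id D X \<otimes> mat 1),
      Act = (\<lambda>X Y h t. \<Sum>i\<in>UNIV. \<Sum>j\<in>UNIV. Act D X Y h (entry i j t) \<otimes> matrix_unit i j) \<rparr>"

lemma entry_tens: "entry i j (f \<otimes> B) = (B $ i $ j) *\<^sub>C f"
proof -
  have "cbilinear (\<lambda>(f::'a) (B::complex^2^2). (B $ i $ j) *\<^sub>C f)"
    by (simp add: cbilinear_def clinear_iff scaleC_add_left scaleC_add_right scaleC_scaleC
        scaleC_vec_def scaleC_complex_def mult.commute)
  then show ?thesis by (simp add: entry_def tensor_lift_tens)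
qed

lemma sum_tens_matrix_unit:
  "(\<Sum>i\<in>UNIV. \<Sum>j\<in>UNIV. ((B $ i $ j) *\<^sub>C f) \<otimes> matrix_unit i j) = f \<otimes> B"
proof -
  interpret L: Vector_Spaces.linear scaleC scaleC "\<lambda>B :: complex^2^2. f \<otimes> B"
    by (rule clinear_tens_right)
  have "((B $ i $ j) *\<^sub>C f) \<otimes> matrix_unit i j = f \<otimes> ((B $ i $ j) *\<^sub>C matrix_unit i j)" for i j
    using clinear_tens_left[where 'a='a and b = "matrix_unit i j"] L.scale by (simp add: clinear_iff)
  moreover have "(\<Sum>i\<in>UNIV. \<Sum>j\<in>UNIV. (B $ i $ j) *\<^sub>C matrix_unit i j) = B"
    by (simp add: vec_eq_iff scaleC_vec_def scaleC_complex_def matrix_unit_def sum_2 forall_2)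
  ultimately show ?thesis by (simp add: L.sum[symmetric])
qed

lemma (in left_H_category) mat2_Comp_tens:
  assumes "X \<in> Ob D" "Y \<in> Ob D" "Z \<in> Ob D" "f \<in> Hom D X Y" "g \<in> Hom D Y Z"
  shows "Comp (mat2 D) X Y Z (g \<otimes> B) (f \<otimes> C) = Comp D X Y Z g f \<otimes> (B ** C)"
proof -
  interpret L: Vector_Spaces.linear scaleC scaleC "\<lambda>a. a \<otimes> E" for E :: "complex^2^2"
    by (rule clinear_tens_left)
  have "Comp D X Y Z (c *\<^sub>C g) (d *\<^sub>C f) = (c * d) *\<^sub>C Comp D X Y Z g f" for c d
  proof -
    have "d *\<^sub>C f \<in> Hom D X Y" using assms Hom_subspace cv.subspace_scale by blast
    then show ?thesis
      using assms Comp_linear_left[of X Y Z "d *\<^sub>C f"] Comp_linear_right[of X Y Z g]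
      by (simp add: clinear_on_def scaleC_scaleC)
  qed
  then have "Comp (mat2 D) X Y Z (g \<otimes> B) (f \<otimes> C) =
      (\<Sum>i\<in>UNIV. \<Sum>j\<in>UNIV. (((B ** C) $ i $ j) *\<^sub>C Comp D X Y Z g f) \<otimes> matrix_unit i j)"
    by (simp add: mat2_def entry_tens L.sum[symmetric] cv.scale_sum_left[symmetric]
        matrix_matrix_mult_def)
  then show ?thesis by (simp only: sum_tens_matrix_unit)
qed

lemma (in left_H_category) mat2_Act_tens:
  assumes "X \<in> Ob D" "Y \<in> Ob D" "f \<in> Hom D X Y"
  shows "Act (mat2 D) X Y h (f \<otimes> B) = Act D X Y h f \<otimes> B"
proof -
  have "Act D X Y h (c *\<^sub>C f) = c *\<^sub>C Act D X Y h f" for c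
    using assms Act_linear_right[of X Y h] by (simp add: clinear_on_def)
  then show ?thesis by (simp add: mat2_def entry_tens sum_tens_matrix_unit)
qed

definition Aut :: "('o, 'f, 'h) hcat \<Rightarrow> 'o \<Rightarrow> 'f set"
  where "Aut E X = {f \<in> Hom E X X. \<exists>g \<in> Hom E X X.
    Comp E X X X g f = Id E X \<and> Comp E X X X f g = Id E X}"

definition inverse_mor :: "('o, 'f, 'h) hcat \<Rightarrow> 'o \<Rightarrow> 'f \<Rightarrow> 'f"
  where "inverse_mor E X f = (THE g. g \<in> Hom E X X \<and>
    Comp E X X X g f = Id E X \<and> Comp E X X X f g = Id E X)"

definition invariant_units ::
  "('h::complex_algebra_1) hopf \<Rightarrow> ('o, 'f::complex_vector, 'h) hcat \<Rightarrow> ('o \<Rightarrow> 'f) set"  (\<open>\<U>\<close>)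
  where "\<U> H E = {\<eta>. \<forall>X\<in>Ob E. \<eta> X \<in> Aut E X \<and> (\<forall>h. Act E X X h (\<eta> X) = counit H h *\<^sub>C \<eta> X)}"

text \<open>The map on \<open>Hom X Y\<close> of the functor \<open>\<Phi>\<^sub>\<eta>\<close>, which fixes objects.\<close>

definition inner_functor ::
  "('o, 'f, 'h) hcat \<Rightarrow> ('o \<Rightarrow> 'f) \<Rightarrow> 'o \<Rightarrow> 'o \<Rightarrow> 'f \<Rightarrow> 'f"  (\<open>\<Phi>\<close>)
  where "\<Phi> E \<eta> X Y f = Comp E X Y Y (\<eta> Y) (Comp E X X Y f (inverse_mor E X (\<eta> X)))"


section \<open>Hopf-cyclic cohomology\<close>

type_synonym ('m, 'o, 'f) chain = "('m, 'o list \<Rightarrow>\<^sub>0 'f tensor_power) tensor"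

text \<open>
  A generator of \<open>CN\<^sub>n(D)\<close> is given by lists \<open>Xs = [X\<^sub>0, \<dots>, X\<^sub>n]\<close> and
  \<open>fs = [f\<^sup>0, \<dots>, f\<^sup>n]\<close> with \<open>f\<^sup>i \<in> Hom X\<^sub>i\<^sub>+\<^sub>1 X\<^sub>i\<close>, indices modulo \<open>n + 1\<close>.
\<close>

definition cyc_strings :: "('o, 'f, 'h) hcat \<Rightarrow> nat \<Rightarrow> ('o list \<times> 'f list) set"
  where "cyc_strings D n = {(Xs, fs). length Xs = n + 1 \<and> length fs = n + 1 \<and> set Xs \<subseteq> Ob D \<and>
    (\<forall>i\<le>n. fs ! i \<in> Hom D (Xs ! ((i + 1) mod (n + 1))) (Xs ! i))}"

text \<open>The summand of \<open>CN\<^sub>n(D)\<close> at \<open>Xs\<close> is the image of \<open>Poly_Mapping.single Xs\<close>.\<close>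

definition CN :: "('o, 'f::complex_vector, 'h) hcat \<Rightarrow> nat \<Rightarrow> ('o list \<Rightarrow>\<^sub>0 'f tensor_power) set"
  where "CN D n = cv.span {Poly_Mapping.single Xs (tens_list fs) | Xs fs. (Xs, fs) \<in> cyc_strings D n}"

definition MCN :: "('o, 'f::complex_vector, 'h) hcat \<Rightarrow> nat \<Rightarrow> ('m::complex_vector, 'o, 'f) chain set"
  where "MCN D n = cv.span {m \<otimes> c | m c. c \<in> CN D n}"

definition gen :: "'m::complex_vector \<Rightarrow> 'o list \<Rightarrow> 'f::complex_vector tensor_power
    \<Rightarrow> ('m, 'o, 'f) chain"
  where "gen m Xs t = m \<otimes> Poly_Mapping.single Xs t"

text \<open>
  Linear functionals on \<open>M \<otimes> CN\<^sub>n(D)\<close>. They are set to zero outside this subspace of the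
  ambient type, so that functionals agreeing on \<open>M \<otimes> CN\<^sub>n(D)\<close> are equal.
\<close>

definition functionals ::
  "('o, 'f::complex_vector, 'h) hcat \<Rightarrow> nat \<Rightarrow> (('m::complex_vector, 'o, 'f) chain \<Rightarrow> complex) set"
  where "functionals D n = {\<phi>. clinear_on (MCN D n) \<phi> \<and> (\<forall>x. x \<notin> MCN D n \<longrightarrow> \<phi> x = 0)}"

definition extend_functional ::
  "('o, 'f::complex_vector, 'h) hcat \<Rightarrow> nat \<Rightarrow> ('m::complex_vector \<Rightarrow> 'o list \<Rightarrow> 'f list \<Rightarrow> complex)
    \<Rightarrow> ('m, 'o, 'f) chain \<Rightarrow> complex"
  where "extend_functional D n F = (THE \<psi>. \<psi> \<in> functionals D n \<and>
    (\<forall>m. \<forall>(Xs, fs) \<in> cyc_strings D n. \<psi> (gen m Xs (tens_list fs)) = F m Xs fs))"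

text \<open>
  The universal property of \<open>M \<otimes> CN\<^sub>n(D)\<close>: a family of maps that are linear in \<open>m\<close> and in each
  \<open>f\<^sup>i\<close> extends uniquely to a linear functional.
\<close>

lemma MCN_eq: "MCN D n = cv.span {gen m Xs (tens_list fs) | m Xs fs. (Xs, fs) \<in> cyc_strings D n}"
  (is "_ = cv.span ?G")
proof
  have "m \<otimes> c \<in> cv.span ?G" if "c \<in> CN D n" for m :: 'a and c
  proof -
    interpret L: Vector_Spaces.linear scaleC scaleC "\<lambda>c. m \<otimes> c"
      by (rule clinear_tens_right)
    from that show ?thesis unfolding CN_def
    proof (induction rule: cv.span_induct_alt)
      case base
      then show ?case by (simp add: L.zero cv.span_zero)
    next
      case (step c x y)
      then have "m \<otimes> x \<in> ?G" by (auto simp: gen_def)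
      then show ?case using step
        by (simp add: L.add L.scale cv.span_add cv.span_scale cv.span_base)
    qed
  qed
  then show "MCN D n \<subseteq> cv.span ?G"
    unfolding MCN_def by (intro cv.span_minimal) auto
  have "?G \<subseteq> {m \<otimes> c | m c. c \<in> CN D n}"
    unfolding gen_def CN_def by (force intro: cv.span_base)
  then show "cv.span ?G \<subseteq> MCN D n"
    unfolding MCN_def by (rule cv.span_mono)
qed

lemma functionals_eqI:
  assumes "\<phi> \<in> functionals D n" "\<psi> \<in> functionals D n"
    and "\<And>m Xs fs. (Xs, fs) \<in> cyc_strings D n
      \<Longrightarrow> \<phi> (gen m Xs (tens_list fs)) = \<psi> (gen m Xs (tens_list fs))"
  shows "\<phi> = \<psi>"
proof
  fix x
  let ?G = "{gen m Xs (tens_list fs) | m Xs fs. (Xs, fs) \<in> cyc_strings D n}"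
  note lin = assms(1,2)[unfolded functionals_def clinear_on_def mem_Collect_eq]
  show "\<phi> x = \<psi> x"
  proof (cases "x \<in> MCN D n")
    case False
    then show ?thesis using lin by simp
  next
    case True
    have zero: "0 \<in> MCN D n" by (simp add: MCN_def cv.span_zero)
    have "x \<in> MCN D n \<and> \<phi> x = \<psi> x"
      using True[unfolded MCN_eq]
    proof (induction rule: cv.span_induct_alt)
      case base
      have "\<phi> (0 *\<^sub>C 0) = 0 *\<^sub>C \<phi> 0" "\<psi> (0 *\<^sub>C 0) = 0 *\<^sub>C \<psi> 0" using lin zero by blast+
      then show ?case using zero by simp
    next
      case (step c x y)
      then have x: "x \<in> MCN D n" "\<phi> x = \<psi> x"
        unfolding MCN_eq using assms(3) by (auto intro: cv.span_base)
      then have cx: "c *\<^sub>C x \<in> MCN D n" by (simp add: MCN_def cv.span_scale)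
      moreover have "\<phi> (c *\<^sub>C x) = \<psi> (c *\<^sub>C x)" using lin x by simp
      ultimately have "\<phi> (c *\<^sub>C x + y) = \<psi> (c *\<^sub>C x + y)" using lin step(2) by simp
      then show ?case using cx step(2) by (simp add: MCN_def cv.span_add)
    qed
    then show ?thesis by simp
  qed
qed

lemma exists_linear_projection:
  assumes "cv.subspace V"
  shows "\<exists>P. clinear P \<and> range P \<subseteq> V \<and> (\<forall>v\<in>V. P v = v)"
proof -
  interpret vector_space_pair "scaleC :: complex \<Rightarrow> 'a \<Rightarrow> 'a" "scaleC :: complex \<Rightarrow> 'a \<Rightarrow> 'a" ..
  show ?thesis
    using linear_exists_left_inverse_on[of "\<lambda>x. x" V] assms by (auto simp: clinear_iff)
qed

lemma (in left_H_category)
  fixes F :: "'m::complex_vector \<Rightarrow> 'o list \<Rightarrow> 'f list \<Rightarrow> complex"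
  assumes F_m: "\<And>Xs fs. (Xs, fs) \<in> cyc_strings D n \<Longrightarrow> clinear (\<lambda>m. F m Xs fs)"
    and F_f: "\<And>m Xs fs i. \<lbrakk>(Xs, fs) \<in> cyc_strings D n; i \<le> n\<rbrakk>
      \<Longrightarrow> clinear_on (Hom D (Xs ! ((i + 1) mod (n + 1))) (Xs ! i)) (\<lambda>f. F m Xs (fs[i := f]))"
  shows extend_functional_in: "extend_functional D n F \<in> functionals D n"
    and extend_functional_gen: "(Xs, fs) \<in> cyc_strings D n
      \<Longrightarrow> extend_functional D n F (gen m Xs (tens_list fs)) = F m Xs fs"
proof -
  define P where "P = (\<lambda>X Y. SOME P. clinear P \<and> range P \<subseteq> Hom D X Y \<and> (\<forall>v\<in>Hom D X Y. P v = v))"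
  have P: "clinear (P X Y)" "P X Y f \<in> Hom D X Y" "f \<in> Hom D X Y \<Longrightarrow> P X Y f = f"
    if "X \<in> Ob D" "Y \<in> Ob D" for X Y f
    using someI_ex[OF exists_linear_projection[OF Hom_subspace[OF that]]]
    unfolding P_def by auto
  define pr where "pr = (\<lambda>Xs fs. map (\<lambda>i. P (Xs ! ((i + 1) mod (n + 1))) (Xs ! i) (fs ! i)) [0..<n + 1])"
  define G where "G = (\<lambda>m Xs fs. if length Xs = n + 1 \<and> set Xs \<subseteq> Ob D \<and> length fs = n + 1
    then F m Xs (pr Xs fs) else 0)"
  have ob: "Xs ! (i mod (n + 1)) \<in> Ob D" if "length Xs = n + 1" "set Xs \<subseteq> Ob D" for Xs i
  proof -
    have "i mod (n + 1) < length Xs" using that by simp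
    then show ?thesis using that nth_mem by blast
  qed
  have ob': "Xs ! i \<in> Ob D" if "length Xs = n + 1" "set Xs \<subseteq> Ob D" "i \<le> n" for Xs i
    using ob[OF that(1,2), of i] that(3) by simp
  have pr: "(Xs, pr Xs fs) \<in> cyc_strings D n" if "length Xs = n + 1" "set Xs \<subseteq> Ob D" for Xs fs
    using that P(2) ob ob' unfolding cyc_strings_def pr_def
    by (auto simp del: upt_Suc simp: less_Suc_eq_le)
  have G_cyc: "G m Xs fs = F m Xs fs" if "(Xs, fs) \<in> cyc_strings D n" for m Xs fs
  proof -
    have "pr Xs fs = fs"
      using that P(3) ob ob' unfolding cyc_strings_def pr_def
      by (intro nth_equalityI) (auto simp del: upt_Suc simp: less_Suc_eq_le)
    then show ?thesis using that by (simp add: G_def cyc_strings_def)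
  qed
  have G_m: "clinear (\<lambda>m. G m Xs fs)" for Xs fs
    using F_m[OF pr, of Xs fs] by (auto simp: G_def clinear_iff)
  have G_f: "list_multilinear (G m Xs)" for m Xs
    unfolding list_multilinear_def
  proof (intro allI)
    fix xs ys
    show "clinear (\<lambda>a. G m Xs (xs @ a # ys))"
    proof (cases "length Xs = n + 1 \<and> set Xs \<subseteq> Ob D \<and> length (xs @ undefined # ys) = n + 1")
      case False
      then show ?thesis by (auto simp: G_def clinear_iff)
    next
      case True
      let ?i = "length xs"
      let ?X = "Xs ! ((?i + 1) mod (n + 1))" and ?Y = "Xs ! ?i"
      define gs where "gs = pr Xs (xs @ 0 # ys)"
      have i: "?i \<le> n" using True by simp
      have "pr Xs (xs @ a # ys) = gs[?i := P ?X ?Y a]" for a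
        using i unfolding gs_def pr_def
        by (intro nth_equalityI) (auto simp del: upt_Suc simp: nth_list_update nth_append nth_Cons')
      then have "G m Xs (xs @ a # ys) = F m Xs (gs[?i := P ?X ?Y a])" for a
        using True by (simp add: G_def)
      moreover have "clinear_on (Hom D ?X ?Y) (\<lambda>f. F m Xs (gs[?i := f]))"
        using F_f[OF pr i] True unfolding gs_def by blast
      moreover have "?X \<in> Ob D" "?Y \<in> Ob D" using ob ob' i True by blast+
      ultimately show ?thesis
        using P(1,2)[of ?X ?Y] by (simp add: clinear_iff clinear_on_def)
    qed
  qed
  define L where "L = (\<lambda>m p. \<Sum>Xs\<in>Poly_Mapping.keys p. tensor_power_lift (G m Xs) (Poly_Mapping.lookup p Xs))"
  note lift = clinear_tensor_power_lift[OF G_f, unfolded clinear_iff]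
  have lift0: "tensor_power_lift (G m Xs) 0 = 0" for m Xs
    using lift[THEN conjunct2, rule_format, of m Xs 0 0] by simp
  have L_super: "L m p = (\<Sum>Xs\<in>A. tensor_power_lift (G m Xs) (Poly_Mapping.lookup p Xs))"
    if "finite A" "Poly_Mapping.keys p \<subseteq> A" for m p A
    unfolding L_def using that
    by (intro sum.mono_neutral_left) (auto simp: in_keys_iff lift0)
  have "L m (p + q) = L m p + L m q" for m p q
  proof -
    let ?A = "Poly_Mapping.keys p \<union> Poly_Mapping.keys q"
    have "Poly_Mapping.keys (p + q) \<subseteq> ?A" by (rule keys_add)
    then show ?thesis by (simp add: L_super[of ?A] lookup_add lift sum.distrib)
  qed
  moreover have "L m (c *\<^sub>C p) = c *\<^sub>C L m p" for m c p
  proof -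
    have "Poly_Mapping.keys (c *\<^sub>C p) \<subseteq> Poly_Mapping.keys p"
      by (auto simp: in_keys_iff lookup_scaleC)
    then show ?thesis
      by (simp add: L_super[of "Poly_Mapping.keys p"] lookup_scaleC lift cv.scale_sum_right)
  qed
  moreover have "L (m + m') p = L m p + L m' p" "L (c *\<^sub>C m) p = c *\<^sub>C L m p" for m m' c p
    using G_m unfolding L_def tensor_power_lift_def free_lift_def clinear_iff
    by (simp_all add: sum.distrib scaleC_add_right cv.scale_sum_right scaleC_scaleC mult.commute)
  ultimately have bil: "cbilinear L" by (simp add: cbilinear_def clinear_iff)
  define \<psi> where "\<psi> = (\<lambda>x :: ('m, 'o, 'f) chain. if x \<in> MCN D n then tensor_lift L x else 0)"
  have "\<psi> \<in> functionals D n"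
    using clinear_tensor_lift[OF bil]
    by (auto simp: functionals_def \<psi>_def clinear_on_def clinear_iff MCN_def cv.span_add cv.span_scale)
  moreover have "\<psi> (gen m Xs (tens_list fs)) = F m Xs fs" if "(Xs, fs) \<in> cyc_strings D n" for m Xs fs
  proof -
    have "gen m Xs (tens_list fs) \<in> MCN D n"
      unfolding MCN_eq using that by (auto intro: cv.span_base)
    moreover have "L m (Poly_Mapping.single Xs t) = tensor_power_lift (G m Xs) t" for t
      using L_super[of "{Xs}" "Poly_Mapping.single Xs t" m] by (simp split: if_splits)
    ultimately show ?thesis
      by (simp add: \<psi>_def gen_def tensor_lift_tens[OF bil] tensor_power_lift_tens_list[OF G_f] G_cyc that)
  qed
  ultimately have "\<exists>!\<psi>. \<psi> \<in> functionals D n \<and>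
      (\<forall>m. \<forall>(Xs, fs) \<in> cyc_strings D n. \<psi> (gen m Xs (tens_list fs)) = F m Xs fs)"
    by (intro ex1I[of _ \<psi>]) (fastforce intro!: functionals_eqI)+
  from theI'[OF this, folded extend_functional_def]
  show "extend_functional D n F \<in> functionals D n"
    and "(Xs, fs) \<in> cyc_strings D n \<Longrightarrow> extend_functional D n F (gen m Xs (tens_list fs)) = F m Xs fs"
    by auto
qed

text \<open>\<open>diag_act H [g\<^sub>0, \<dots>, g\<^sub>n] h = g\<^sub>0 h\<^sub>1 \<otimes> \<dots> \<otimes> g\<^sub>n h\<^sub>n\<^sub>+\<^sub>1\<close>\<close>

fun diag_act :: "('h::complex_algebra_1) hopf \<Rightarrow> ('h \<Rightarrow> 'f::complex_vector) list \<Rightarrow> 'h \<Rightarrow> 'f tensor_power"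
  where
    "diag_act H [] h = counit H h *\<^sub>C tens_list []"
  | "diag_act H (g # gs) h =
      tensor_lift (\<lambda>h1 h2. tens_cons (g h1) (diag_act H gs h2)) (comult H h)"

definition string_act :: "('h::complex_algebra_1) hopf \<Rightarrow> ('o, 'f::complex_vector, 'h) hcat
    \<Rightarrow> 'h \<Rightarrow> 'o list \<Rightarrow> 'f list \<Rightarrow> 'f tensor_power"
  where "string_act H D h Xs fs = diag_act H
    (map (\<lambda>i h. Act D (Xs ! ((i + 1) mod length Xs)) (Xs ! i) h (fs ! i)) [0..<length fs]) h"

definition cochains ::
  "('h::complex_algebra_1) hopf \<Rightarrow> ('o, 'f::complex_vector, 'h) hcat \<Rightarrow> ('m::complex_vector, 'h) sayd
    \<Rightarrow> nat \<Rightarrow> (('m, 'o, 'f) chain \<Rightarrow> complex) set"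
  where "cochains H D M n = {\<phi> \<in> functionals D n. \<forall>h m. \<forall>(Xs, fs) \<in> cyc_strings D n.
    tensor_lift (\<lambda>h1 h2. \<phi> (gen (ract M m h1) Xs (string_act H D (antipode H h2) Xs fs))) (comult H h)
      = counit H h * \<phi> (gen m Xs (tens_list fs))}"

text \<open>
  \<open>coface H D M n i\<close> is the operator \<open>\<delta>\<^sub>i\<close> with values in degree \<open>n\<close>,
  where \<open>n \<ge> 1\<close> and \<open>i \<le> n\<close>. For \<open>i < n\<close> it composes \<open>f\<^sup>i : X\<^sub>i\<^sub>+\<^sub>1 \<rightarrow> X\<^sub>i\<close> with
  \<open>f\<^sup>i\<^sup>+\<^sup>1 : X\<^sub>i\<^sub>+\<^sub>2 \<rightarrow> X\<^sub>i\<^sub>+\<^sub>1\<close> and removes \<open>X\<^sub>i\<^sub>+\<^sub>1\<close>.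
  For \<open>i = n\<close> it composes \<open>f\<^sup>0 : X\<^sub>1 \<rightarrow> X\<^sub>0\<close> with \<open>f\<^sup>n : X\<^sub>0 \<rightarrow> X\<^sub>n\<close> and leaves the string on
  \<open>[X\<^sub>n, X\<^sub>1, \<dots>, X\<^sub>n\<^sub>-\<^sub>1]\<close>.
\<close>

definition coface ::
  "('h::complex_algebra_1) hopf \<Rightarrow> ('o, 'f::complex_vector, 'h) hcat \<Rightarrow> ('m::complex_vector, 'h) sayd
    \<Rightarrow> nat \<Rightarrow> nat \<Rightarrow> (('m, 'o, 'f) chain \<Rightarrow> complex) \<Rightarrow> ('m, 'o, 'f) chain \<Rightarrow> complex"
  where "coface H D M n i \<phi> = extend_functional D n (\<lambda>m Xs fs.
    if i < n then
      \<phi> (gen m (take (i + 1) Xs @ drop (i + 2) Xs)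
        (tens_list (take i fs @
          Comp D (Xs ! ((i + 2) mod (n + 1))) (Xs ! (i + 1)) (Xs ! i) (fs ! i) (fs ! (i + 1))
          # drop (i + 2) fs)))
    else
      tensor_lift (\<lambda>a m0. \<phi> (gen m0 (Xs ! n # butlast (tl Xs))
        (tens_list (Comp D (Xs ! 1) (Xs ! 0) (Xs ! n)
            (Act D (Xs ! 0) (Xs ! n) (inv (antipode H) a) (fs ! n)) (fs ! 0)
          # butlast (tl fs))))) (coact M m))"

definition cyc_op ::
  "('h::complex_algebra_1) hopf \<Rightarrow> ('o, 'f::complex_vector, 'h) hcat \<Rightarrow> ('m::complex_vector, 'h) sayd
    \<Rightarrow> nat \<Rightarrow> (('m, 'o, 'f) chain \<Rightarrow> complex) \<Rightarrow> ('m, 'o, 'f) chain \<Rightarrow> complex"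
  where "cyc_op H D M n \<phi> = extend_functional D n (\<lambda>m Xs fs.
    tensor_lift (\<lambda>a m0. \<phi> (gen m0 (Xs ! n # butlast Xs)
      (tens_list (Act D (Xs ! 0) (Xs ! n) (inv (antipode H) a) (fs ! n) # butlast fs)))) (coact M m))"

definition cyclic_cochains ::
  "('h::complex_algebra_1) hopf \<Rightarrow> ('o, 'f::complex_vector, 'h) hcat \<Rightarrow> ('m::complex_vector, 'h) sayd
    \<Rightarrow> nat \<Rightarrow> (('m, 'o, 'f) chain \<Rightarrow> complex) set"
  where "cyclic_cochains H D M n =
    {\<phi> \<in> cochains H D M n. \<phi> = (\<lambda>x. (- 1) ^ n * cyc_op H D M n \<phi> x)}"

definition bdiff ::
  "('h::complex_algebra_1) hopf \<Rightarrow> ('o, 'f::complex_vector, 'h) hcat \<Rightarrow> ('m::complex_vector, 'h) sayd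
    \<Rightarrow> nat \<Rightarrow> (('m, 'o, 'f) chain \<Rightarrow> complex) \<Rightarrow> ('m, 'o, 'f) chain \<Rightarrow> complex"
  where "bdiff H D M n \<phi> = (\<lambda>x. \<Sum>i\<le>n + 1. (- 1) ^ i * coface H D M (n + 1) i \<phi> x)"

definition cyclic_cocycles ::
  "('h::complex_algebra_1) hopf \<Rightarrow> ('o, 'f::complex_vector, 'h) hcat \<Rightarrow> ('m::complex_vector, 'h) sayd
    \<Rightarrow> nat \<Rightarrow> (('m, 'o, 'f) chain \<Rightarrow> complex) set"
  where "cyclic_cocycles H D M n = {\<phi> \<in> cyclic_cochains H D M n. bdiff H D M n \<phi> = (\<lambda>x. 0)}"

fun cyclic_coboundaries ::
  "('h::complex_algebra_1) hopf \<Rightarrow> ('o, 'f::complex_vector, 'h) hcat \<Rightarrow> ('m::complex_vector, 'h) sayd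
    \<Rightarrow> nat \<Rightarrow> (('m, 'o, 'f) chain \<Rightarrow> complex) set"
  where
    "cyclic_coboundaries H D M 0 = {\<lambda>x. 0}"
  | "cyclic_coboundaries H D M (Suc n) = bdiff H D M n ` cyclic_cochains H D M n"

definition cohomologous ::
  "('h::complex_algebra_1) hopf \<Rightarrow> ('o, 'f::complex_vector, 'h) hcat \<Rightarrow> ('m::complex_vector, 'h) sayd
    \<Rightarrow> nat \<Rightarrow> (('m, 'o, 'f) chain \<Rightarrow> complex) rel"
  where "cohomologous H D M n = {(\<phi>, \<psi>). \<phi> \<in> cyclic_cocycles H D M n \<and>
    \<psi> \<in> cyclic_cocycles H D M n \<and> (\<lambda>x. \<phi> x - \<psi> x) \<in> cyclic_coboundaries H D M n}"

definition HC ::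
  "('h::complex_algebra_1) hopf \<Rightarrow> ('o, 'f::complex_vector, 'h) hcat \<Rightarrow> ('m::complex_vector, 'h) sayd
    \<Rightarrow> nat \<Rightarrow> (('m, 'o, 'f) chain \<Rightarrow> complex) set set"
  where "HC H D M n = cyclic_cocycles H D M n // cohomologous H D M n"

definition HC_zero ::
  "('h::complex_algebra_1) hopf \<Rightarrow> ('o, 'f::complex_vector, 'h) hcat \<Rightarrow> ('m::complex_vector, 'h) sayd
    \<Rightarrow> nat \<Rightarrow> (('m, 'o, 'f) chain \<Rightarrow> complex) set"
  where "HC_zero H D M n = cohomologous H D M n `` {\<lambda>x. 0}"

end

theory Submission
  imports Defs
begin

text \<open>
  Comparing entries in the hypothesis on \<open>\<eta>\<close> gives \<open>H\<close>-invariant endomorphisms \<open>u, v, d, e\<close>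
  of every object with \<open>\<upsilon>(f) = u f v + d \<upsilon>(f) e\<close>, \<open>v u = 1\<close>, \<open>v d = 0\<close>, \<open>e u = 0\<close> and
  \<open>e d \<upsilon>(f) = \<upsilon>(f)\<close>. They yield a path \<open>\<gamma>\<^sub>t\<close>, affine in \<open>t\<close>, of \<open>H\<close>-linear semifunctors from
  \<open>D\<close> to \<open>3 \<times> 3\<close> matrices over \<open>D\<close>. For a cyclic cocycle \<open>\<phi>\<close> the pullback of \<open>\<phi> \<circ> tr\<close> along
  \<open>\<gamma>\<^sub>0\<close> is \<open>\<phi> + \<upsilon>\<^sup>*\<phi>\<close> and along \<open>\<gamma>\<^sub>1\<close> it is \<open>\<upsilon>\<^sup>*\<phi>\<close>. The derivative of \<open>\<gamma>\<^sub>t\<close> is the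
  commutator with a fixed invariant matrix \<open>Y\<close>. Inner derivations act trivially on cyclic
  cohomology: inserting \<open>Y\<close> after each entry with alternating signs produces a cyclic cochain whose
  coboundary is the derivative of \<open>\<phi> \<circ> tr\<close> along \<open>Y\<close>. Since everything is polynomial in \<open>t\<close>,
  integrating over \<open>[0, 1]\<close> writes \<open>\<phi>\<close> as a coboundary.
\<close>

section \<open>Linear maps and tensors\<close>

text \<open>The argument is an Eilenberg swindle: \<open>\<upsilon>\<close> absorbs the identity, so
  \<open>\<phi> + \<upsilon>\<^sup>*\<phi>\<close> and \<open>\<upsilon>\<^sup>*\<phi>\<close> have
  the same class. The equivalence of \<open>id \<oplus> \<upsilon>\<close> with
  \<open>\<upsilon>\<close> is given by rectangular data, the row \<open>(u, d)\<close> and the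
  column with entries \<open>v\<close>, \<open>e\<close>. Putting the two semifunctors into
  complementary diagonal blocks of sizes 2 and 1 leaves room for a straight path between them; this
  is the origin of the size 3. The weights \<open>1 - t\<close> and \<open>t\<close> of the two ends
  add up to 1, which keeps every point of the path multiplicative. Since \<open>\<upsilon>\<close>
  need not preserve identities, \<open>e d = 1\<close> is available only in front of values of
  \<open>\<upsilon>\<close>, and the relations are stated in that form. Invariance of the entries is
  used throughout to replace an action by the counit; this removes the twist by the coaction
  wherever an inserted entry is acted upon. Functionals are linear only on the span of cyclic
  strings. Every operator is therefore described by its values on strings, and equality of
  functionals is tested there.\<close>

lemma clinear_add: "clinear f \<Longrightarrow> f (x + y) = f x + f y"
  and clinear_scale: "clinear f \<Longrightarrow> f (c *\<^sub>C x) = c *\<^sub>C f x"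
  by (simp_all add: clinear_iff)

lemma clinear_zero: "clinear f \<Longrightarrow> f 0 = 0"
  using clinear_scale[of f 0 0] by simp

lemma clinear_sum: "clinear f \<Longrightarrow> f (\<Sum>i\<in>A. g i) = (\<Sum>i\<in>A. f (g i))"
  by (induction A rule: infinite_finite_induct) (simp_all add: clinear_add clinear_zero)

lemma clinear_sum_list: "clinear f \<Longrightarrow> f (\<Sum>i\<leftarrow>xs. g i) = (\<Sum>i\<leftarrow>xs. f (g i))"
  by (induction xs) (simp_all add: clinear_add clinear_zero)

lemma clinear_zero_map: "clinear (\<lambda>x. 0)"
  by (simp add: clinear_iff)

lemma clinear_compose: "clinear f \<Longrightarrow> clinear g \<Longrightarrow> clinear (\<lambda>x. f (g x))"
  by (simp add: clinear_iff)

lemma clinear_inv: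
  assumes "clinear f" "bij f"
  shows "clinear (inv f)"
proof -
  have "inv f (x + y) = inv f x + inv f y" for x y
    by (rule bij_inv_eq_iff[OF assms(2), THEN iffD2, symmetric])
       (simp add: clinear_add[OF assms(1)] bij_is_surj[OF assms(2)] surj_f_inv_f)
  moreover have "inv f (c *\<^sub>C x) = c *\<^sub>C inv f x" for c x
    by (rule bij_inv_eq_iff[OF assms(2), THEN iffD2, symmetric])
       (simp add: clinear_scale[OF assms(1)] bij_is_surj[OF assms(2)] surj_f_inv_f)
  ultimately show ?thesis by (simp add: clinear_iff)
qed

lemma clinear_onD:
  assumes "clinear_on V f"
  shows "x \<in> V \<Longrightarrow> y \<in> V \<Longrightarrow> f (x + y) = f x + f y"
    and "x \<in> V \<Longrightarrow> f (c *\<^sub>C x) = c *\<^sub>C f x"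
  using assms by (simp_all add: clinear_on_def)

lemma clinear_on_zero: "clinear_on V f \<Longrightarrow> cv.subspace V \<Longrightarrow> f 0 = 0"
  using clinear_onD(2)[of V f 0 0] by (simp add: cv.subspace_0)

lemma clinear_on_diff:
  assumes "clinear_on V f" "cv.subspace V" "x \<in> V" "y \<in> V"
  shows "f (x - y) = f x - f y"
proof -
  have "f (x + (-1) *\<^sub>C y) = f x + (-1) *\<^sub>C f y"
    using assms by (simp add: clinear_onD cv.subspace_scale del: cv.scale_minus_left)
  then show ?thesis by simp
qed

lemma clinear_on_sum:
  assumes "clinear_on V f" "cv.subspace V" "\<And>i. i \<in> A \<Longrightarrow> g i \<in> V"
  shows "f (\<Sum>i\<in>A. g i) = (\<Sum>i\<in>A. f (g i))"
  using assms(3)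
proof (induction A rule: infinite_finite_induct)
  case (insert i A)
  then show ?case
    using clinear_onD(1)[OF assms(1), of "g i" "sum g A"] cv.subspace_sum[OF assms(2), of A g] by simp
qed (simp_all add: clinear_on_zero[OF assms(1,2)])

lemma subspace_sum_list:
  assumes "cv.subspace V" "\<And>i. i \<in> set xs \<Longrightarrow> g i \<in> V"
  shows "(\<Sum>i\<leftarrow>xs. g i) \<in> V"
  using assms(2) by (induction xs) (simp_all add: cv.subspace_0[OF assms(1)] cv.subspace_add[OF assms(1)])

lemma clinear_on_sum_list:
  assumes "clinear_on V f" "cv.subspace V" "\<And>i. i \<in> set xs \<Longrightarrow> g i \<in> V"
  shows "f (\<Sum>i\<leftarrow>xs. g i) = (\<Sum>i\<leftarrow>xs. f (g i))"
  using assms(3)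
  by (induction xs)
    (simp_all add: clinear_on_zero[OF assms(1,2)] clinear_onD(1)[OF assms(1)] subspace_sum_list[OF assms(2)])

lemma clinear_on_compose:
  assumes "clinear_on V f" "clinear_on W g" "\<And>x. x \<in> W \<Longrightarrow> g x \<in> V"
  shows "clinear_on W (\<lambda>x. f (g x))"
  using assms by (simp add: clinear_on_def)

lemma clinear_on_id: "clinear_on V (\<lambda>x. x)"
  by (simp add: clinear_on_def)

lemma cbilinearI:
  "(\<And>a. clinear (B a)) \<Longrightarrow> (\<And>b. clinear (\<lambda>a. B a b)) \<Longrightarrow> cbilinear B"
  by (simp add: cbilinear_def)

text \<open>\<open>tensor_lift\<close> sums over one chosen representative of \<open>t\<close>, the
  same for every integrand. It is therefore linear in the integrand, even where the
  \<open>B i\<close> are not bilinear.\<close>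

lemma tensor_lift_sum:
  fixes B :: "'i \<Rightarrow> 'a::complex_vector \<Rightarrow> 'b::complex_vector \<Rightarrow> complex"
  shows "tensor_lift (\<lambda>a b. \<Sum>i\<in>I. c i * B i a b) t = (\<Sum>i\<in>I. c i * tensor_lift (B i) t)"
  unfolding tensor_lift_def free_lift_def
  by (subst sum_distrib_left, subst sum.swap)
     (simp add: case_prod_beta scaleC_complex_def sum_distrib_left mult_ac)

lemma clinear_tensor_lift_out:
  "clinear L \<Longrightarrow> L (tensor_lift B t) = tensor_lift (\<lambda>a b. L (B a b)) t"
  unfolding tensor_lift_def free_lift_def
  by (simp add: clinear_sum clinear_scale case_prod_beta)

text \<open>A scalar can be moved into the left factor, so sums of pure tensors suffice.\<close>

lemma tens_induct [case_names zero add]: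
  assumes "P 0" "\<And>a b t. P t \<Longrightarrow> P (a \<otimes> b + t)"
  shows "P t"
proof -
  have "t \<in> cv.span {a \<otimes> b | a b. True}" unfolding cspan_tens by (rule UNIV_I)
  then show ?thesis
  proof (induction rule: cv.span_induct_alt)
    case (step c x y)
    then obtain a b where "x = a \<otimes> b" by auto
    then have "c *\<^sub>C x = (c *\<^sub>C a) \<otimes> b" by (simp add: clinear_scale[OF clinear_tens_left])
    then show ?case using assms(2) step by simp
  qed (rule assms(1))
qed

lemma tensor_decomposition: "\<exists>xs. t = (\<Sum>(a, b)\<leftarrow>xs. a \<otimes> b)"
proof (induction t rule: tens_induct)
  case zero
  have "0 = (\<Sum>(a, b)\<leftarrow>[]. a \<otimes> b)" by simp
  then show ?case by blast
next
  case (add a b t)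
  then obtain xs where "t = (\<Sum>(a, b)\<leftarrow>xs. a \<otimes> b)" by blast
  then have "a \<otimes> b + t = (\<Sum>(a, b)\<leftarrow>(a, b) # xs. a \<otimes> b)" by simp
  then show ?case by blast
qed

definition pure_terms :: "('a::complex_vector, 'b::complex_vector) tensor \<Rightarrow> ('a \<times> 'b) list"
  where "pure_terms t = (SOME xs. t = (\<Sum>(a, b)\<leftarrow>xs. a \<otimes> b))"

lemma sum_pure_terms: "(\<Sum>(a, b)\<leftarrow>pure_terms t. a \<otimes> b) = t"
  unfolding pure_terms_def using someI_ex[OF tensor_decomposition[of t]] by simp

lemma tensor_lift_pure_terms:
  assumes "cbilinear B"
  shows "tensor_lift B t = (\<Sum>(a, b)\<leftarrow>pure_terms t. B a b)"
proof -
  have "tensor_lift B t = tensor_lift B (\<Sum>(a, b)\<leftarrow>pure_terms t. a \<otimes> b)"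
    by (simp add: sum_pure_terms)
  also have "\<dots> = (\<Sum>x\<leftarrow>pure_terms t. tensor_lift B (case x of (a, b) \<Rightarrow> a \<otimes> b))"
    by (rule clinear_sum_list[OF clinear_tensor_lift[OF assms]])
  also have "\<dots> = (\<Sum>(a, b)\<leftarrow>pure_terms t. B a b)"
    by (simp add: case_prod_unfold tensor_lift_tens[OF assms])
  finally show ?thesis .
qed

lemma list_multilinearD: "list_multilinear F \<Longrightarrow> clinear (\<lambda>a. F (xs @ a # ys))"
  by (simp add: list_multilinear_def)

text \<open>The coefficient stays explicit because \<open>tens_list []\<close> has no factor that
  could absorb it.\<close>

lemma tensor_power_induct [case_names zero add]:
  assumes "P 0" "\<And>c xs t. P t \<Longrightarrow> P (c *\<^sub>C tens_list xs + t)"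
  shows "P t"
proof (induction t)
  case (1 p)
  have lin: "clinear abs_tensor_power"
    by (simp add: clinear_iff plus_tensor_power.abs_eq scaleC_tensor_power.abs_eq)
  have "p \<in> cv.span (range (\<lambda>k. Poly_Mapping.single k (1::complex)))"
    by (simp add: cspan_free)
  then show ?case
  proof (induction rule: cv.span_induct_alt)
    case base
    then show ?case using assms(1) by (simp add: clinear_zero[OF lin])
  next
    case (step c x y)
    then obtain xs where "x = Poly_Mapping.single xs 1" by auto
    then have "abs_tensor_power x = tens_list xs" by (simp add: tens_list.abs_eq)
    then show ?case using assms(2) step by (simp add: clinear_add[OF lin] clinear_scale[OF lin])
  qed
qed

lemma clinear_eq_tensor_power:
  assumes "clinear f" "clinear g" "\<And>xs. f (tens_list xs) = g (tens_list xs)"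
  shows "f t = g t"
  by (induction t rule: tensor_power_induct)
    (simp_all add: assms(3) clinear_zero[OF assms(1)] clinear_zero[OF assms(2)]
      clinear_add[OF assms(1)] clinear_add[OF assms(2)] clinear_scale[OF assms(1)] clinear_scale[OF assms(2)])

lemma list_multilinear_Cons:
  assumes "list_multilinear F"
  shows "list_multilinear (\<lambda>xs. F (a # xs))"
  unfolding list_multilinear_def using list_multilinearD[OF assms, of "a # _"] by simp

lemma clinear_tens_cons: "clinear (tens_cons a)"
  unfolding tens_cons_def
  by (intro clinear_tensor_power_lift list_multilinear_Cons list_multilinear_tens_list)

lemma clinear_tens_cons_left: "clinear (\<lambda>a. tens_cons a t)"
proof (induction t rule: tensor_power_induct)
  case zero
  then show ?case by (simp add: clinear_zero[OF clinear_tens_cons] clinear_zero_map)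
next
  case (add c xs t)
  have "clinear (\<lambda>a. tens_list (a # xs))"
    using list_multilinearD[OF list_multilinear_tens_list, of "[]"] by simp
  then show ?case using add
    by (simp add: clinear_iff clinear_add[OF clinear_tens_cons] clinear_scale[OF clinear_tens_cons]
      tens_cons_tens_list scaleC_add_right scaleC_scaleC mult.commute algebra_simps)
qed

text \<open>Insertion is lifted to tensors because the diagonal action of a string is a sum of pure
  tensors and not a list.\<close>

definition tens_insert :: "nat \<Rightarrow> 'a::complex_vector \<Rightarrow> 'a tensor_power \<Rightarrow> 'a tensor_power"
  where "tens_insert i c = tensor_power_lift (\<lambda>xs. tens_list (take i xs @ c # drop i xs))"

lemma list_multilinear_insert: "list_multilinear (\<lambda>xs. tens_list (take i xs @ c # drop i xs))"
  unfolding list_multilinear_def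
proof (intro allI)
  fix xs ys :: "'a list"
  show "clinear (\<lambda>a. tens_list (take i (xs @ a # ys) @ c # drop i (xs @ a # ys)))"
  proof (cases "i \<le> length xs")
    case True
    then show ?thesis
      using list_multilinearD[OF list_multilinear_tens_list, of "take i xs @ c # drop i xs" ys] by simp
  next
    case False
    then obtain j where "i = length xs + Suc j"
      by (metis add_Suc_right less_iff_Suc_add not_le)
    then show ?thesis
      using list_multilinearD[OF list_multilinear_tens_list, of xs "take j ys @ c # drop j ys"] by simp
  qed
qed

lemma tens_insert_tens_list: "tens_insert i c (tens_list xs) = tens_list (take i xs @ c # drop i xs)"
  unfolding tens_insert_def by (rule tensor_power_lift_tens_list[OF list_multilinear_insert])

lemma clinear_tens_insert: "clinear (tens_insert i c)"
  unfolding tens_insert_def by (rule clinear_tensor_power_lift[OF list_multilinear_insert])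

lemma tens_insert_0: "tens_insert 0 c t = tens_cons c t"
  by (rule clinear_eq_tensor_power[OF clinear_tens_insert clinear_tens_cons])
    (simp add: tens_insert_tens_list tens_cons_tens_list)

lemma tens_insert_Suc: "tens_insert (Suc i) c (tens_cons x t) = tens_cons x (tens_insert i c t)"
  by (rule clinear_eq_tensor_power[OF clinear_compose[OF clinear_tens_insert clinear_tens_cons]
        clinear_compose[OF clinear_tens_cons clinear_tens_insert]])
    (simp add: tens_insert_tens_list tens_cons_tens_list)

section \<open>The diagonal action\<close>

context hopf_algebra
begin

lemma clinear_diag_act:
  "(\<And>g. g \<in> set gs \<Longrightarrow> clinear g) \<Longrightarrow> clinear (diag_act H gs)"
proof (induction gs)
  case Nil
  then show ?case
    by (simp add: clinear_iff clinear_add[OF counit_linear] clinear_scale[OF counit_linear]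
        scaleC_add_left scaleC_scaleC scaleC_complex_def)
next
  case (Cons g gs)
  have "cbilinear (\<lambda>h1 h2. tens_cons (g h1) (diag_act H gs h2))"
    using Cons by (intro cbilinearI clinear_compose[OF clinear_tens_cons]
      clinear_compose[OF clinear_tens_cons_left]) auto
  from clinear_compose[OF clinear_tensor_lift[OF this] comult_linear] show ?case by simp
qed

lemma cbilinear_diag_act_step:
  assumes "clinear g" "\<And>g. g \<in> set gs \<Longrightarrow> clinear g"
  shows "cbilinear (\<lambda>h1 h2. tens_cons (g h1) (diag_act H gs h2))"
  using assms by (intro cbilinearI clinear_compose[OF clinear_tens_cons]
      clinear_compose[OF clinear_tens_cons_left] clinear_diag_act) auto

end

text \<open>
  \<open>hlists H n h\<close> lists the pure summands of the iterated coproduct of \<open>h\<close> in \<open>n + 1\<close> factors;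
  the choice of summands does not depend on the maps to which they are applied.
\<close>

fun hlists :: "('h::complex_algebra_1) hopf \<Rightarrow> nat \<Rightarrow> 'h \<Rightarrow> 'h list list" where
  "hlists H 0 h = [[h]]"
| "hlists H (Suc n) h = concat (map (\<lambda>(a, b). map ((#) a) (hlists H n b)) (pure_terms (comult H h)))"

lemma length_hlists: "hs \<in> set (hlists H n h) \<Longrightarrow> length hs = Suc n"
  by (induction n arbitrary: h hs) auto

context hopf_algebra
begin

lemma sum_list_map_concat: "sum_list (concat xss) = (\<Sum>xs\<leftarrow>xss. sum_list xs)"
  by (induction xss) simp_all

lemma diag_act_hlists:
  assumes "length gs = Suc n" "\<And>g. g \<in> set gs \<Longrightarrow> clinear g"
  shows "diag_act H gs h = (\<Sum>hs\<leftarrow>hlists H n h. tens_list (map2 (\<lambda>g x. g x) gs hs))"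
  using assms
proof (induction n arbitrary: gs h)
  case 0
  then obtain g where gs: "gs = [g]" by (metis length_0_conv length_Suc_conv)
  then have g: "clinear g" using 0 by simp
  have lin: "clinear (\<lambda>x. tens_list [g x])"
    using clinear_compose[OF list_multilinearD[OF list_multilinear_tens_list, of "[]" "[]"] g] by simp
  \<comment> \<open>The empty tail of \<open>diag_act\<close> contributes a counit, which the counit
    axiom removes. Hence a single factor leaves \<open>h\<close> unsplit, in accordance with
    \<open>hlists H 0 h = [[h]]\<close>.\<close>
  have "diag_act H gs h = tensor_lift (\<lambda>h1 h2. tens_list [g (counit H h2 *\<^sub>C h1)]) (comult H h)"
    by (simp add: gs clinear_scale[OF lin] clinear_scale[OF clinear_tens_cons] tens_cons_tens_list)
  also have "\<dots> = tens_list [g h]"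
    by (subst clinear_tensor_lift_out[OF lin, symmetric]) (simp add: counit_right)
  finally show ?case by (simp add: gs)
next
  case (Suc n)
  then obtain g gs' where gs: "gs = g # gs'" "length gs' = Suc n" by (metis length_Suc_conv)
  have bil: "cbilinear (\<lambda>h1 h2. tens_cons (g h1) (diag_act H gs' h2))"
    using Suc.prems gs by (intro cbilinear_diag_act_step) auto
  have IH: "diag_act H gs' h = (\<Sum>hs\<leftarrow>hlists H n h. tens_list (map2 (\<lambda>g x. g x) gs' hs))" for h
    using Suc gs by simp
  have step: "tens_cons (g a) (diag_act H gs' b)
      = (\<Sum>hs\<leftarrow>map ((#) a) (hlists H n b). tens_list (map2 (\<lambda>g x. g x) gs hs))" for a b
    by (simp add: IH gs clinear_sum_list[OF clinear_tens_cons] tens_cons_tens_list comp_def)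
  have "diag_act H gs h = (\<Sum>(a, b)\<leftarrow>pure_terms (comult H h). tens_cons (g a) (diag_act H gs' b))"
    by (simp add: gs tensor_lift_pure_terms[OF bil])
  also have "\<dots> = (\<Sum>hs\<leftarrow>hlists H (Suc n) h. tens_list (map2 (\<lambda>g x. g x) gs hs))"
    by (simp add: step map_concat sum_list_map_concat comp_def case_prod_unfold)
  finally show ?case .
qed

text \<open>An invariant entry receives its leg of the iterated coproduct through the counit, and
  the counit axiom deletes that leg. The other entries then see the coproduct with one leg
  fewer.\<close>

lemma diag_act_insert:
  assumes "\<And>g. g \<in> set (gs1 @ gs2) \<Longrightarrow> clinear g"
  shows "diag_act H (gs1 @ (\<lambda>h. counit H h *\<^sub>C c) # gs2) h
    = tens_insert (length gs1) c (diag_act H (gs1 @ gs2) h)"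
  using assms
proof (induction gs1 arbitrary: h)
  case Nil
  have lin: "clinear (\<lambda>x. tens_cons c (diag_act H gs2 x))"
    using Nil by (intro clinear_compose[OF clinear_tens_cons] clinear_diag_act) auto
  have "tens_cons (counit H h1 *\<^sub>C c) (diag_act H gs2 h2) = tens_cons c (diag_act H gs2 (counit H h1 *\<^sub>C h2))"
    for h1 h2
    using clinear_scale[OF lin] clinear_scale[OF clinear_tens_cons_left] by metis
  then have "diag_act H ([] @ (\<lambda>h. counit H h *\<^sub>C c) # gs2) h
      = tensor_lift (\<lambda>h1 h2. tens_cons c (diag_act H gs2 (counit H h1 *\<^sub>C h2))) (comult H h)"
    by simp
  also have "\<dots> = tens_cons c (diag_act H gs2 h)"
    by (subst clinear_tensor_lift_out[OF lin, symmetric]) (simp add: counit_left)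
  finally show ?case by (simp add: tens_insert_0)
next
  case (Cons g gs1)
  then show ?case
    by (simp add: clinear_tensor_lift_out[OF clinear_tens_insert] tens_insert_Suc)
qed

text \<open>Apply the counit to \<open>S(h_1) h_2 = \<epsilon>(h) 1\<close>; by multiplicativity the
  left side becomes \<open>\<epsilon>(S(h_1 \<epsilon>(h_2)))\<close>.\<close>

lemma counit_antipode: "counit H (antipode H h) = counit H h"
proof -
  have lin: "clinear (\<lambda>x. counit H (antipode H x))"
    by (rule clinear_compose[OF counit_linear antipode_linear])
  have "counit H h = counit H (tensor_lift (\<lambda>h1 h2. antipode H h1 * h2) (comult H h))"
    by (simp add: antipode_left clinear_scale[OF counit_linear] counit_one scaleC_complex_def)
  also have "\<dots> = tensor_lift (\<lambda>h1 h2. counit H (antipode H (counit H h2 *\<^sub>C h1))) (comult H h)"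
    by (simp add: clinear_tensor_lift_out[OF counit_linear] counit_mult clinear_scale[OF lin]
        scaleC_complex_def mult.commute)
  also have "\<dots> = counit H (antipode H h)"
    by (subst clinear_tensor_lift_out[OF lin, symmetric]) (simp add: counit_right)
  finally show ?thesis by simp
qed

end

section \<open>Cyclic strings and functionals\<close>

text \<open>Besides the source object of the \<open>i\<close>-th morphism of a cyclic string, this
  also gives the column index of the \<open>i\<close>-th matrix in a cyclic word, when applied to a
  list of indices.\<close>

definition src :: "'o list \<Rightarrow> nat \<Rightarrow> 'o"
  where "src Xs i = Xs ! ((i + 1) mod length Xs)"

lemma src_less: "Suc i < length Xs \<Longrightarrow> src Xs i = Xs ! Suc i"
  and src_end: "Suc i = length Xs \<Longrightarrow> src Xs i = Xs ! 0"
  by (simp_all add: src_def)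

lemma src_eq: "length Xs = Suc n \<Longrightarrow> i \<le> n \<Longrightarrow> src Xs i = (if i = n then Xs ! 0 else Xs ! Suc i)"
  by (simp add: src_less src_end)

lemma cyc_stringsD:
  assumes "(Xs, fs) \<in> cyc_strings D n"
  shows "length Xs = Suc n" "length fs = Suc n"
    and "i \<le> n \<Longrightarrow> Xs ! i \<in> Ob D" "i \<le> n \<Longrightarrow> src Xs i \<in> Ob D" (is "PROP ?D")
    and "i \<le> n \<Longrightarrow> fs ! i \<in> Hom D (src Xs i) (Xs ! i)" (is "PROP ?E")
proof -
  show l: "length Xs = Suc n" "length fs = Suc n" using assms by (simp_all add: cyc_strings_def)
  have ob: "Xs ! i \<in> Ob D" if "i \<le> n" for i
    using assms that l(1) nth_mem[of i Xs] by (auto simp: cyc_strings_def)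
  then show "i \<le> n \<Longrightarrow> Xs ! i \<in> Ob D" .
  show "PROP ?D" using ob by (simp add: src_eq[OF l(1)])
  show "PROP ?E"
    using assms l by (simp add: cyc_strings_def src_def)
qed

lemma cyc_stringsI:
  assumes "length Xs = Suc n" "length fs = Suc n"
    and "\<And>i. i \<le> n \<Longrightarrow> Xs ! i \<in> Ob D" "\<And>i. i \<le> n \<Longrightarrow> fs ! i \<in> Hom D (src Xs i) (Xs ! i)"
  shows "(Xs, fs) \<in> cyc_strings D n"
  using assms by (auto simp: cyc_strings_def src_def in_set_conv_nth)

lemma cyc_strings_update:
  assumes "(Xs, fs) \<in> cyc_strings D n" "f \<in> Hom D (src Xs i) (Xs ! i)"
  shows "(Xs, fs[i := f]) \<in> cyc_strings D n"
proof (rule cyc_stringsI)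
  show "fs[i := f] ! j \<in> Hom D (src Xs j) (Xs ! j)" if "j \<le> n" for j
    using that assms(2) cyc_stringsD[OF assms(1)] by (cases "j = i") auto
qed (use cyc_stringsD[OF assms(1)] in auto)

lemma clinear_single: "clinear (\<lambda>t :: 'b::complex_vector. Poly_Mapping.single k t)"
  by (auto simp: clinear_iff single_add lookup_scaleC lookup_single when_def intro!: poly_mapping_eqI)

abbreviation word :: "'m::complex_vector \<Rightarrow> 'o list \<Rightarrow> 'f::complex_vector list \<Rightarrow> ('m, 'o, 'f) chain"
  where "word m Xs fs \<equiv> gen m Xs (tens_list fs)"

lemma clinear_gen: "clinear (\<lambda>t. gen m Xs t)"
  unfolding gen_def by (rule clinear_compose[OF clinear_tens_right clinear_single])

lemma clinear_gen_left: "clinear (\<lambda>m. gen m Xs t)"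
  unfolding gen_def by (rule clinear_tens_left)

lemma subspace_MCN: "cv.subspace (MCN D n)"
  unfolding MCN_def by (rule cv.subspace_span)

lemma gen_in_MCN:
  fixes m :: "'m::complex_vector"
  shows "(Xs, fs) \<in> cyc_strings D n \<Longrightarrow> word m Xs fs \<in> MCN D n"
  unfolding MCN_eq by (auto intro: cv.span_base)

lemma functional_linear: "\<phi> \<in> functionals D n \<Longrightarrow> clinear_on (MCN D n) \<phi>"
  by (simp add: functionals_def)

lemma functional_gen_left:
  fixes \<phi> :: "('m::complex_vector, 'o, 'f::complex_vector) chain \<Rightarrow> complex"
  assumes "\<phi> \<in> functionals D n" "(Xs, fs) \<in> cyc_strings D n"
  shows "clinear (\<lambda>m. \<phi> (word m Xs fs))"
  using clinear_onD[OF functional_linear[OF assms(1)]] gen_in_MCN[OF assms(2), where 'm='m]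
  by (simp add: clinear_iff clinear_add[OF clinear_gen_left] clinear_scale[OF clinear_gen_left])

lemma functional_slot:
  assumes "\<phi> \<in> functionals D n" "(Xs, fs) \<in> cyc_strings D n" "i \<le> n"
  shows "clinear_on (Hom D (src Xs i) (Xs ! i)) (\<lambda>f. \<phi> (word m Xs (fs[i := f])))"
proof -
  have "fs[i := f] = take i fs @ f # drop (Suc i) fs" for f
    using assms(3) cyc_stringsD(2)[OF assms(2)] by (simp add: upd_conv_take_nth_drop)
  then have lin: "clinear (\<lambda>f. word m Xs (fs[i := f]))"
    by (simp add: clinear_compose[OF clinear_gen list_multilinearD[OF list_multilinear_tens_list]])
  then have "clinear_on (Hom D (src Xs i) (Xs ! i)) (\<lambda>f. word m Xs (fs[i := f]))"
    by (simp add: clinear_iff clinear_on_def)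
  from clinear_on_compose[OF functional_linear[OF assms(1)] this] show ?thesis
    using gen_in_MCN[OF cyc_strings_update[OF assms(2)]] by blast
qed

text \<open>The domain \<open>V\<close> is left arbitrary: it is a Hom space when a morphism varies
  and the whole Hopf algebra when the acting element varies.\<close>

lemma functional_slot_map:
  assumes "\<phi> \<in> functionals E n" "(Ys, gs) \<in> cyc_strings E n" "j \<le> n"
    and V: "cv.subspace V" and L: "clinear_on V L" "\<And>f. f \<in> V \<Longrightarrow> L f \<in> Hom E (src Ys j) (Ys ! j)"
    and T: "\<And>f. f \<in> V \<Longrightarrow> T f = gs[j := L f]"
  shows "clinear_on V (\<lambda>f. \<phi> (word m Ys (T f)))"
proof -
  have "clinear_on V (\<lambda>f. \<phi> (word m Ys (gs[j := L f])))"
    by (rule clinear_on_compose[OF functional_slot[OF assms(1-3)] L])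
  then show ?thesis
    using T V by (simp add: clinear_on_def cv.subspace_add cv.subspace_scale)
qed

lemma functionals_sum:
  assumes "\<And>k. k \<in> I \<Longrightarrow> \<phi> k \<in> functionals D n"
  shows "(\<lambda>x. \<Sum>k\<in>I. c k * \<phi> k x) \<in> functionals D n"
proof -
  have "clinear_on (MCN D n) (\<phi> k)" "\<And>x. x \<notin> MCN D n \<Longrightarrow> \<phi> k x = 0" if "k \<in> I" for k
    using assms[OF that] by (simp_all add: functionals_def)
  then show ?thesis
    by (auto simp: functionals_def clinear_on_def scaleC_complex_def distrib_left sum.distrib
      sum_distrib_left mult_ac intro!: sum.cong sum.neutral)
qed

lemma functionals_scale: "\<phi> \<in> functionals D n \<Longrightarrow> (\<lambda>x. c * \<phi> x) \<in> functionals D n"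
  using functionals_sum[of "{()}" "\<lambda>_. \<phi>" D n "\<lambda>_. c"] by simp

lemma functionals_zero: "(\<lambda>x. 0) \<in> functionals D n"
  using functionals_sum[of "{}"] by simp

definition act_list :: "('o, 'f, 'h) hcat \<Rightarrow> 'h list \<Rightarrow> 'o list \<Rightarrow> 'f list \<Rightarrow> 'f list"
  where "act_list D hs Xs fs = map (\<lambda>i. Act D (src Xs i) (Xs ! i) (hs ! i) (fs ! i)) [0..<length fs]"

lemma length_act_list [simp]: "length (act_list D hs Xs fs) = length fs"
  by (simp add: act_list_def)

lemma nth_act_list: "i < length fs \<Longrightarrow> act_list D hs Xs fs ! i = Act D (src Xs i) (Xs ! i) (hs ! i) (fs ! i)"
  by (simp add: act_list_def)

lemma (in left_H_category) act_list_in: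
  assumes "(Xs, fs) \<in> cyc_strings D n"
  shows "(Xs, act_list D hs Xs fs) \<in> cyc_strings D n"
  using cyc_stringsD[OF assms] by (intro cyc_stringsI) (auto simp: nth_act_list Act_in_Hom)

text \<open>Turns the recursively defined diagonal action into a finite sum of cyclic strings, on
  which functionals can be evaluated term by term.\<close>

lemma string_act_hlists:
  assumes "hopf_algebra H" "left_H_category H D" "(Xs, fs) \<in> cyc_strings D n"
  shows "string_act H D h Xs fs = (\<Sum>hs\<leftarrow>hlists H n h. tens_list (act_list D hs Xs fs))"
proof -
  interpret H: hopf_algebra H by fact
  interpret D: left_H_category H D by fact
  note str = cyc_stringsD[OF assms(3)]
  let ?gs = "map (\<lambda>i h. Act D (Xs ! ((i + 1) mod length Xs)) (Xs ! i) h (fs ! i)) [0..<length fs]"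
  have "clinear g" if g: "g \<in> set ?gs" for g
  proof -
    obtain i where i: "i \<le> n" "g = (\<lambda>h. Act D (src Xs i) (Xs ! i) h (fs ! i))"
      using g str(2) by (auto simp: src_def less_Suc_eq_le simp del: upt_Suc)
    show ?thesis unfolding i(2) using i(1) str by (intro D.Act_linear_left)
  qed
  then have "string_act H D h Xs fs = (\<Sum>hs\<leftarrow>hlists H n h. tens_list (map2 (\<lambda>g x. g x) ?gs hs))"
    unfolding string_act_def using str(2) by (intro H.diag_act_hlists) auto
  also have "\<dots> = (\<Sum>hs\<leftarrow>hlists H n h. tens_list (act_list D hs Xs fs))"
  proof (intro arg_cong[where f=sum_list] map_cong refl arg_cong[where f=tens_list])
    fix hs assume "hs \<in> set (hlists H n h)"
    then have "length hs = Suc n" by (rule length_hlists)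
    then show "map2 (\<lambda>g x. g x) ?gs hs = act_list D hs Xs fs"
      using str by (intro nth_equalityI) (auto simp: nth_act_list src_def simp del: upt_Suc)
  qed
  finally show ?thesis .
qed

lemma functional_gen_sum_list:
  fixes \<phi> :: "('m::complex_vector, 'o, 'f::complex_vector) chain \<Rightarrow> complex"
  assumes "\<phi> \<in> functionals D n" "\<And>x. x \<in> set xs \<Longrightarrow> (Xs, fs x) \<in> cyc_strings D n"
  shows "\<phi> (gen m Xs (\<Sum>x\<leftarrow>xs. tens_list (fs x))) = (\<Sum>x\<leftarrow>xs. \<phi> (word m Xs (fs x)))"
  using clinear_on_sum_list[OF functional_linear[OF assms(1)] subspace_MCN, of xs "\<lambda>x. word m Xs (fs x)"]
    gen_in_MCN[OF assms(2), where 'm='m] by (simp add: clinear_sum_list[OF clinear_gen])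

section \<open>Maps of strings\<close>

text \<open>This is the condition that makes the pullback of a functional multilinear: varying one
  input slot changes one output slot, and that linearly. The linear map \<open>L\<close> may depend
  on the entries in the other slots, as it does for a composite.\<close>

definition slot_map ::
  "('o, 'f::complex_vector, 'h) hcat \<Rightarrow> nat \<Rightarrow> ('p, 'g::complex_vector, 'h) hcat \<Rightarrow> nat
    \<Rightarrow> ('o list \<Rightarrow> 'p list) \<Rightarrow> ('o list \<Rightarrow> 'f list \<Rightarrow> 'g list) \<Rightarrow> bool"
  where "slot_map D p E n P T \<longleftrightarrow> (\<forall>(Xs, fs) \<in> cyc_strings D p.
    (P Xs, T Xs fs) \<in> cyc_strings E n \<and>
    (\<forall>j\<le>p. \<exists>k\<le>n. \<exists>L. clinear_on (Hom D (src Xs j) (Xs ! j)) L \<and>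
      (\<forall>f\<in>Hom D (src Xs j) (Xs ! j). L f \<in> Hom E (src (P Xs) k) (P Xs ! k) \<and>
        T Xs (fs[j := f]) = (T Xs fs)[k := L f])))"

text \<open>
  The equation in \<open>string_map\<close> says that \<open>T\<close> intertwines the diagonal actions, written on pure
  tensors because \<open>T\<close> is only defined on those.
\<close>

definition string_map ::
  "('h::complex_algebra_1) hopf \<Rightarrow> ('o, 'f::complex_vector, 'h) hcat \<Rightarrow> nat
    \<Rightarrow> ('p, 'g::complex_vector, 'h) hcat \<Rightarrow> nat
    \<Rightarrow> ('o list \<Rightarrow> 'p list) \<Rightarrow> ('o list \<Rightarrow> 'f list \<Rightarrow> 'g list) \<Rightarrow> bool"
  where "string_map H D p E n P T \<longleftrightarrow> slot_map D p E n P T \<and> (\<forall>(Xs, fs) \<in> cyc_strings D p. \<forall>h.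
    (\<Sum>hs\<leftarrow>hlists H p h. tens_list (T Xs (act_list D hs Xs fs))) = string_act H E h (P Xs) (T Xs fs))"

lemma slot_mapI:
  assumes "\<And>Xs fs. (Xs, fs) \<in> cyc_strings D p \<Longrightarrow> (P Xs, T Xs fs) \<in> cyc_strings E n"
    and "\<And>Xs fs j. (Xs, fs) \<in> cyc_strings D p \<Longrightarrow> j \<le> p \<Longrightarrow> k Xs fs j \<le> n \<and>
      clinear_on (Hom D (src Xs j) (Xs ! j)) (L Xs fs j)"
    and "\<And>Xs fs j f. (Xs, fs) \<in> cyc_strings D p \<Longrightarrow> j \<le> p \<Longrightarrow> f \<in> Hom D (src Xs j) (Xs ! j) \<Longrightarrow>
      L Xs fs j f \<in> Hom E (src (P Xs) (k Xs fs j)) (P Xs ! k Xs fs j)"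
    and "\<And>Xs fs j f. (Xs, fs) \<in> cyc_strings D p \<Longrightarrow> j \<le> p \<Longrightarrow> f \<in> Hom D (src Xs j) (Xs ! j) \<Longrightarrow>
      T Xs (fs[j := f]) = (T Xs fs)[k Xs fs j := L Xs fs j f]"
  shows "slot_map D p E n P T"
  unfolding slot_map_def using assms by blast

lemma slot_map_in:
  "slot_map D p E n P T \<Longrightarrow> (Xs, fs) \<in> cyc_strings D p \<Longrightarrow> (P Xs, T Xs fs) \<in> cyc_strings E n"
  by (auto simp: slot_map_def)

text \<open>The definite description tests \<open>\<psi>\<close> on cyclic strings only. This allows
  the operators of the complex to be rewritten in the uniform shapes \<open>pull\<close> and
  \<open>twist\<close>.\<close>

lemma extend_functional_cong:
  assumes "\<And>m Xs fs. (Xs, fs) \<in> cyc_strings D n \<Longrightarrow> F m Xs fs = G m Xs fs"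
  shows "extend_functional D n F = extend_functional D n G"
proof -
  have "(\<forall>m. \<forall>(Xs, fs)\<in>cyc_strings D n. \<psi> (word m Xs fs) = F m Xs fs) \<longleftrightarrow>
      (\<forall>m. \<forall>(Xs, fs)\<in>cyc_strings D n. \<psi> (word m Xs fs) = G m Xs fs)" for \<psi>
    by (intro all_cong1 ball_cong refl) (auto simp: assms)
  then show ?thesis by (simp add: extend_functional_def)
qed

lemma slot_map_clinear_on:
  assumes D: "left_H_category H D" and T: "slot_map D p E n P T" and \<phi>: "\<phi> \<in> functionals E n"
    and s: "(Xs, fs) \<in> cyc_strings D p" and j: "j \<le> p"
  shows "clinear_on (Hom D (Xs ! ((j + 1) mod (p + 1))) (Xs ! j))
      (\<lambda>f. \<phi> (word m (P Xs) (T Xs (fs[j := f]))))"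
proof -
  interpret D: left_H_category H D by fact
  from T s j obtain k L where kL: "k \<le> n" "clinear_on (Hom D (src Xs j) (Xs ! j)) L"
    "\<And>f. f \<in> Hom D (src Xs j) (Xs ! j) \<Longrightarrow> L f \<in> Hom E (src (P Xs) k) (P Xs ! k)"
    "\<And>f. f \<in> Hom D (src Xs j) (Xs ! j) \<Longrightarrow> T Xs (fs[j := f]) = (T Xs fs)[k := L f]"
    unfolding slot_map_def by blast
  have "cv.subspace (Hom D (src Xs j) (Xs ! j))"
    using cyc_stringsD[OF s] j D.Hom_subspace by blast
  from functional_slot_map[OF \<phi> slot_map_in[OF T s] kL(1) this kL(2-4)]
  show ?thesis using cyc_stringsD(1)[OF s] by (simp add: src_def)
qed

definition pull :: "('o, 'f::complex_vector, 'h) hcat \<Rightarrow> nat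
    \<Rightarrow> ('o list \<Rightarrow> 'p list) \<Rightarrow> ('o list \<Rightarrow> 'f list \<Rightarrow> 'g::complex_vector list)
    \<Rightarrow> (('m::complex_vector, 'p, 'g) chain \<Rightarrow> complex) \<Rightarrow> ('m, 'o, 'f) chain \<Rightarrow> complex"
  where "pull D p P T \<phi> = extend_functional D p (\<lambda>m Xs fs. \<phi> (word m (P Xs) (T Xs fs)))"

lemma
  assumes D: "left_H_category H D" and T: "slot_map D p E n P T" and \<phi>: "\<phi> \<in> functionals E n"
  shows pull_in: "pull D p P T \<phi> \<in> functionals D p"
    and pull_gen: "(Xs, fs) \<in> cyc_strings D p \<Longrightarrow>
      pull D p P T \<phi> (word m Xs fs) = \<phi> (word m (P Xs) (T Xs fs))" (is "PROP ?B")
proof -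
  interpret D: left_H_category H D by fact
  have lin: "clinear (\<lambda>m. \<phi> (word m (P Xs) (T Xs fs)))" if "(Xs, fs) \<in> cyc_strings D p" for Xs fs
    by (rule functional_gen_left[OF \<phi> slot_map_in[OF T that]])
  note slot = slot_map_clinear_on[OF assms]
  show "pull D p P T \<phi> \<in> functionals D p"
    unfolding pull_def by (rule D.extend_functional_in[OF lin slot])
  show "PROP ?B"
    unfolding pull_def by (rule D.extend_functional_gen[OF lin slot])
qed

text \<open>The common shape of the last coface and the cyclic operator: the coaction leg
  \<open>a\<close> of the coefficient is handed to the map of strings.\<close>

definition twist :: "('o, 'f::complex_vector, 'h::complex_algebra_1) hcat \<Rightarrow> ('m::complex_vector, 'h) sayd \<Rightarrow> nat
    \<Rightarrow> ('o list \<Rightarrow> 'p list) \<Rightarrow> ('h \<Rightarrow> 'o list \<Rightarrow> 'f list \<Rightarrow> 'g::complex_vector list)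
    \<Rightarrow> (('m, 'p, 'g) chain \<Rightarrow> complex) \<Rightarrow> ('m, 'o, 'f) chain \<Rightarrow> complex"
  where "twist D M p P T \<phi> = extend_functional D p (\<lambda>m Xs fs.
    tensor_lift (\<lambda>a m0. \<phi> (word m0 (P Xs) (T a Xs fs))) (coact M m))"

lemma tensor_lift_clinear_on:
  fixes B :: "'f::complex_vector \<Rightarrow> 'a::complex_vector \<Rightarrow> 'b::complex_vector \<Rightarrow> complex"
  assumes "\<And>a b. clinear_on V (\<lambda>f. B f a b)" "cv.subspace V"
  shows "clinear_on V (\<lambda>f. tensor_lift (B f) t)"
proof -
  have "tensor_lift (B (x + y)) t = tensor_lift (B x) t + tensor_lift (B y) t" if "x \<in> V" "y \<in> V" for x y
    using that assms clinear_onD(1)[OF assms(1)]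
    by (simp add: tensor_lift_def free_lift_def case_prod_unfold scaleC_complex_def distrib_left sum.distrib)
  moreover have "tensor_lift (B (c *\<^sub>C x)) t = c *\<^sub>C tensor_lift (B x) t" if "x \<in> V" for x c
    using that assms clinear_onD(2)[OF assms(1)]
    by (simp add: tensor_lift_def free_lift_def case_prod_unfold scaleC_complex_def sum_distrib_left mult_ac)
  ultimately show ?thesis by (simp add: clinear_on_def)
qed

lemma
  assumes D: "left_H_category H D" and M: "sayd_module H M" and T: "\<And>a. slot_map D p E n P (T a)"
    and \<phi>: "\<phi> \<in> functionals E n"
    and T_lin: "\<And>m Xs fs. (Xs, fs) \<in> cyc_strings D p \<Longrightarrow> clinear (\<lambda>a. \<phi> (word m (P Xs) (T a Xs fs)))"
  shows twist_in: "twist D M p P T \<phi> \<in> functionals D p"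
    and twist_gen: "(Xs, fs) \<in> cyc_strings D p \<Longrightarrow> twist D M p P T \<phi> (word m Xs fs)
      = tensor_lift (\<lambda>a m0. \<phi> (word m0 (P Xs) (T a Xs fs))) (coact M m)" (is "PROP ?B")
proof -
  interpret D: left_H_category H D by fact
  interpret M: sayd_module H M by fact
  have lin: "clinear (\<lambda>m. tensor_lift (\<lambda>a m0. \<phi> (word m0 (P Xs) (T a Xs fs))) (coact M m))"
    if "(Xs, fs) \<in> cyc_strings D p" for Xs fs
    using functional_gen_left[OF \<phi> slot_map_in[OF T that]] T_lin[OF that]
    by (intro clinear_compose[OF clinear_tensor_lift M.coact_linear] cbilinearI) auto
  have slot: "clinear_on (Hom D (Xs ! ((j + 1) mod (p + 1))) (Xs ! j))
      (\<lambda>f. tensor_lift (\<lambda>a m0. \<phi> (word m0 (P Xs) (T a Xs (fs[j := f])))) (coact M m))"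
    if s: "(Xs, fs) \<in> cyc_strings D p" and j: "j \<le> p" for m Xs fs j
  proof (rule tensor_lift_clinear_on[OF slot_map_clinear_on[OF D T \<phi> s j]])
    show "cv.subspace (Hom D (Xs ! ((j + 1) mod (p + 1))) (Xs ! j))"
      using cyc_stringsD[OF s] j D.Hom_subspace by (simp add: src_def)
  qed
  show "twist D M p P T \<phi> \<in> functionals D p"
    unfolding twist_def by (rule D.extend_functional_in[OF lin slot])
  show "PROP ?B"
    unfolding twist_def by (rule D.extend_functional_gen[OF lin slot])
qed

lemma cochain_functional: "\<phi> \<in> cochains H D M n \<Longrightarrow> \<phi> \<in> functionals D n"
  by (simp add: cochains_def)

lemma cochainD:
  "\<phi> \<in> cochains H D M n \<Longrightarrow> (Xs, fs) \<in> cyc_strings D n \<Longrightarrow>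
    tensor_lift (\<lambda>h1 h2. \<phi> (gen (ract M m h1) Xs (string_act H D (antipode H h2) Xs fs))) (comult H h)
      = counit H h * \<phi> (word m Xs fs)"
  unfolding cochains_def by blast

lemma cochainI:
  assumes "\<phi> \<in> functionals D n" "\<And>m Xs fs h. (Xs, fs) \<in> cyc_strings D n \<Longrightarrow>
    tensor_lift (\<lambda>h1 h2. \<phi> (gen (ract M m h1) Xs (string_act H D (antipode H h2) Xs fs))) (comult H h)
      = counit H h * \<phi> (word m Xs fs)"
  shows "\<phi> \<in> cochains H D M n"
  using assms unfolding cochains_def by blast

text \<open>The invariance condition at \<open>T Xs fs\<close> is carried back to \<open>fs\<close>
  by the intertwining property; the action on the coefficient is the same on both sides.\<close>

lemma pull_cochain:
  assumes H: "hopf_algebra H" and D: "left_H_category H D"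
    and T: "string_map H D p E n P T" and \<phi>: "\<phi> \<in> cochains H E M n"
  shows "pull D p P T \<phi> \<in> cochains H D M p"
proof -
  interpret D: left_H_category H D by fact
  note \<phi>' = cochain_functional[OF \<phi>]
  have T': "slot_map D p E n P T" using T by (simp add: string_map_def)
  note pull = pull_in[OF D T' \<phi>'] pull_gen[OF D T' \<phi>']
  have act: "pull D p P T \<phi> (gen m Xs (string_act H D h Xs fs))
      = \<phi> (gen m (P Xs) (string_act H E h (P Xs) (T Xs fs)))"
    if s: "(Xs, fs) \<in> cyc_strings D p" for m Xs fs h
  proof -
    have "pull D p P T \<phi> (gen m Xs (string_act H D h Xs fs))
        = (\<Sum>hs\<leftarrow>hlists H p h. \<phi> (word m (P Xs) (T Xs (act_list D hs Xs fs))))"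
      by (simp add: string_act_hlists[OF H D s] functional_gen_sum_list[OF pull(1)]
          D.act_list_in[OF s] pull(2))
    also have "\<dots> = \<phi> (gen m (P Xs) (\<Sum>hs\<leftarrow>hlists H p h. tens_list (T Xs (act_list D hs Xs fs))))"
      by (subst functional_gen_sum_list[OF \<phi>']) (simp_all add: slot_map_in[OF T'] D.act_list_in[OF s])
    also have "(\<Sum>hs\<leftarrow>hlists H p h. tens_list (T Xs (act_list D hs Xs fs)))
        = string_act H E h (P Xs) (T Xs fs)"
      using T s by (auto simp: string_map_def)
    finally show ?thesis .
  qed
  show ?thesis
    by (rule cochainI[OF pull(1)]) (simp add: act pull(2) cochainD[OF \<phi> slot_map_in[OF T']])
qed

lemma cochains_sum:
  assumes "\<And>k. k \<in> I \<Longrightarrow> \<phi> k \<in> cochains H D M n"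
  shows "(\<lambda>x. \<Sum>k\<in>I. c k * \<phi> k x) \<in> cochains H D M n"
proof (rule cochainI[OF functionals_sum])
  show "\<phi> k \<in> functionals D n" if "k \<in> I" for k
    using assms[OF that] by (rule cochain_functional)
  show "tensor_lift (\<lambda>h1 h2. \<Sum>k\<in>I. c k * \<phi> k (gen (ract M m h1) Xs
      (string_act H D (antipode H h2) Xs fs))) (comult H h)
    = counit H h * (\<Sum>k\<in>I. c k * \<phi> k (word m Xs fs))"
    if "(Xs, fs) \<in> cyc_strings D n" for m Xs fs h
    using cochainD[OF assms that, of _ m h] by (simp add: tensor_lift_sum sum_distrib_left mult_ac)
qed

section \<open>Faces, rotations and insertions\<close>

definition merge_obs :: "nat \<Rightarrow> 'o list \<Rightarrow> 'o list"
  where "merge_obs i Xs = take (i + 1) Xs @ drop (i + 2) Xs"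

definition merge_mor :: "('o, 'f, 'h) hcat \<Rightarrow> nat \<Rightarrow> 'o list \<Rightarrow> 'f list \<Rightarrow> 'f list"
  where "merge_mor D i Xs fs = take i fs @
    Comp D (src Xs (i + 1)) (Xs ! (i + 1)) (Xs ! i) (fs ! i) (fs ! (i + 1)) # drop (i + 2) fs"

definition wrap_obs :: "'o list \<Rightarrow> 'o list"
  where "wrap_obs Xs = last Xs # butlast (tl Xs)"

definition wrap_mor :: "('o, 'f, 'h) hcat \<Rightarrow> 'h \<Rightarrow> 'o list \<Rightarrow> 'f list \<Rightarrow> 'f list"
  where "wrap_mor D a Xs fs =
    Comp D (Xs ! 1) (Xs ! 0) (last Xs) (Act D (Xs ! 0) (last Xs) a (last fs)) (fs ! 0) # butlast (tl fs)"

definition rot_obs :: "'o list \<Rightarrow> 'o list"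
  where "rot_obs Xs = last Xs # butlast Xs"

definition rot_mor :: "('o, 'f, 'h) hcat \<Rightarrow> 'h \<Rightarrow> 'o list \<Rightarrow> 'f list \<Rightarrow> 'f list"
  where "rot_mor D a Xs fs = Act D (Xs ! 0) (last Xs) a (last fs) # butlast fs"

text \<open>An endomorphism placed after \<open>f^i\<close> lives at the source of
  \<open>f^i\<close>, so this object is repeated. In the last slot the repeated object is
  \<open>X_0\<close>, appended at the end.\<close>

definition insert_obs :: "nat \<Rightarrow> 'o list \<Rightarrow> 'o list"
  where "insert_obs i Xs = take (Suc i) Xs @ src Xs i # drop (Suc i) Xs"

definition insert_mor :: "('o \<Rightarrow> 'f) \<Rightarrow> nat \<Rightarrow> 'o list \<Rightarrow> 'f list \<Rightarrow> 'f list"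
  where "insert_mor c i Xs fs = take (Suc i) fs @ c (src Xs i) # drop (Suc i) fs"

lemma last_nth: "length xs = Suc n \<Longrightarrow> last xs = xs ! n"
  by (cases xs rule: rev_cases) auto

lemma merge_obs:
  assumes "length Xs = Suc (Suc p)" "i \<le> p"
  shows "length (merge_obs i Xs) = Suc p"
    and "j \<le> p \<Longrightarrow> merge_obs i Xs ! j = (if j \<le> i then Xs ! j else Xs ! Suc j)" (is "PROP ?B")
    and "j \<le> p \<Longrightarrow> src (merge_obs i Xs) j = (if j < i then src Xs j else src Xs (Suc j))" (is "PROP ?C")
proof -
  show l: "length (merge_obs i Xs) = Suc p" using assms by (simp add: merge_obs_def)
  have nth: "merge_obs i Xs ! j = (if j \<le> i then Xs ! j else Xs ! Suc j)" if "j \<le> p" for j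
    using assms that by (auto simp: merge_obs_def nth_append)
  then show "PROP ?B" .
  show "PROP ?C"
    using assms by (auto simp: src_eq[OF l] src_eq[OF assms(1)] nth)
qed

lemma merge_mor:
  assumes "length fs = Suc (Suc p)" "i \<le> p"
  shows "length (merge_mor D i Xs fs) = Suc p"
    and "j \<le> p \<Longrightarrow> merge_mor D i Xs fs ! j = (if j < i then fs ! j
      else if j = i then Comp D (src Xs (Suc i)) (Xs ! Suc i) (Xs ! i) (fs ! i) (fs ! Suc i) else fs ! Suc j)"
  using assms by (auto simp: merge_mor_def nth_append nth_Cons')

lemma wrap_obs:
  assumes "length Xs = Suc (Suc p)"
  shows "length (wrap_obs Xs) = Suc p"
    and "j \<le> p \<Longrightarrow> wrap_obs Xs ! j = (if j = 0 then Xs ! Suc p else Xs ! j)" (is "PROP ?B")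
    and "j \<le> p \<Longrightarrow> src (wrap_obs Xs) j = src Xs j" (is "PROP ?C")
proof -
  show l: "length (wrap_obs Xs) = Suc p" using assms by (simp add: wrap_obs_def)
  have nth: "wrap_obs Xs ! j = (if j = 0 then Xs ! Suc p else Xs ! j)" if "j \<le> p" for j
    using assms that by (auto simp: wrap_obs_def last_nth nth_Cons' nth_butlast nth_tl)
  then show "PROP ?B" .
  show "PROP ?C"
    using assms by (auto simp: src_eq[OF l] src_eq[OF assms] nth)
qed

lemma wrap_mor:
  assumes "length Xs = Suc (Suc p)" "length fs = Suc (Suc p)"
  shows "length (wrap_mor D a Xs fs) = Suc p"
    and "j \<le> p \<Longrightarrow> wrap_mor D a Xs fs ! j = (if j = 0 then
      Comp D (src Xs 0) (Xs ! 0) (Xs ! Suc p) (Act D (src Xs (Suc p)) (Xs ! Suc p) a (fs ! Suc p)) (fs ! 0)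
      else fs ! j)"
  using assms by (auto simp: wrap_mor_def last_nth nth_Cons' nth_butlast nth_tl src_eq)

lemma rot_obs:
  assumes "length Xs = Suc n"
  shows "length (rot_obs Xs) = Suc n"
    and "j \<le> n \<Longrightarrow> rot_obs Xs ! j = (if j = 0 then Xs ! n else Xs ! (j - 1))" (is "PROP ?B")
    and "j \<le> n \<Longrightarrow> src (rot_obs Xs) j = Xs ! j" (is "PROP ?C")
proof -
  show l: "length (rot_obs Xs) = Suc n" using assms by (simp add: rot_obs_def)
  have nth: "rot_obs Xs ! j = (if j = 0 then Xs ! n else Xs ! (j - 1))" if "j \<le> n" for j
    using assms that by (auto simp: rot_obs_def last_nth nth_Cons' nth_butlast)
  then show "PROP ?B" .
  show "PROP ?C"
    using assms by (auto simp: src_eq[OF l] nth)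
qed

lemma rot_mor:
  assumes "length Xs = Suc n" "length fs = Suc n"
  shows "length (rot_mor D a Xs fs) = Suc n"
    and "j \<le> n \<Longrightarrow> rot_mor D a Xs fs ! j =
      (if j = 0 then Act D (src Xs n) (Xs ! n) a (fs ! n) else fs ! (j - 1))"
  using assms by (auto simp: rot_mor_def last_nth nth_Cons' nth_butlast src_eq)

lemma insert_obs:
  assumes "length Xs = Suc p" "i \<le> p"
  shows "length (insert_obs i Xs) = Suc (Suc p)"
    and "j \<le> Suc p \<Longrightarrow> insert_obs i Xs ! j = (if j \<le> i then Xs ! j else if j = Suc i then src Xs i else Xs ! (j - 1))" (is "PROP ?B")
    and "j \<le> Suc p \<Longrightarrow> src (insert_obs i Xs) j = (if j \<le> i then src Xs j else src Xs (j - 1))" (is "PROP ?C")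
proof -
  show l: "length (insert_obs i Xs) = Suc (Suc p)" using assms by (simp add: insert_obs_def)
  have nth: "insert_obs i Xs ! j = (if j \<le> i then Xs ! j else if j = Suc i then src Xs i else Xs ! (j - 1))"
    if "j \<le> Suc p" for j
    using assms that by (auto simp: insert_obs_def nth_append nth_Cons' numeral_2_eq_2 Suc_diff_Suc)
  then show "PROP ?B" .
  show "PROP ?C"
    using assms by (cases j i rule: linorder_cases) (auto simp: src_eq[OF l] src_eq[OF assms(1)] nth)
qed

lemma insert_mor:
  assumes "length fs = Suc p" "i \<le> p"
  shows "length (insert_mor c i Xs fs) = Suc (Suc p)"
    and "j \<le> Suc p \<Longrightarrow> insert_mor c i Xs fs ! j =
      (if j \<le> i then fs ! j else if j = Suc i then c (src Xs i) else fs ! (j - 1))"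
  using assms by (auto simp: insert_mor_def nth_append nth_Cons' numeral_2_eq_2 Suc_diff_Suc)

context left_H_category
begin

lemma slot_map_merge:
  assumes "i \<le> p"
  shows "slot_map D (Suc p) D p (merge_obs i) (merge_mor D i)"
proof (rule slot_mapI[where k = "\<lambda>Xs fs j. if j \<le> i then j else j - 1"
      and L = "\<lambda>Xs fs j f. if j = i then Comp D (src Xs (Suc i)) (Xs ! Suc i) (Xs ! i) f (fs ! Suc i)
        else if j = Suc i then Comp D (src Xs (Suc i)) (Xs ! Suc i) (Xs ! i) (fs ! i) f else f"])
  fix Xs fs assume s: "(Xs, fs) \<in> cyc_strings D (Suc p)"
  note str = cyc_stringsD[OF s] and obs = merge_obs[OF cyc_stringsD(1)[OF s] assms]
    and mor = merge_mor[OF cyc_stringsD(2)[OF s] assms]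
  have sr: "src Xs i = Xs ! Suc i" using str(1) assms by (simp add: src_eq)
  have hom: "fs ! i \<in> Hom D (Xs ! Suc i) (Xs ! i)" "fs ! Suc i \<in> Hom D (src Xs (Suc i)) (Xs ! Suc i)"
    using str(5)[of i] str(5)[of "Suc i"] assms by (simp_all add: sr)
  have ob: "Xs ! i \<in> Ob D" "Xs ! Suc i \<in> Ob D" "src Xs (Suc i) \<in> Ob D"
    using str assms by simp_all
  show "(merge_obs i Xs, merge_mor D i Xs fs) \<in> cyc_strings D p"
  proof (rule cyc_stringsI)
    fix j assume "j \<le> p"
    then show "merge_mor D i Xs fs ! j \<in> Hom D (src (merge_obs i Xs) j) (merge_obs i Xs ! j)"
      using str hom ob by (auto simp: obs mor Comp_in_Hom)
  qed (use str obs mor in auto)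
  fix j assume j: "j \<le> Suc p"
  let ?L = "\<lambda>f. if j = i then Comp D (src Xs (Suc i)) (Xs ! Suc i) (Xs ! i) f (fs ! Suc i)
        else if j = Suc i then Comp D (src Xs (Suc i)) (Xs ! Suc i) (Xs ! i) (fs ! i) f else f"
  show "(if j \<le> i then j else j - 1) \<le> p \<and> clinear_on (Hom D (src Xs j) (Xs ! j)) ?L"
    using j assms hom ob
    by (cases "j = i"; cases "j = Suc i") (auto simp: sr clinear_on_id Comp_linear_left Comp_linear_right)
  fix f assume f: "f \<in> Hom D (src Xs j) (Xs ! j)"
  show "?L f \<in> Hom D (src (merge_obs i Xs) (if j \<le> i then j else j - 1))
      (merge_obs i Xs ! (if j \<le> i then j else j - 1))"
    using f j assms hom ob sr
    by (cases "j = i"; cases "j = Suc i") (auto simp: obs Comp_in_Hom)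
  show "merge_mor D i Xs (fs[j := f]) = (merge_mor D i Xs fs)[if j \<le> i then j else j - 1 := ?L f]"
    using j assms str(2)
    by (intro nth_equalityI) (auto simp: mor merge_mor nth_list_update)
qed

lemma slot_map_wrap: "slot_map D (Suc p) D p wrap_obs (wrap_mor D a)"
proof (rule slot_mapI[where k = "\<lambda>Xs fs j. if j = Suc p then 0 else j"
      and L = "\<lambda>Xs fs j f. if j = 0 then
          Comp D (src Xs 0) (Xs ! 0) (Xs ! Suc p) (Act D (src Xs (Suc p)) (Xs ! Suc p) a (fs ! Suc p)) f
        else if j = Suc p then Comp D (src Xs 0) (Xs ! 0) (Xs ! Suc p) (Act D (src Xs (Suc p)) (Xs ! Suc p) a f) (fs ! 0)
        else f"])
  fix Xs fs assume s: "(Xs, fs) \<in> cyc_strings D (Suc p)"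
  note str = cyc_stringsD[OF s] and obs = wrap_obs[OF cyc_stringsD(1)[OF s]]
    and mor = wrap_mor[OF cyc_stringsD(1,2)[OF s]]
  have sr: "src Xs (Suc p) = Xs ! 0" using str(1) by (simp add: src_eq)
  have hom: "fs ! 0 \<in> Hom D (src Xs 0) (Xs ! 0)" "fs ! Suc p \<in> Hom D (Xs ! 0) (Xs ! Suc p)"
    using str(5)[of 0] str(5)[of "Suc p"] by (simp_all add: sr)
  have ob: "Xs ! 0 \<in> Ob D" "Xs ! Suc p \<in> Ob D" "src Xs 0 \<in> Ob D"
    using str by simp_all
  show "(wrap_obs Xs, wrap_mor D a Xs fs) \<in> cyc_strings D p"
  proof (rule cyc_stringsI)
    fix j assume "j \<le> p"
    then show "wrap_mor D a Xs fs ! j \<in> Hom D (src (wrap_obs Xs) j) (wrap_obs Xs ! j)"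
      using str hom ob by (auto simp: obs mor sr Comp_in_Hom Act_in_Hom)
  qed (use str obs mor in auto)
  fix j assume j: "j \<le> Suc p"
  let ?L = "\<lambda>f. if j = 0 then
          Comp D (src Xs 0) (Xs ! 0) (Xs ! Suc p) (Act D (src Xs (Suc p)) (Xs ! Suc p) a (fs ! Suc p)) f
        else if j = Suc p then Comp D (src Xs 0) (Xs ! 0) (Xs ! Suc p) (Act D (src Xs (Suc p)) (Xs ! Suc p) a f) (fs ! 0)
        else f"
  have "clinear_on (Hom D (Xs ! 0) (Xs ! Suc p))
      (\<lambda>f. Comp D (src Xs 0) (Xs ! 0) (Xs ! Suc p) (Act D (Xs ! 0) (Xs ! Suc p) a f) (fs ! 0))"
    using hom ob by (intro clinear_on_compose[OF Comp_linear_left Act_linear_right] Act_in_Hom)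
  then show "(if j = Suc p then 0 else j) \<le> p \<and> clinear_on (Hom D (src Xs j) (Xs ! j)) ?L"
    using j hom ob
    by (cases "j = 0"; cases "j = Suc p") (auto simp: sr clinear_on_id Act_in_Hom Comp_linear_right)
  fix f assume f: "f \<in> Hom D (src Xs j) (Xs ! j)"
  show "?L f \<in> Hom D (src (wrap_obs Xs) (if j = Suc p then 0 else j))
      (wrap_obs Xs ! (if j = Suc p then 0 else j))"
    using f j hom ob by (auto simp: obs sr Comp_in_Hom Act_in_Hom)
  show "wrap_mor D a Xs (fs[j := f]) = (wrap_mor D a Xs fs)[if j = Suc p then 0 else j := ?L f]"
    using j str(1,2)
    by (intro nth_equalityI) (auto simp: mor wrap_mor nth_list_update)
qed

lemma slot_map_rot: "slot_map D n D n rot_obs (rot_mor D a)"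
proof (rule slot_mapI[where k = "\<lambda>Xs fs j. if j = n then 0 else Suc j"
      and L = "\<lambda>Xs fs j f. if j = n then Act D (src Xs n) (Xs ! n) a f else f"])
  fix Xs fs assume s: "(Xs, fs) \<in> cyc_strings D n"
  note str = cyc_stringsD[OF s] and obs = rot_obs[OF cyc_stringsD(1)[OF s]]
    and mor = rot_mor[OF cyc_stringsD(1,2)[OF s]]
  have sr: "src Xs j = (if j = n then Xs ! 0 else Xs ! Suc j)" if "j \<le> n" for j
    using str(1) that by (simp add: src_eq)
  show "(rot_obs Xs, rot_mor D a Xs fs) \<in> cyc_strings D n"
  proof (rule cyc_stringsI)
    fix j assume "j \<le> n"
    then show "rot_mor D a Xs fs ! j \<in> Hom D (src (rot_obs Xs) j) (rot_obs Xs ! j)"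
      using str(3)[of 0] str(3)[of n] str(5)[of n] str(5)[of "j - 1"]
      by (cases j) (auto simp: obs mor sr Act_in_Hom)
  qed (use str obs mor in auto)
  fix j assume j: "j \<le> n"
  let ?L = "\<lambda>f. if j = n then Act D (src Xs n) (Xs ! n) a f else f"
  show "(if j = n then 0 else Suc j) \<le> n \<and> clinear_on (Hom D (src Xs j) (Xs ! j)) ?L"
    using j str(3,4) by (auto simp: clinear_on_id Act_linear_right)
  fix f assume f: "f \<in> Hom D (src Xs j) (Xs ! j)"
  show "?L f \<in> Hom D (src (rot_obs Xs) (if j = n then 0 else Suc j))
      (rot_obs Xs ! (if j = n then 0 else Suc j))"
    using f j str(3-4) by (auto simp: obs sr Act_in_Hom)
  show "rot_mor D a Xs (fs[j := f]) = (rot_mor D a Xs fs)[if j = n then 0 else Suc j := ?L f]"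
    using j str(1,2)
    by (intro nth_equalityI) (auto simp: mor rot_mor nth_list_update)
qed

end

section \<open>Cofaces and the cyclic operator as maps of strings\<close>

locale hopf_cyclic = hopf_algebra H + left_H_category H D + sayd_module H M
  for H :: "('h::complex_algebra_1) hopf"
    and D :: "('o, 'f::complex_vector, 'h) hcat"
    and M :: "('m::complex_vector, 'h) sayd" +
  assumes antipode_bij: "bij (antipode H)"
begin

lemma clinear_inv_antipode: "clinear (inv (antipode H))"
  by (rule clinear_inv[OF antipode_linear antipode_bij])

lemma counit_inv_antipode: "counit H (inv (antipode H) a) = counit H a"
  using counit_antipode[of "inv (antipode H) a"] antipode_bij
  by (simp add: bij_is_surj surj_f_inv_f)

lemma coface_merge:
  assumes "i \<le> p"
  shows "coface H D M (Suc p) i \<phi> = pull D (Suc p) (merge_obs i) (merge_mor D i) \<phi>"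
  unfolding coface_def pull_def
  by (rule extend_functional_cong) (use assms in \<open>simp add: merge_obs_def merge_mor_def src_def cyc_stringsD(1)\<close>)

lemma coface_wrap:
  "coface H D M (Suc p) (Suc p) \<phi> = twist D M (Suc p) wrap_obs (\<lambda>a. wrap_mor D (inv (antipode H) a)) \<phi>"
  unfolding coface_def twist_def
  by (rule extend_functional_cong)
    (simp add: wrap_obs_def wrap_mor_def last_nth[OF cyc_stringsD(1)] last_nth[OF cyc_stringsD(2)])

lemma cyc_op_rot: "cyc_op H D M n \<phi> = twist D M n rot_obs (\<lambda>a. rot_mor D (inv (antipode H) a)) \<phi>"
  unfolding cyc_op_def twist_def
  by (rule extend_functional_cong)
    (simp add: rot_obs_def rot_mor_def last_nth[OF cyc_stringsD(1)] last_nth[OF cyc_stringsD(2)])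

text \<open>Linearity in the coaction leg makes the Sweedler expression in \<open>twist\<close> a
  linear function of the coefficient, as the extension to a functional requires.\<close>

lemma wrap_linear:
  fixes \<phi> :: "('n::complex_vector, 'o, 'f) chain \<Rightarrow> complex"
  assumes \<phi>: "\<phi> \<in> functionals D p" and s: "(Xs, fs) \<in> cyc_strings D (Suc p)"
  shows "clinear (\<lambda>a. \<phi> (word m (wrap_obs Xs) (wrap_mor D (inv (antipode H) a) Xs fs)))"
proof -
  note str = cyc_stringsD[OF s]
  have sr: "src Xs (Suc p) = Xs ! 0" using str(1) by (simp add: src_eq)
  have hom: "fs ! 0 \<in> Hom D (src Xs 0) (Xs ! 0)" "fs ! Suc p \<in> Hom D (Xs ! 0) (Xs ! Suc p)"
    using str(5)[of 0] str(5)[of "Suc p"] by (simp_all add: sr)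
  have ob: "Xs ! 0 \<in> Ob D" "Xs ! Suc p \<in> Ob D" "src Xs 0 \<in> Ob D"
    using str by simp_all
  let ?L = "\<lambda>a. Comp D (src Xs 0) (Xs ! 0) (Xs ! Suc p)
    (Act D (Xs ! 0) (Xs ! Suc p) (inv (antipode H) a) (fs ! Suc p)) (fs ! 0)"
  have "clinear_on UNIV (\<lambda>a. Act D (Xs ! 0) (Xs ! Suc p) (inv (antipode H) a) (fs ! Suc p))"
    using clinear_compose[OF Act_linear_left[OF ob(1,2) hom(2)] clinear_inv_antipode]
    by (simp add: clinear_on_def clinear_iff)
  from clinear_on_compose[OF Comp_linear_left[OF ob(3,1,2) hom(1)] this]
  have L: "clinear_on UNIV ?L" using ob hom by (simp add: Act_in_Hom)
  \<comment> \<open>The string acted on by \<open>0\<close> is only a reference point; its slot 0,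
    the only one that depends on the acting element, is overwritten.\<close>
  have "clinear_on UNIV (\<lambda>a. \<phi> (word m (wrap_obs Xs) (wrap_mor D (inv (antipode H) a) Xs fs)))"
  proof (rule functional_slot_map[OF \<phi> slot_map_in[OF slot_map_wrap[of p 0] s] _ _ L, of 0])
    show "?L a \<in> Hom D (src (wrap_obs Xs) 0) (wrap_obs Xs ! 0)" for a
      using ob hom by (simp add: wrap_obs[OF str(1)] Comp_in_Hom Act_in_Hom)
    show "wrap_mor D (inv (antipode H) a) Xs fs = (wrap_mor D 0 Xs fs)[0 := ?L a]" for a
      using str(1,2) by (intro nth_equalityI) (auto simp: wrap_mor nth_list_update sr)
  qed (auto simp: cv.subspace_UNIV)
  then show ?thesis by (simp add: clinear_on_def clinear_iff)
qed

lemma rot_linear: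
  fixes \<phi> :: "('n::complex_vector, 'o, 'f) chain \<Rightarrow> complex"
  assumes \<phi>: "\<phi> \<in> functionals D n" and s: "(Xs, fs) \<in> cyc_strings D n"
  shows "clinear (\<lambda>a. \<phi> (word m (rot_obs Xs) (rot_mor D (inv (antipode H) a) Xs fs)))"
proof -
  note str = cyc_stringsD[OF s]
  let ?L = "\<lambda>a. Act D (src Xs n) (Xs ! n) (inv (antipode H) a) (fs ! n)"
  have hom: "fs ! n \<in> Hom D (src Xs n) (Xs ! n)" and ob: "src Xs n \<in> Ob D" "Xs ! n \<in> Ob D"
    using str by simp_all
  have L: "clinear_on UNIV ?L"
    using clinear_compose[OF Act_linear_left[OF ob hom] clinear_inv_antipode]
    by (simp add: clinear_on_def clinear_iff)
  have "clinear_on UNIV (\<lambda>a. \<phi> (word m (rot_obs Xs) (rot_mor D (inv (antipode H) a) Xs fs)))"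
  proof (rule functional_slot_map[OF \<phi> slot_map_in[OF slot_map_rot[of n 0] s] _ _ L, of 0])
    show "?L a \<in> Hom D (src (rot_obs Xs) 0) (rot_obs Xs ! 0)" for a
      using Act_in_Hom[OF ob hom, of "inv (antipode H) a"] str(1)
      by (simp add: rot_obs[OF str(1)] src_end)
    show "rot_mor D (inv (antipode H) a) Xs fs = (rot_mor D 0 Xs fs)[0 := ?L a]" for a
      using str(1,2) by (intro nth_equalityI) (auto simp: rot_mor nth_list_update)
  qed (auto simp: cv.subspace_UNIV)
  then show ?thesis by (simp add: clinear_on_def clinear_iff)
qed

lemmas category = left_H_category_axioms and hopf = hopf_algebra_axioms and sayd = sayd_module_axioms

lemma coface_merge_gen:
  "\<lbrakk>\<phi> \<in> functionals D p; i \<le> p; (Xs, fs) \<in> cyc_strings D (Suc p)\<rbrakk> \<Longrightarrow>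
    coface H D M (Suc p) i \<phi> (word m Xs fs)
      = \<phi> (word m (merge_obs i Xs) (merge_mor D i Xs fs))"
  by (simp add: coface_merge pull_gen[OF category slot_map_merge])

lemma coface_wrap_gen:
  "\<lbrakk>\<phi> \<in> functionals D p; (Xs, fs) \<in> cyc_strings D (Suc p)\<rbrakk> \<Longrightarrow>
    coface H D M (Suc p) (Suc p) \<phi> (word m Xs fs) = tensor_lift (\<lambda>a m0.
      \<phi> (word m0 (wrap_obs Xs) (wrap_mor D (inv (antipode H) a) Xs fs))) (coact M m)"
  by (simp add: coface_wrap twist_gen[OF category sayd slot_map_wrap _ wrap_linear])

lemma cyc_op_gen:
  "\<lbrakk>\<phi> \<in> functionals D n; (Xs, fs) \<in> cyc_strings D n\<rbrakk> \<Longrightarrow>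
    cyc_op H D M n \<phi> (word m Xs fs) = tensor_lift (\<lambda>a m0.
      \<phi> (word m0 (rot_obs Xs) (rot_mor D (inv (antipode H) a) Xs fs))) (coact M m)"
  by (simp add: cyc_op_rot twist_gen[OF category sayd slot_map_rot _ rot_linear])

lemma coface_in:
  assumes "\<phi> \<in> functionals D p" "i \<le> Suc p"
  shows "coface H D M (Suc p) i \<phi> \<in> functionals D (Suc p)"
proof (cases "i = Suc p")
  case True
  then show ?thesis using assms
    by (simp add: coface_wrap twist_in[OF category sayd slot_map_wrap _ wrap_linear])
next
  case False
  then show ?thesis using assms by (simp add: coface_merge pull_in[OF category slot_map_merge])
qed

lemma cyc_op_in: "\<phi> \<in> functionals D n \<Longrightarrow> cyc_op H D M n \<phi> \<in> functionals D n"
  by (simp add: cyc_op_rot twist_in[OF category sayd slot_map_rot _ rot_linear])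

lemma bdiff_in: "\<phi> \<in> functionals D p \<Longrightarrow> bdiff H D M p \<phi> \<in> functionals D (Suc p)"
  unfolding bdiff_def by (intro functionals_sum) (simp add: coface_in)

end

section \<open>Faces and rotations of a string with an inserted entry\<close>

lemma insert_merge_less:
  assumes "length Xs = Suc (Suc p)" "length fs = Suc (Suc p)" "k \<le> i" "i \<le> p"
  shows "merge_obs k (insert_obs (Suc i) Xs) = insert_obs i (merge_obs k Xs)" (is ?A)
    and "merge_mor D k (insert_obs (Suc i) Xs) (insert_mor c (Suc i) Xs fs)
      = insert_mor c i (merge_obs k Xs) (merge_mor D k Xs fs)" (is ?B)
proof -
  have k: "k \<le> Suc p" "k \<le> p" and i: "Suc i \<le> Suc p" using assms by auto
  note io = insert_obs[OF assms(1) i] and im = insert_mor[OF assms(2) i]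
    and mo = merge_obs[OF assms(1) k(2)] and mm = merge_mor[OF assms(2) k(2)]
  note simps = io im mo mm merge_obs[OF io(1) k(1)] merge_mor[OF im(1) k(1)]
    insert_obs[OF mo(1) assms(4)] insert_mor[OF mm(1) assms(4)]
  show ?A
    using assms(3,4) by (intro nth_equalityI) (auto simp: simps)
  show ?B
    using assms(3,4) by (intro nth_equalityI) (auto simp: simps)
qed

lemma insert_merge_greater:
  assumes "length Xs = Suc (Suc p)" "length fs = Suc (Suc p)" "i < k" "k \<le> p"
  shows "merge_obs (Suc k) (insert_obs i Xs) = insert_obs i (merge_obs k Xs)" (is ?A)
    and "merge_mor D (Suc k) (insert_obs i Xs) (insert_mor c i Xs fs)
      = insert_mor c i (merge_obs k Xs) (merge_mor D k Xs fs)" (is ?B)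
proof -
  have k: "Suc k \<le> Suc p" and i: "i \<le> p" "i \<le> Suc p" using assms by auto
  note io = insert_obs[OF assms(1) i(2)] and im = insert_mor[OF assms(2) i(2)]
    and mo = merge_obs[OF assms(1,4)] and mm = merge_mor[OF assms(2,4)]
  note simps = io im mo mm merge_obs[OF io(1) k] merge_mor[OF im(1) k]
    insert_obs[OF mo(1) i(1)] insert_mor[OF mm(1) i(1)]
  show ?A
    using assms(3,4) by (intro nth_equalityI) (auto simp: simps)
  show ?B
    using assms(3,4) by (intro nth_equalityI) (auto simp: simps)
qed

lemma insert_wrap:
  assumes "length Xs = Suc (Suc p)" "length fs = Suc (Suc p)" "i \<le> p"
  shows "wrap_obs (insert_obs i Xs) = insert_obs i (wrap_obs Xs)" (is ?A)
    and "wrap_mor D a (insert_obs i Xs) (insert_mor c i Xs fs)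
      = insert_mor c i (wrap_obs Xs) (wrap_mor D a Xs fs)" (is ?B)
proof -
  have i: "i \<le> Suc p" using assms by auto
  note io = insert_obs[OF assms(1) i] and im = insert_mor[OF assms(2) i]
    and mo = wrap_obs[OF assms(1)] and mm = wrap_mor[OF assms(1,2)]
  note simps = io im mo mm wrap_obs[OF io(1)] wrap_mor[OF io(1) im(1)]
    insert_obs[OF mo(1) assms(3)] insert_mor[OF mm(1) assms(3)]
  show ?A
    using assms(3) by (intro nth_equalityI) (auto simp: simps)
  show ?B
    using assms(3) by (intro nth_equalityI) (auto simp: simps)
qed

text \<open>The two faces adjacent to the new entry multiply it into its neighbours. This one gives
  \<open>f^i c\<close>, the next lemma gives \<open>c f^(i+1)\<close>; they are the two halves of
  the commutator.\<close>

lemma insert_merge_same: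
  assumes "length Xs = Suc n" "length fs = Suc n" "i \<le> n"
  shows "merge_obs i (insert_obs i Xs) = Xs"
    and "merge_mor D i (insert_obs i Xs) (insert_mor c i Xs fs)
      = fs[i := Comp D (src Xs i) (src Xs i) (Xs ! i) (fs ! i) (c (src Xs i))]" (is ?B)
proof -
  note io = insert_obs[OF assms(1,3)] and im = insert_mor[OF assms(2,3)]
  note simps = io im merge_obs[OF io(1) assms(3)] merge_mor[OF im(1) assms(3)]
  show "merge_obs i (insert_obs i Xs) = Xs"
    using assms by (intro nth_equalityI) (auto simp: simps)
  show ?B
    using assms by (intro nth_equalityI) (auto simp: simps nth_list_update)
qed

lemma insert_merge_Suc:
  assumes "length Xs = Suc n" "length fs = Suc n" "i < n"
  shows "merge_obs (Suc i) (insert_obs i Xs) = Xs"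
    and "merge_mor D (Suc i) (insert_obs i Xs) (insert_mor c i Xs fs)
      = fs[Suc i := Comp D (src Xs (Suc i)) (Xs ! Suc i) (Xs ! Suc i) (c (Xs ! Suc i)) (fs ! Suc i)]" (is ?B)
proof -
  have i: "i \<le> n" "Suc i \<le> n" using assms by auto
  have sr: "src Xs i = Xs ! Suc i" using assms by (simp add: src_eq)
  note io = insert_obs[OF assms(1) i(1)] and im = insert_mor[OF assms(2) i(1)]
  note simps = io im merge_obs[OF io(1) i(2)] merge_mor[OF im(1) i(2)] sr
  show "merge_obs (Suc i) (insert_obs i Xs) = Xs"
    using assms by (intro nth_equalityI) (auto simp: simps elim: le_SucE)
  show ?B
    using assms by (intro nth_equalityI) (auto simp: simps nth_list_update)
qed

text \<open>After the last slot the next neighbour of the new entry is \<open>f^0\<close>, which is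
  reached only by the wrapping face. Here the new entry is hit by the acting element.\<close>

lemma insert_wrap_end:
  assumes "length Xs = Suc n" "length fs = Suc n"
  shows "wrap_obs (insert_obs n Xs) = Xs"
    and "wrap_mor D a (insert_obs n Xs) (insert_mor c n Xs fs)
      = fs[0 := Comp D (src Xs 0) (Xs ! 0) (Xs ! 0) (Act D (Xs ! 0) (Xs ! 0) a (c (Xs ! 0))) (fs ! 0)]" (is ?B)
proof -
  have sr: "src Xs n = Xs ! 0" using assms by (simp add: src_end)
  note io = insert_obs[OF assms(1) le_refl] and im = insert_mor[OF assms(2) le_refl]
  note simps = io im wrap_obs[OF io(1)] wrap_mor[OF io(1) im(1)] sr
  show "wrap_obs (insert_obs n Xs) = Xs"
    using assms by (intro nth_equalityI) (auto simp: simps)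
  show ?B
    using assms by (intro nth_equalityI) (auto simp: simps nth_list_update)
qed

lemma insert_rot:
  assumes "length Xs = Suc p" "length fs = Suc p" "j < p"
  shows "insert_obs (Suc j) (rot_obs Xs) = rot_obs (insert_obs j Xs)" (is ?A)
    and "insert_mor c (Suc j) (rot_obs Xs) (rot_mor D a Xs fs)
      = rot_mor D a (insert_obs j Xs) (insert_mor c j Xs fs)" (is ?B)
proof -
  have j: "j \<le> p" "Suc j \<le> p" using assms by auto
  have sr: "src Xs j = Xs ! Suc j" "src Xs p = Xs ! 0" using assms by (simp_all add: src_eq)
  note io = insert_obs[OF assms(1) j(1)] and im = insert_mor[OF assms(2) j(1)]
    and ro = rot_obs[OF assms(1)] and rm = rot_mor[OF assms(1,2)]
  note simps = io im ro rm insert_obs[OF ro(1) j(2)] insert_mor[OF rm(1) j(2)]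
    rot_obs[OF io(1)] rot_mor[OF io(1) im(1)] sr
  show ?A
    using assms by (intro nth_equalityI) (auto simp: simps)
  show ?B
    using assms by (intro nth_equalityI) (auto simp: simps)
qed

text \<open>The exceptional case of \<open>insert_rot\<close>, where the new entry crosses the end
  of the string. It goes from slot \<open>p\<close> to the front in one rotation and from the front
  to slot \<open>0\<close> in a second one.\<close>

lemma insert_0_rot:
  assumes "length Xs = Suc p" "length fs = Suc p"
  shows "insert_obs 0 (rot_obs Xs) = rot_obs (Xs ! 0 # Xs)" (is ?A)
    and "insert_mor c 0 (rot_obs Xs) (rot_mor D a Xs fs) = rot_mor D a (Xs ! 0 # Xs) (c (Xs ! 0) # fs)" (is ?B)
    and "rot_obs (insert_obs p Xs) = Xs ! 0 # Xs"
    and "rot_mor D a (insert_obs p Xs) (insert_mor c p Xs fs) = Act D (Xs ! 0) (Xs ! 0) a (c (Xs ! 0)) # fs" (is ?D)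
proof -
  have sr: "src Xs p = Xs ! 0" using assms by (simp add: src_eq)
  have ne: "Xs \<noteq> []" "fs \<noteq> []" using assms by auto
  show ?A
    using ne rot_obs(3)[OF assms(1), of 0] by (simp add: insert_obs_def rot_obs_def)
  show ?B
    using ne rot_obs(3)[OF assms(1), of 0] by (simp add: insert_mor_def rot_mor_def)
  show "rot_obs (insert_obs p Xs) = Xs ! 0 # Xs"
    using assms sr by (simp add: insert_obs_def rot_obs_def)
  show ?D
    using assms sr by (simp add: insert_obs_def insert_mor_def rot_mor_def nth_append)
qed

section \<open>The homotopy of an inner derivation\<close>

text \<open>In the application \<open>G i k\<close> is the \<open>k\<close>-th face after an
  insertion at \<open>i\<close>, and \<open>P i k\<close> is the insertion at \<open>i\<close> after
  the \<open>k\<close>-th face. A face away from the new entry commutes with the insertion after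
  shifting one index, which costs a sign; the two adjacent faces carry opposite signs and
  remain.\<close>

lemma sum_alternating_faces:
  fixes G P :: "nat \<Rightarrow> nat \<Rightarrow> complex"
  assumes less: "\<And>i k. k < i \<Longrightarrow> i \<le> n \<Longrightarrow> G i k = P (i - 1) k"
    and greater: "\<And>i k. i < k \<Longrightarrow> k \<le> n \<Longrightarrow> G i (Suc k) = P i k"
  shows "(\<Sum>i\<le>n. (-1) ^ i * (\<Sum>k\<le>Suc n. (-1) ^ k * G i k))
    = (\<Sum>i\<le>n. G i i - G i (Suc i)) - (\<Sum>i<n. (-1) ^ i * (\<Sum>k\<le>n. (-1) ^ k * P i k))"
proof -
  have split: "(\<Sum>k\<le>Suc n. f k) = (\<Sum>k<i. f k) + f i + f (Suc i) + (\<Sum>k\<in>{Suc i..n}. f (Suc k))"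
    if "i \<le> n" for i and f :: "nat \<Rightarrow> complex"
  proof -
    have "(\<Sum>k\<in>{Suc i..n}. f (Suc k)) = (\<Sum>k\<in>{Suc (Suc i)..Suc n}. f k)"
      by (rule sum.shift_bounds_cl_Suc_ivl[symmetric])
    moreover have "{..Suc n} = {..<i} \<union> {i, Suc i} \<union> {Suc (Suc i)..Suc n}" using that by auto
    then have "(\<Sum>k\<le>Suc n. f k) = (\<Sum>k\<in>{..<i} \<union> {i, Suc i}. f k) + (\<Sum>k\<in>{Suc (Suc i)..Suc n}. f k)"
      by (simp only:) (rule sum.union_disjoint; auto)
    moreover have "(\<Sum>k\<in>{..<i} \<union> {i, Suc i}. f k) = (\<Sum>k<i. f k) + (f i + f (Suc i))"
      by (subst sum.union_disjoint) auto
    ultimately show ?thesis by simp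
  qed
  have one: "(-1) ^ i * (\<Sum>k\<le>Suc n. (-1) ^ k * G i k) = (G i i - G i (Suc i))
      + (-1) ^ i * (\<Sum>k<i. (-1) ^ k * P (i - 1) k) - (-1) ^ i * (\<Sum>k\<in>{Suc i..n}. (-1) ^ k * P i k)"
    if "i \<le> n" for i
  proof -
    have sq: "(-1) ^ i * ((-1) ^ i * x) = x" for x :: complex
      by (simp add: mult.assoc[symmetric] power_add[symmetric])
    have eqs: "(\<Sum>k<i. (-1) ^ k * G i k) = (\<Sum>k<i. (-1) ^ k * P (i - 1) k)"
      "(\<Sum>k\<in>{Suc i..n}. (-1) ^ Suc k * G i (Suc k)) = - (\<Sum>k\<in>{Suc i..n}. (-1) ^ k * P i k)"
      using that less greater by (simp_all add: sum_negf)
    show ?thesis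
      by (simp only: split[OF that] eqs) (simp add: distrib_left right_diff_distrib sq)
  qed
  have shift: "(\<Sum>i\<le>n. (-1) ^ i * (\<Sum>k<i. (-1) ^ k * P (i - 1) k))
      = - (\<Sum>i<n. (-1) ^ i * (\<Sum>k\<le>i. (-1) ^ k * P i k))"
    by (cases n) (simp_all add: sum.atMost_Suc_shift lessThan_Suc_atMost sum_negf del: sum.atMost_Suc)
  have last: "(\<Sum>i\<le>n. (-1) ^ i * (\<Sum>k\<in>{Suc i..n}. (-1) ^ k * P i k))
      = (\<Sum>i<n. (-1) ^ i * (\<Sum>k\<in>{Suc i..n}. (-1) ^ k * P i k))"
    by (simp add: lessThan_Suc_atMost[symmetric])
  have join: "(\<Sum>k\<le>i. f k) + (\<Sum>k\<in>{Suc i..n}. f k) = (\<Sum>k\<le>n. f k)"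
    if "i < n" for i and f :: "nat \<Rightarrow> complex"
  proof -
    have "{..n} = {..i} \<union> {Suc i..n}" using that by auto
    then show ?thesis by (simp only:) (rule sum.union_disjoint[symmetric]; auto)
  qed
  have "(\<Sum>i\<le>n. (-1) ^ i * (\<Sum>k\<le>Suc n. (-1) ^ k * G i k))
     = (\<Sum>i\<le>n. (G i i - G i (Suc i)) + (-1) ^ i * (\<Sum>k<i. (-1) ^ k * P (i - 1) k)
      - (-1) ^ i * (\<Sum>k\<in>{Suc i..n}. (-1) ^ k * P i k))"
    by (rule sum.cong[OF refl]) (simp only: atMost_iff one)
  also have "\<dots> = (\<Sum>i\<le>n. G i i - G i (Suc i)) - (\<Sum>i<n. (-1) ^ i * (\<Sum>k\<le>i. (-1) ^ k * P i k))
      - (\<Sum>i<n. (-1) ^ i * (\<Sum>k\<in>{Suc i..n}. (-1) ^ k * P i k))"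
    by (simp only: sum.distrib sum_subtractf shift last) simp
  also have "\<dots> = (\<Sum>i\<le>n. G i i - G i (Suc i)) - (\<Sum>i<n. (-1) ^ i * (\<Sum>k\<le>n. (-1) ^ k * P i k))"
    by (simp add: join[symmetric] distrib_left sum.distrib algebra_simps)
  finally show ?thesis .
qed

definition invariant_family :: "('h::complex_vector) hopf \<Rightarrow> ('o, 'f::complex_vector, 'h) hcat \<Rightarrow> ('o \<Rightarrow> 'f) \<Rightarrow> bool"
  where "invariant_family H D c \<longleftrightarrow>
    (\<forall>X\<in>Ob D. c X \<in> Hom D X X \<and> (\<forall>h. Act D X X h (c X) = counit H h *\<^sub>C c X))"

definition commutator :: "('o, 'f::ab_group_add, 'h) hcat \<Rightarrow> ('o \<Rightarrow> 'f) \<Rightarrow> 'o \<Rightarrow> 'o \<Rightarrow> 'f \<Rightarrow> 'f"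
  where "commutator D c X Y f = Comp D X X Y f (c X) - Comp D X Y Y (c Y) f"

text \<open>The homotopy lowers the degree: \<open>\<phi>\<close> has degree \<open>p + 1\<close>
  and the result has degree \<open>p\<close>.\<close>

definition insertion :: "('o, 'f::complex_vector, 'h) hcat \<Rightarrow> ('o \<Rightarrow> 'f) \<Rightarrow> nat
    \<Rightarrow> (('m::complex_vector, 'o, 'f) chain \<Rightarrow> complex) \<Rightarrow> ('m, 'o, 'f) chain \<Rightarrow> complex"
  where "insertion D c p \<phi> = (\<lambda>x. \<Sum>i\<le>p. (-1) ^ i * pull D p (insert_obs i) (insert_mor c i) \<phi> x)"

lemma string_act_src: "string_act H D h Xs fs
    = diag_act H (map (\<lambda>i h. Act D (src Xs i) (Xs ! i) h (fs ! i)) [0..<length fs]) h"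
  by (simp add: string_act_def src_def)

context hopf_cyclic
begin

lemma coface_sum_gen:
  assumes "\<And>k. k \<in> I \<Longrightarrow> \<phi> k \<in> functionals D p" "i \<le> Suc p" "(Xs, fs) \<in> cyc_strings D (Suc p)"
  shows "coface H D M (Suc p) i (\<lambda>x. \<Sum>k\<in>I. c k * \<phi> k x) (word m Xs fs)
    = (\<Sum>k\<in>I. c k * coface H D M (Suc p) i (\<phi> k) (word m Xs fs))"
proof (cases "i = Suc p")
  case True
  then show ?thesis using assms
    by (simp add: coface_wrap_gen functionals_sum tensor_lift_sum)
next
  case False
  then show ?thesis using assms by (simp add: coface_merge_gen functionals_sum)
qed

lemma cyc_op_sum_gen:
  assumes "\<And>k. k \<in> I \<Longrightarrow> \<phi> k \<in> functionals D n" "(Xs, fs) \<in> cyc_strings D n"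
  shows "cyc_op H D M n (\<lambda>x. \<Sum>k\<in>I. c k * \<phi> k x) (word m Xs fs)
    = (\<Sum>k\<in>I. c k * cyc_op H D M n (\<phi> k) (word m Xs fs))"
  using assms by (simp add: cyc_op_gen functionals_sum tensor_lift_sum)

lemma cyclic_cochain_cyc_op:
  assumes "\<phi> \<in> cyclic_cochains H D M n"
  shows "cyc_op H D M n \<phi> x = (-1) ^ n * \<phi> x"
proof -
  have "\<phi> x = (-1) ^ n * cyc_op H D M n \<phi> x"
    using assms unfolding cyclic_cochains_def by (auto dest: fun_cong)
  then show ?thesis by (simp add: mult.assoc[symmetric] power_add[symmetric])
qed

lemma cyclic_cochainI:
  assumes "\<phi> \<in> cochains H D M n"
    and "\<And>m Xs fs. (Xs, fs) \<in> cyc_strings D n \<Longrightarrow>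
      cyc_op H D M n \<phi> (word m Xs fs) = (-1) ^ n * \<phi> (word m Xs fs)"
  shows "\<phi> \<in> cyclic_cochains H D M n"
proof -
  note \<phi> = cochain_functional[OF assms(1)]
  have "\<phi> = (\<lambda>x. (-1) ^ n * cyc_op H D M n \<phi> x)"
    by (rule functionals_eqI[OF \<phi> functionals_scale[OF cyc_op_in[OF \<phi>]]])
      (simp add: assms(2) mult.assoc[symmetric] power_add[symmetric])
  then show ?thesis using assms(1) unfolding cyclic_cochains_def by blast
qed

text \<open>Once the coaction leg enters only through the counit, which the inverse antipode
  preserves, the counit axiom of the comodule removes it.\<close>

lemma counit_twist:
  assumes "clinear L"
  shows "tensor_lift (\<lambda>a m0. counit H (inv (antipode H) a) * L m0) (coact M m) = L m"
  using clinear_tensor_lift_out[OF assms, of "\<lambda>a m0. counit H a *\<^sub>C m0" "coact M m"]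
  by (simp add: counit_inv_antipode coact_counit clinear_scale[OF assms] scaleC_complex_def)

context
  fixes c :: "'o \<Rightarrow> 'f"
  assumes c: "invariant_family H D c"
begin

lemma c_hom: "X \<in> Ob D \<Longrightarrow> c X \<in> Hom D X X"
  and c_act: "X \<in> Ob D \<Longrightarrow> Act D X X h (c X) = counit H h *\<^sub>C c X"
  using c by (simp_all add: invariant_family_def)

lemma insert_in:
  assumes s: "(Xs, fs) \<in> cyc_strings D p" and i: "i \<le> p"
  shows "(insert_obs i Xs, insert_mor c i Xs fs) \<in> cyc_strings D (Suc p)"
proof -
  note str = cyc_stringsD[OF s]
  note obs = insert_obs[OF str(1) i] and mor = insert_mor[OF str(2) i]
  show ?thesis
  proof (rule cyc_stringsI)
    fix j assume j: "j \<le> Suc p"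
    show "insert_obs i Xs ! j \<in> Ob D" using j i str by (auto simp: obs)
    show "insert_mor c i Xs fs ! j \<in> Hom D (src (insert_obs i Xs) j) (insert_obs i Xs ! j)"
      using j i str(4)[of i] str(5)[of j] str(5)[of "j - 1"] c_hom by (auto simp: obs mor)
  qed (use obs mor in auto)
qed

lemma slot_map_insert:
  assumes i: "i \<le> p"
  shows "slot_map D p D (Suc p) (insert_obs i) (insert_mor c i)"
proof (rule slot_mapI[where k = "\<lambda>Xs fs j. if j \<le> i then j else Suc j" and L = "\<lambda>Xs fs j f. f"])
  fix Xs fs assume s: "(Xs, fs) \<in> cyc_strings D p"
  note str = cyc_stringsD[OF s]
  note obs = insert_obs[OF str(1) i] and mor = insert_mor[OF str(2) i]
  show "(insert_obs i Xs, insert_mor c i Xs fs) \<in> cyc_strings D (Suc p)" by (rule insert_in[OF s i])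
  fix j assume j: "j \<le> p"
  show "(if j \<le> i then j else Suc j) \<le> Suc p \<and> clinear_on (Hom D (src Xs j) (Xs ! j)) (\<lambda>f. f)"
    using j by (auto simp: clinear_on_id)
  fix f assume f: "f \<in> Hom D (src Xs j) (Xs ! j)"
  show "f \<in> Hom D (src (insert_obs i Xs) (if j \<le> i then j else Suc j))
      (insert_obs i Xs ! (if j \<le> i then j else Suc j))"
    using f j i by (auto simp: obs)
  show "insert_mor c i Xs (fs[j := f]) = (insert_mor c i Xs fs)[if j \<le> i then j else Suc j := f]"
    using j i str(2)
    by (intro nth_equalityI) (auto simp: mor insert_mor nth_list_update)
qed

lemma string_map_insert:
  assumes i: "i \<le> p"
  shows "string_map H D p D (Suc p) (insert_obs i) (insert_mor c i)"
proof -
  have "(\<Sum>hs\<leftarrow>hlists H p h. tens_list (insert_mor c i Xs (act_list D hs Xs fs)))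
      = string_act H D h (insert_obs i Xs) (insert_mor c i Xs fs)"
    if s: "(Xs, fs) \<in> cyc_strings D p" for Xs fs h
  proof -
    note str = cyc_stringsD[OF s]
    note obs = insert_obs[OF str(1) i] and mor = insert_mor[OF str(2) i]
    define gs where "gs = map (\<lambda>i h. Act D (src Xs i) (Xs ! i) h (fs ! i)) [0..<length fs]"
    have lin: "clinear g" if g: "g \<in> set gs" for g
    proof -
      obtain k where k: "k \<le> p" "g = (\<lambda>h. Act D (src Xs k) (Xs ! k) h (fs ! k))"
        using g str(2) by (auto simp: gs_def less_Suc_eq_le simp del: upt_Suc)
      show ?thesis unfolding k(2) using k(1) str by (intro Act_linear_left)
    qed
    have "src Xs i \<in> Ob D" using str i by simp
    then have "map (\<lambda>k h. Act D (src (insert_obs i Xs) k) (insert_obs i Xs ! k) h (insert_mor c i Xs fs ! k))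
          [0..<length (insert_mor c i Xs fs)]
        = take (Suc i) gs @ (\<lambda>h. counit H h *\<^sub>C c (src Xs i)) # drop (Suc i) gs"
      using i str(2) unfolding mor(1) gs_def
      apply (intro nth_equalityI)
       apply (simp del: upt_Suc)
      subgoal for j
        by (cases j "Suc i" rule: linorder_cases)
          (auto simp: obs mor nth_append nth_Cons' c_act numeral_2_eq_2 Suc_diff_Suc less_Suc_eq_le fun_eq_iff simp del: upt_Suc)
      done
    then have "string_act H D h (insert_obs i Xs) (insert_mor c i Xs fs)
        = diag_act H (take (Suc i) gs @ (\<lambda>h. counit H h *\<^sub>C c (src Xs i)) # drop (Suc i) gs) h"
      by (simp only: string_act_src)
    also have "\<dots> = tens_insert (length (take (Suc i) gs)) (c (src Xs i)) (diag_act H (take (Suc i) gs @ drop (Suc i) gs) h)"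
      by (rule diag_act_insert) (simp add: lin)
    also have "\<dots> = tens_insert (Suc i) (c (src Xs i)) (string_act H D h Xs fs)"
      using i str(2) by (simp add: gs_def string_act_src del: upt_Suc)
    also have "\<dots> = (\<Sum>hs\<leftarrow>hlists H p h. tens_list (insert_mor c i Xs (act_list D hs Xs fs)))"
      by (simp add: string_act_hlists[OF hopf category s] clinear_sum_list[OF clinear_tens_insert]
          tens_insert_tens_list insert_mor_def)
    finally show ?thesis by simp
  qed
  then show ?thesis by (auto simp: string_map_def slot_map_insert[OF i])
qed

text \<open>Rotation moves slot \<open>j\<close> to \<open>j + 1\<close> with the factor
  \<open>(-1)^(p+1)\<close> of \<open>\<phi>\<close>, which the alternating sign turns into
  \<open>(-1)^p\<close>. The last slot reaches slot \<open>0\<close> after two rotations of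
  \<open>\<phi>\<close>, whose factors cancel.\<close>

lemma insertion_cyclic:
  assumes \<phi>: "\<phi> \<in> cyclic_cochains H D M (Suc p)"
  shows "insertion D c p \<phi> \<in> cyclic_cochains H D M p"
proof (rule cyclic_cochainI)
  have coch: "\<phi> \<in> cochains H D M (Suc p)" using \<phi> by (simp add: cyclic_cochains_def)
  note fn = cochain_functional[OF coch]
  show "insertion D c p \<phi> \<in> cochains H D M p"
    unfolding insertion_def
    by (intro cochains_sum pull_cochain[OF hopf category string_map_insert coch]) simp
  note pull = pull_in[OF category slot_map_insert fn] pull_gen[OF category slot_map_insert fn]
  fix m Xs fs assume s: "(Xs, fs) \<in> cyc_strings D p"
  note str = cyc_stringsD[OF s]
  define Q where "Q i = \<phi> (word m (insert_obs i Xs) (insert_mor c i Xs fs))" for i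
  have rotQ: "cyc_op H D M (Suc p) \<phi> (word m (insert_obs i Xs) (insert_mor c i Xs fs))
      = (-1) ^ Suc p * Q i" for i
    by (simp only: cyclic_cochain_cyc_op[OF \<phi>] Q_def)
  have rot: "(rot_obs Xs, rot_mor D a Xs fs) \<in> cyc_strings D p" for a
    by (rule slot_map_in[OF slot_map_rot s])
  have cyc: "cyc_op H D M p (pull D p (insert_obs i) (insert_mor c i) \<phi>) (word m Xs fs)
      = tensor_lift (\<lambda>a m0. \<phi> (word m0 (insert_obs i (rot_obs Xs))
        (insert_mor c i (rot_obs Xs) (rot_mor D (inv (antipode H) a) Xs fs)))) (coact M m)"
    if "i \<le> p" for i
    using that by (simp add: cyc_op_gen s pull rot)
  have Suc: "cyc_op H D M p (pull D p (insert_obs (Suc j)) (insert_mor c (Suc j)) \<phi>) (word m Xs fs)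
      = (-1) ^ Suc p * Q j" if "j < p" for j
    using that insert_in[OF s, of j]
    by (simp only: cyc Suc_leI insert_rot[OF str(1,2) that] cyc_op_gen[OF fn, symmetric] less_imp_le rotQ)
  have X0: "Xs ! 0 \<in> Ob D" using str by simp
  \<comment> \<open>The string with the new entry in front is the rotation of the insertion at
    \<open>p\<close> with acting element \<open>1\<close>.\<close>
  have ext: "(Xs ! 0 # Xs, c (Xs ! 0) # fs) \<in> cyc_strings D (Suc p)"
    using slot_map_in[OF slot_map_rot insert_in[OF s le_refl], of 1]
    by (simp add: insert_0_rot[OF str(1,2)] Act_one X0 c_hom)
  have "cyc_op H D M (Suc p) \<phi> (word m (insert_obs p Xs) (insert_mor c p Xs fs))
      = tensor_lift (\<lambda>a m0. \<phi> (word m0 (Xs ! 0 # Xs)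
        ((counit H (inv (antipode H) a) *\<^sub>C c (Xs ! 0)) # fs))) (coact M m)"
    by (simp add: cyc_op_gen[OF fn insert_in[OF s le_refl]] insert_0_rot[OF str(1,2)] c_act X0)
  also have "\<dots> = tensor_lift (\<lambda>a m0. counit H (inv (antipode H) a) *
      \<phi> (word m0 (Xs ! 0 # Xs) (c (Xs ! 0) # fs))) (coact M m)"
  proof -
    have "\<phi> (word m0 (Xs ! 0 # Xs) ((e *\<^sub>C c (Xs ! 0)) # fs))
        = e * \<phi> (word m0 (Xs ! 0 # Xs) (c (Xs ! 0) # fs))" for m0 e
      using clinear_onD(2)[OF functional_slot[OF fn ext, of 0 m0], of "c (Xs ! 0)" e] cyc_stringsD(5)[OF ext, of 0]
      by (simp add: scaleC_complex_def)
    then show ?thesis by simp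
  qed
  also have "\<dots> = \<phi> (word m (Xs ! 0 # Xs) (c (Xs ! 0) # fs))"
    by (rule counit_twist[OF functional_gen_left[OF fn ext]])
  finally have front: "\<phi> (word m (Xs ! 0 # Xs) (c (Xs ! 0) # fs)) = (-1) ^ Suc p * Q p"
    by (simp only: rotQ)
  have "cyc_op H D M p (pull D p (insert_obs 0) (insert_mor c 0) \<phi>) (word m Xs fs)
      = cyc_op H D M (Suc p) \<phi> (word m (Xs ! 0 # Xs) (c (Xs ! 0) # fs))"
    by (simp add: cyc insert_0_rot[OF str(1,2)] cyc_op_gen[OF fn ext])
  also have "\<dots> = (-1) ^ Suc p * ((-1) ^ Suc p * Q p)"
    by (simp only: cyclic_cochain_cyc_op[OF \<phi>] front)
  also have "\<dots> = Q p" by (simp add: mult.assoc[symmetric] power_add[symmetric])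
  finally have zero: "cyc_op H D M p (pull D p (insert_obs 0) (insert_mor c 0) \<phi>) (word m Xs fs) = Q p" .
  have "cyc_op H D M p (insertion D c p \<phi>) (word m Xs fs)
      = (\<Sum>i\<le>p. (-1) ^ i * cyc_op H D M p (pull D p (insert_obs i) (insert_mor c i) \<phi>) (word m Xs fs))"
    unfolding insertion_def by (rule cyc_op_sum_gen) (simp_all add: pull s)
  also have "\<dots> = Q p + (\<Sum>j<p. (-1) ^ Suc j * ((-1) ^ Suc p * Q j))"
    by (subst sum.atMost_shift) (simp add: zero Suc del: power_Suc)
  also have "\<dots> = (-1) ^ p * (\<Sum>i\<le>p. (-1) ^ i * Q i)"
  proof -
    have sq: "(-1) ^ p * ((-1) ^ p * x) = x" for x :: complex
      by (simp add: mult.assoc[symmetric] power_add[symmetric])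
    show ?thesis by (simp add: lessThan_Suc_atMost[symmetric] distrib_left sq sum_distrib_left mult_ac)
  qed
  also have "(\<Sum>i\<le>p. (-1) ^ i * Q i) = insertion D c p \<phi> (word m Xs fs)"
    unfolding insertion_def Q_def by (intro sum.cong refl) (simp add: pull s)
  finally show "cyc_op H D M p (insertion D c p \<phi>) (word m Xs fs)
      = (-1) ^ p * insertion D c p \<phi> (word m Xs fs)" .
qed

end

end

context hopf_cyclic
begin

lemma cyclic_cocycle_bdiff:
  "\<phi> \<in> cyclic_cocycles H D M n \<Longrightarrow> bdiff H D M n \<phi> x = 0"
  unfolding cyclic_cocycles_def by (auto dest: fun_cong)

theorem inner_derivation_coboundary:
  fixes c :: "'o \<Rightarrow> 'f"
  assumes c: "invariant_family H D c"
    and \<phi>: "\<phi> \<in> cyclic_cocycles H D M n"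
  shows "\<exists>\<xi>\<in>cyclic_coboundaries H D M n. \<forall>m Xs fs. (Xs, fs) \<in> cyc_strings D n \<longrightarrow>
    \<xi> (word m Xs fs) = (\<Sum>i\<le>n. \<phi> (word m Xs (fs[i :=
      commutator D c (src Xs i) (Xs ! i) (fs ! i)])))"
proof -
  have cyc: "\<phi> \<in> cyclic_cochains H D M n" using \<phi> by (simp add: cyclic_cocycles_def)
  have fn: "\<phi> \<in> functionals D n"
    using cyc cochain_functional[of \<phi> H D M n] by (simp add: cyclic_cochains_def)
  note c_hom = c_hom[OF c] and c_act = c_act[OF c]
  \<comment> \<open>For \<open>n = 0\<close> the truncated \<open>n - 1\<close> is harmless, because
    \<open>P\<close> is then summed over the empty range \<open>i < n\<close>.\<close>
  define P where "P m Xs fs i k = coface H D M n k (pull D (n - 1) (insert_obs i) (insert_mor c i) \<phi>) (word m Xs fs)"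
    for m Xs fs i k
  have key: "(\<Sum>i\<le>n. \<phi> (word m Xs (fs[i :=
      commutator D c (src Xs i) (Xs ! i) (fs ! i)])))
    = (\<Sum>i<n. (-1) ^ i * (\<Sum>k\<le>n. (-1) ^ k * P m Xs fs i k))"
    if s: "(Xs, fs) \<in> cyc_strings D n" for m Xs fs
  proof -
    note str = cyc_stringsD[OF s]
    define G where "G i k = coface H D M (Suc n) k \<phi> (word m (insert_obs i Xs) (insert_mor c i Xs fs))" for i k
    define A where "A i = \<phi> (word m Xs (fs[i := Comp D (src Xs i) (src Xs i) (Xs ! i) (fs ! i) (c (src Xs i))]))" for i
    define B where "B i = \<phi> (word m Xs (fs[i := Comp D (src Xs i) (Xs ! i) (Xs ! i) (c (Xs ! i)) (fs ! i)]))" for i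
    note ins = insert_in[OF c s]
    note merge = coface_merge_gen[OF fn _ ins] and wrap = coface_wrap_gen[OF fn ins]
    note slots = slot_map_insert[OF c]
    have Gii: "G i i = A i" if "i \<le> n" for i
      using that by (simp add: G_def A_def merge insert_merge_same[OF str(1,2) that])
    have GiSuc: "G i (Suc i) = B (Suc i)" if "i < n" for i
      using that by (simp add: G_def B_def merge insert_merge_Suc[OF str(1,2) that])
    have ob: "Xs ! 0 \<in> Ob D" "src Xs 0 \<in> Ob D" and f0: "fs ! 0 \<in> Hom D (src Xs 0) (Xs ! 0)"
      using str by auto
    \<comment> \<open>In the wrapping face the coaction acts on the inserted entry alone. Since that
      entry is invariant, only the counit is left and \<open>counit_twist\<close> applies.\<close>
    have GnSuc: "G n (Suc n) = B 0"
    proof -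
      let ?f = "Comp D (src Xs 0) (Xs ! 0) (Xs ! 0) (c (Xs ! 0)) (fs ! 0)"
      have f: "?f \<in> Hom D (src Xs 0) (Xs ! 0)" using ob f0 c_hom by (intro Comp_in_Hom) auto
      have scale: "\<phi> (word m0 Xs (fs[0 := Comp D (src Xs 0) (Xs ! 0) (Xs ! 0) (e *\<^sub>C c (Xs ! 0)) (fs ! 0)]))
          = e * \<phi> (word m0 Xs (fs[0 := ?f]))" for e m0
        using clinear_onD(2)[OF functional_slot[OF fn s, of 0 m0] f, of e]
          clinear_onD(2)[OF Comp_linear_left[OF ob(2,1,1) f0] c_hom[OF ob(1)], of e]
        by (simp add: scaleC_complex_def)
      have "G n (Suc n) = tensor_lift (\<lambda>a m0. counit H (inv (antipode H) a) * \<phi> (word m0 Xs (fs[0 := ?f]))) (coact M m)"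
        by (simp add: G_def wrap insert_wrap_end[OF str(1,2)] c_act ob scale)
      also have "\<dots> = B 0"
        unfolding B_def using cyc_strings_update[OF s f]
        by (intro counit_twist functional_gen_left[OF fn])
      finally show ?thesis .
    qed
    have less: "G i k = P m Xs fs (i - 1) k" if ki: "k < i" "i \<le> n" for i k
    proof -
      obtain i' p where ip: "i = Suc i'" "n = Suc p" using ki by (cases i; cases n) auto
      have str': "(Xs, fs) \<in> cyc_strings D (Suc p)" and fn': "\<phi> \<in> functionals D (Suc p)"
        using s fn ip by simp_all
      have le: "k \<le> i'" "i' \<le> p" "k \<le> p" using ki ip by auto
      have l: "length Xs = Suc (Suc p)" "length fs = Suc (Suc p)" using str ip by auto
      note sl = slots[OF le(2)]
      have "P m Xs fs i' k = pull D p (insert_obs i') (insert_mor c i') \<phi>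
          (word m (merge_obs k Xs) (merge_mor D k Xs fs))"
        using ip by (simp add: P_def coface_merge_gen[OF pull_in[OF category sl fn'] le(3) str'])
      also have "\<dots> = \<phi> (word m (insert_obs i' (merge_obs k Xs)) (insert_mor c i' (merge_obs k Xs) (merge_mor D k Xs fs)))"
        by (rule pull_gen[OF category sl fn' slot_map_in[OF slot_map_merge[OF le(3)] str']])
      also have "\<dots> = G i k"
        using ki by (simp add: G_def merge ip(1) insert_merge_less[OF l le(1,2)])
      finally show ?thesis using ip by simp
    qed
    have greater: "G i (Suc k) = P m Xs fs i k" if ik: "i < k" "k \<le> n" for i k
    proof -
      obtain p where p: "n = Suc p" using ik by (cases n) auto
      have str': "(Xs, fs) \<in> cyc_strings D (Suc p)" and fn': "\<phi> \<in> functionals D (Suc p)"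
        using s fn p by simp_all
      have l: "length Xs = Suc (Suc p)" "length fs = Suc (Suc p)" using str p by auto
      have i: "i \<le> p" "i \<le> n" using ik p by auto
      note sl = slots[OF i(1)]
      note pul = pull_in[OF category sl fn'] pull_gen[OF category sl fn']
      show ?thesis
      proof (cases "k = n")
        case True
        have "P m Xs fs i k = tensor_lift (\<lambda>a m0. pull D p (insert_obs i) (insert_mor c i) \<phi>
            (word m0 (wrap_obs Xs) (wrap_mor D (inv (antipode H) a) Xs fs))) (coact M m)"
          using p True by (simp add: P_def coface_wrap_gen[OF pul(1) str'])
        also have "\<dots> = G i (Suc k)"
          using True i by (simp add: pul(2)[OF slot_map_in[OF slot_map_wrap str']] G_def wrap
              insert_wrap[OF l i(1)])
        finally show ?thesis by simp
      next
        case False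
        then have k: "k \<le> p" using ik p by simp
        have "P m Xs fs i k = pull D p (insert_obs i) (insert_mor c i) \<phi>
            (word m (merge_obs k Xs) (merge_mor D k Xs fs))"
          using p by (simp add: P_def coface_merge_gen[OF pul(1) k str'])
        also have "\<dots> = G i (Suc k)"
          using False ik i by (simp add: pul(2)[OF slot_map_in[OF slot_map_merge[OF k] str']] G_def merge
              insert_merge_greater[OF l ik(1) k])
        finally show ?thesis by simp
      qed
    qed
    \<comment> \<open>The cocycle condition in degree \<open>n + 1\<close> is evaluated on every
      insertion into the given string.\<close>
    have "(\<Sum>i\<le>n. (-1) ^ i * (\<Sum>k\<le>Suc n. (-1) ^ k * G i k)) = 0"
      using cyclic_cocycle_bdiff[OF \<phi>] by (simp add: G_def bdiff_def del: sum.atMost_Suc)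
    then have "(\<Sum>i<n. (-1) ^ i * (\<Sum>k\<le>n. (-1) ^ k * P m Xs fs i k)) = (\<Sum>i\<le>n. G i i - G i (Suc i))"
      using sum_alternating_faces[of n G "P m Xs fs", OF less greater] by simp
    also have "\<dots> = (\<Sum>i\<le>n. A i) - (\<Sum>i\<le>n. G i (Suc i))"
      by (simp add: sum_subtractf Gii)
    also have "(\<Sum>i\<le>n. G i (Suc i)) = (\<Sum>i<n. B (Suc i)) + B 0"
      by (simp add: lessThan_Suc_atMost[symmetric] GnSuc GiSuc)
    also have "\<dots> = (\<Sum>i\<le>n. B i)"
      by (subst sum.atMost_shift) simp
    also have "(\<Sum>i\<le>n. A i) - (\<Sum>i\<le>n. B i) = (\<Sum>i\<le>n. \<phi> (word m Xs (fs[i :=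
      commutator D c (src Xs i) (Xs ! i) (fs ! i)])))"
      unfolding sum_subtractf[symmetric]
    proof (rule sum.cong[OF refl])
      fix i assume "i \<in> {..n}"
      then have i: "i \<le> n" by simp
      have hom: "Comp D (src Xs i) (src Xs i) (Xs ! i) (fs ! i) (c (src Xs i)) \<in> Hom D (src Xs i) (Xs ! i)"
        "Comp D (src Xs i) (Xs ! i) (Xs ! i) (c (Xs ! i)) (fs ! i) \<in> Hom D (src Xs i) (Xs ! i)"
        using str i c_hom by (auto intro!: Comp_in_Hom)
      show "A i - B i = \<phi> (word m Xs (fs[i :=
        commutator D c (src Xs i) (Xs ! i) (fs ! i)]))"
        unfolding A_def B_def commutator_def
        using str i by (intro clinear_on_diff[OF functional_slot[OF fn s i] _ hom, symmetric] Hom_subspace)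
    qed
    finally show ?thesis by simp
  qed
  show ?thesis
  proof (cases n)
    \<comment> \<open>In degree 0 the right side of \<open>key\<close> is an empty sum: a cocycle
      vanishes on commutators with \<open>c\<close>, and zero is the only coboundary.\<close>
    case 0
    then show ?thesis using key by (intro bexI[of _ "\<lambda>x. 0"]) auto
  next
    case (Suc p)
    have cyc': "\<phi> \<in> cyclic_cochains H D M (Suc p)" and fn': "\<phi> \<in> functionals D (Suc p)"
      using cyc fn Suc by simp_all
    have mem: "bdiff H D M p (insertion D c p \<phi>) \<in> cyclic_coboundaries H D M n"
      using insertion_cyclic[OF c cyc'] Suc by simp
    have eval: "bdiff H D M p (insertion D c p \<phi>) (word m Xs fs)
        = (\<Sum>i<n. (-1) ^ i * (\<Sum>k\<le>n. (-1) ^ k * P m Xs fs i k))"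
      if s: "(Xs, fs) \<in> cyc_strings D n" for m Xs fs
    proof -
      have "coface H D M n k (insertion D c p \<phi>) (word m Xs fs) = (\<Sum>i\<le>p. (-1) ^ i * P m Xs fs i k)"
        if "k \<le> n" for k
        using s that unfolding insertion_def P_def Suc diff_Suc_1
        by (intro coface_sum_gen) (simp_all add: pull_in[OF category slot_map_insert[OF c] fn'])
      then have "bdiff H D M p (insertion D c p \<phi>) (word m Xs fs)
          = (\<Sum>k\<le>n. (-1) ^ k * (\<Sum>i<n. (-1) ^ i * P m Xs fs i k))"
        using Suc by (simp add: bdiff_def lessThan_Suc_atMost del: sum.atMost_Suc)
      also have "\<dots> = (\<Sum>i<n. (-1) ^ i * (\<Sum>k\<le>n. (-1) ^ k * P m Xs fs i k))"
        by (simp only: sum_distrib_left, subst sum.swap) (simp only: mult.left_commute)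
      finally show ?thesis .
    qed
    show ?thesis using mem eval key by (intro bexI[of _ "bdiff H D M p (insertion D c p \<phi>)"]) simp_all
  qed
qed

end

section \<open>Pulling back along a semifunctor\<close>

definition map_string :: "('o \<Rightarrow> 'o \<Rightarrow> 'f \<Rightarrow> 'g) \<Rightarrow> 'o list \<Rightarrow> 'f list \<Rightarrow> 'g list"
  where "map_string F Xs fs = map (\<lambda>i. F (src Xs i) (Xs ! i) (fs ! i)) [0..<length fs]"

lemma length_map_string [simp]: "length (map_string F Xs fs) = length fs"
  by (simp add: map_string_def)

lemma nth_map_string: "i < length fs \<Longrightarrow> map_string F Xs fs ! i = F (src Xs i) (Xs ! i) (fs ! i)"
  by (simp add: map_string_def)

text \<open>Cofaces and the cyclic operator involve composition and the action but no identity
  morphisms, so pulling back along a semifunctor is a map of cyclic complexes.\<close>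

locale hopf_cyclic_semifunctor =
  D: hopf_cyclic H D M + E: hopf_cyclic H E M + H_linear_semifunctor D E "\<lambda>X. X" F
  for H :: "('h::complex_algebra_1) hopf"
    and D :: "('o, 'f::complex_vector, 'h) hcat"
    and E :: "('o, 'g::complex_vector, 'h) hcat"
    and M :: "('m::complex_vector, 'h) sayd"
    and F :: "'o \<Rightarrow> 'o \<Rightarrow> 'f \<Rightarrow> 'g"
begin

lemma map_string_in:
  assumes "(Xs, fs) \<in> cyc_strings D n"
  shows "(Xs, map_string F Xs fs) \<in> cyc_strings E n"
  using cyc_stringsD[OF assms] by (intro cyc_stringsI) (auto simp: nth_map_string F_hom F_ob)

lemma slot_map_semifunctor: "slot_map D n E n (\<lambda>Xs. Xs) (map_string F)"
proof (rule slot_mapI[where k = "\<lambda>Xs fs j. j" and L = "\<lambda>Xs fs j. F (src Xs j) (Xs ! j)"])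
  fix Xs fs assume s: "(Xs, fs) \<in> cyc_strings D n"
  note str = cyc_stringsD[OF s]
  show "(Xs, map_string F Xs fs) \<in> cyc_strings E n" by (rule map_string_in[OF s])
  fix j assume j: "j \<le> n"
  show "j \<le> n \<and> clinear_on (Hom D (src Xs j) (Xs ! j)) (F (src Xs j) (Xs ! j))"
    using j str by (simp add: F_linear)
  fix f assume f: "f \<in> Hom D (src Xs j) (Xs ! j)"
  show "F (src Xs j) (Xs ! j) f \<in> Hom E (src Xs j) (Xs ! j)"
    using f j str by (simp add: F_hom)
  show "map_string F Xs (fs[j := f]) = (map_string F Xs fs)[j := F (src Xs j) (Xs ! j) f]"
    using j str by (intro nth_equalityI) (auto simp: nth_map_string nth_list_update)
qed

lemma string_map_semifunctor: "string_map H D n E n (\<lambda>Xs. Xs) (map_string F)"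
proof -
  have "map_string F Xs (act_list D hs Xs fs) = act_list E hs Xs (map_string F Xs fs)"
    if s: "(Xs, fs) \<in> cyc_strings D n" for Xs fs hs
    using cyc_stringsD[OF s]
    by (intro nth_equalityI) (auto simp: nth_map_string nth_act_list F_act)
  then show ?thesis
    by (auto simp: string_map_def slot_map_semifunctor string_act_hlists[OF E.hopf E.category map_string_in])
qed

lemma map_string_merge:
  assumes s: "(Xs, fs) \<in> cyc_strings D (Suc p)" and k: "k \<le> p"
  shows "map_string F (merge_obs k Xs) (merge_mor D k Xs fs) = merge_mor E k Xs (map_string F Xs fs)"
proof (rule nth_equalityI)
  note str = cyc_stringsD[OF s]
  note obs = merge_obs[OF str(1) k] and mor = merge_mor[OF str(2) k]
  show "length (map_string F (merge_obs k Xs) (merge_mor D k Xs fs))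
      = length (merge_mor E k Xs (map_string F Xs fs))"
    using str k by (simp add: mor merge_mor)
  fix j assume "j < length (map_string F (merge_obs k Xs) (merge_mor D k Xs fs))"
  then have j: "j \<le> p" by (simp add: mor)
  have hom: "fs ! k \<in> Hom D (Xs ! Suc k) (Xs ! k)" "fs ! Suc k \<in> Hom D (src Xs (Suc k)) (Xs ! Suc k)"
    and ob: "Xs ! k \<in> Ob D" "Xs ! Suc k \<in> Ob D" "src Xs (Suc k) \<in> Ob D"
    using str(1) str(3)[of k] str(3)[of "Suc k"] str(4)[of "Suc k"] str(5)[of k] str(5)[of "Suc k"] k
    by (simp_all add: src_less)
  show "map_string F (merge_obs k Xs) (merge_mor D k Xs fs) ! j = merge_mor E k Xs (map_string F Xs fs) ! j"
    using str(1,2) j k hom ob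
    by (cases j k rule: linorder_cases)
      (auto simp: nth_map_string mor obs merge_mor F_comp src_less)
qed

lemma map_string_wrap:
  assumes s: "(Xs, fs) \<in> cyc_strings D (Suc p)"
  shows "map_string F (wrap_obs Xs) (wrap_mor D a Xs fs) = wrap_mor E a Xs (map_string F Xs fs)"
proof (rule nth_equalityI)
  note str = cyc_stringsD[OF s]
  note obs = wrap_obs[OF str(1)] and mor = wrap_mor[OF str(1,2)]
  show "length (map_string F (wrap_obs Xs) (wrap_mor D a Xs fs)) = length (wrap_mor E a Xs (map_string F Xs fs))"
    using str by (simp add: mor wrap_mor)
  fix j assume "j < length (map_string F (wrap_obs Xs) (wrap_mor D a Xs fs))"
  then have j: "j \<le> p" by (simp add: mor)
  have sr: "src Xs (Suc p) = Xs ! 0" using str by (simp add: src_end)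
  have hom: "fs ! 0 \<in> Hom D (src Xs 0) (Xs ! 0)" "fs ! Suc p \<in> Hom D (Xs ! 0) (Xs ! Suc p)"
    and ob: "Xs ! 0 \<in> Ob D" "Xs ! Suc p \<in> Ob D" "src Xs 0 \<in> Ob D"
    using str(5)[of 0] str(5)[of "Suc p"] str(3,4) by (simp_all add: sr)
  show "map_string F (wrap_obs Xs) (wrap_mor D a Xs fs) ! j = wrap_mor E a Xs (map_string F Xs fs) ! j"
    using str(1,2) j hom ob
    by (cases "j = 0") (auto simp: nth_map_string mor obs wrap_mor sr F_comp F_act D.Act_in_Hom)
qed

lemma map_string_rot:
  assumes s: "(Xs, fs) \<in> cyc_strings D n"
  shows "map_string F (rot_obs Xs) (rot_mor D a Xs fs) = rot_mor E a Xs (map_string F Xs fs)"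
proof (rule nth_equalityI)
  note str = cyc_stringsD[OF s]
  note obs = rot_obs[OF str(1)] and mor = rot_mor[OF str(1,2)]
  show "length (map_string F (rot_obs Xs) (rot_mor D a Xs fs)) = length (rot_mor E a Xs (map_string F Xs fs))"
    using str by (simp add: mor rot_mor)
  fix j assume "j < length (map_string F (rot_obs Xs) (rot_mor D a Xs fs))"
  then have j: "j \<le> n" by (simp add: mor)
  have sr: "src Xs n = Xs ! 0" "0 < j \<Longrightarrow> src Xs (j - 1) = Xs ! j" using str j by (auto simp: src_eq)
  have act: "F (src Xs n) (Xs ! n) (Act D (src Xs n) (Xs ! n) a (fs ! n))
      = Act E (src Xs n) (Xs ! n) a (F (src Xs n) (Xs ! n) (fs ! n))"
    using str by (intro F_act) auto
  show "map_string F (rot_obs Xs) (rot_mor D a Xs fs) ! j = rot_mor E a Xs (map_string F Xs fs) ! j"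
    using str(1,2) j act sr
    by (cases "j = 0") (auto simp: nth_map_string mor obs rot_mor)
qed

definition pullback :: "nat \<Rightarrow> (('m, 'o, 'g) chain \<Rightarrow> complex) \<Rightarrow> ('m, 'o, 'f) chain \<Rightarrow> complex"
  where "pullback n \<phi> = pull D n (\<lambda>Xs. Xs) (map_string F) \<phi>"

lemma pullback_in: "\<phi> \<in> functionals E n \<Longrightarrow> pullback n \<phi> \<in> functionals D n"
  unfolding pullback_def by (rule pull_in[OF D.category slot_map_semifunctor])

lemma pullback_gen: "\<phi> \<in> functionals E n \<Longrightarrow> (Xs, fs) \<in> cyc_strings D n \<Longrightarrow>
    pullback n \<phi> (word m Xs fs) = \<phi> (word m Xs (map_string F Xs fs))"
  unfolding pullback_def by (rule pull_gen[OF D.category slot_map_semifunctor])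

lemma pullback_coface_gen:
  assumes \<phi>: "\<phi> \<in> functionals E p" and k: "k \<le> Suc p" and s: "(Xs, fs) \<in> cyc_strings D (Suc p)"
  shows "coface H D M (Suc p) k (pullback p \<phi>) (word m Xs fs)
    = coface H E M (Suc p) k \<phi> (word m Xs (map_string F Xs fs))"
proof (cases "k = Suc p")
  case True
  then show ?thesis
    by (simp add: D.coface_wrap_gen[OF pullback_in[OF \<phi>] s] E.coface_wrap_gen[OF \<phi> map_string_in[OF s]]
      pullback_gen[OF \<phi> slot_map_in[OF D.slot_map_wrap s]] map_string_wrap[OF s])
next
  case False
  then have "k \<le> p" using k by simp
  then show ?thesis
    by (simp add: D.coface_merge_gen[OF pullback_in[OF \<phi>] _ s] E.coface_merge_gen[OF \<phi> _ map_string_in[OF s]]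
      pullback_gen[OF \<phi> slot_map_in[OF D.slot_map_merge s]] map_string_merge[OF s])
qed

lemma pullback_bdiff:
  assumes \<phi>: "\<phi> \<in> functionals E p"
  shows "pullback (Suc p) (bdiff H E M p \<phi>) = bdiff H D M p (pullback p \<phi>)"
proof (rule functionals_eqI)
  fix m Xs fs assume s: "(Xs, fs) \<in> cyc_strings D (Suc p)"
  show "pullback (Suc p) (bdiff H E M p \<phi>) (word m Xs fs)
      = bdiff H D M p (pullback p \<phi>) (word m Xs fs)"
    unfolding pullback_gen[OF E.bdiff_in[OF \<phi>] s]
    by (simp add: bdiff_def pullback_coface_gen[OF \<phi> _ s] del: sum.atMost_Suc)
qed (intro pullback_in E.bdiff_in D.bdiff_in \<phi>)+

lemma pullback_cyclic:
  assumes \<phi>: "\<phi> \<in> cyclic_cochains H E M n"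
  shows "pullback n \<phi> \<in> cyclic_cochains H D M n"
proof (rule D.cyclic_cochainI)
  have coch: "\<phi> \<in> cochains H E M n" using \<phi> by (simp add: cyclic_cochains_def)
  note fn = cochain_functional[OF coch]
  show "pullback n \<phi> \<in> cochains H D M n"
    unfolding pullback_def by (rule pull_cochain[OF D.hopf D.category string_map_semifunctor coch])
  fix m Xs fs assume s: "(Xs, fs) \<in> cyc_strings D n"
  have "cyc_op H D M n (pullback n \<phi>) (word m Xs fs)
      = cyc_op H E M n \<phi> (word m Xs (map_string F Xs fs))"
    by (simp add: D.cyc_op_gen[OF pullback_in[OF fn] s] E.cyc_op_gen[OF fn map_string_in[OF s]]
      pullback_gen[OF fn slot_map_in[OF D.slot_map_rot s]] map_string_rot[OF s])
  then show "cyc_op H D M n (pullback n \<phi>) (word m Xs fs)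
      = (-1) ^ n * pullback n \<phi> (word m Xs fs)"
    by (simp add: E.cyclic_cochain_cyc_op[OF \<phi>] pullback_gen[OF fn s])
qed

lemma pullback_coboundary:
  assumes "\<phi> \<in> cyclic_coboundaries H E M n"
  shows "pullback n \<phi> \<in> cyclic_coboundaries H D M n"
proof (cases n)
  case 0
  have "pullback 0 (\<lambda>x. 0) = (\<lambda>x. 0)"
    by (rule functionals_eqI[OF pullback_in functionals_zero])
      (simp_all add: functionals_zero pullback_gen)
  then show ?thesis using assms 0 by simp
next
  case (Suc p)
  then obtain \<psi> where \<psi>: "\<psi> \<in> cyclic_cochains H E M p" "\<phi> = bdiff H E M p \<psi>"
    using assms by auto
  have "\<psi> \<in> functionals E p"
    using \<psi>(1) cochain_functional[of \<psi> H E M p] by (simp add: cyclic_cochains_def)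
  from pullback_bdiff[OF this] show ?thesis using pullback_cyclic[OF \<psi>(1)] Suc \<psi>(2) by simp
qed

end

section \<open>Matrices over a category and the trace\<close>

text \<open>The index type is left open: size 2 serves to analyse \<open>\<eta>\<close>, size 3
  carries the path. Entries lie in the Hom spaces themselves, which makes entrywise calculations
  direct.\<close>

definition mat_cat :: "('o, 'f::complex_vector, 'h) hcat \<Rightarrow> ('o, 'f ^ 'i ^ 'i::finite, 'h) hcat"
  where "mat_cat D =
    \<lparr> Ob = Ob D,
      Hom = (\<lambda>X Y. {A. \<forall>i j. A $ i $ j \<in> Hom D X Y}),
      Comp = (\<lambda>X Y Z A B. \<chi> i j. \<Sum>l\<in>UNIV. Comp D X Y Z (A $ i $ l) (B $ l $ j)),
      Id = (\<lambda>X. \<chi> i j. if i = j then Id D X else 0),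
      Act = (\<lambda>X Y h A. \<chi> i j. Act D X Y h (A $ i $ j)) \<rparr>"

lemma mat_cat_simps [simp]:
  "Ob (mat_cat D) = Ob D"
  "A \<in> Hom (mat_cat D) X Y \<longleftrightarrow> (\<forall>i j. A $ i $ j \<in> Hom D X Y)"
  "Comp (mat_cat D) X Y Z A B $ i $ j = (\<Sum>l\<in>UNIV. Comp D X Y Z (A $ i $ l) (B $ l $ j))"
  "Id (mat_cat D) X $ i $ j = (if i = j then Id D X else 0)"
  "Act (mat_cat D) X Y h A $ i $ j = Act D X Y h (A $ i $ j)"
  by (simp_all add: mat_cat_def)

lemma scaleC_vec_nth [simp]: "(c *\<^sub>C x) $ i = c *\<^sub>C (x $ i)"
  by (simp add: scaleC_vec_def)

lemma tensor_lift_add_sum: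
  "tensor_lift (\<lambda>a b. \<Sum>l\<in>I. B l a b) t = (\<Sum>l\<in>I. tensor_lift (B l) t)"
  unfolding tensor_lift_def free_lift_def
  by (subst sum.swap) (simp add: case_prod_unfold cv.scale_sum_right)

context left_H_category
begin

lemma Comp_sum_left:
  assumes "X \<in> Ob D" "Y \<in> Ob D" "Z \<in> Ob D" "f \<in> Hom D X Y" "\<And>l. l \<in> I \<Longrightarrow> g l \<in> Hom D Y Z"
  shows "Comp D X Y Z (\<Sum>l\<in>I. g l) f = (\<Sum>l\<in>I. Comp D X Y Z (g l) f)"
  using assms by (intro clinear_on_sum[OF Comp_linear_left]) (auto intro: Hom_subspace)

lemma Comp_sum_right:
  assumes "X \<in> Ob D" "Y \<in> Ob D" "Z \<in> Ob D" "g \<in> Hom D Y Z" "\<And>l. l \<in> I \<Longrightarrow> f l \<in> Hom D X Y"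
  shows "Comp D X Y Z g (\<Sum>l\<in>I. f l) = (\<Sum>l\<in>I. Comp D X Y Z g (f l))"
  using assms by (intro clinear_on_sum[OF Comp_linear_right]) (auto intro: Hom_subspace)

lemma Act_sum:
  assumes "X \<in> Ob D" "Y \<in> Ob D" "\<And>l. l \<in> I \<Longrightarrow> f l \<in> Hom D X Y"
  shows "Act D X Y h (\<Sum>l\<in>I. f l) = (\<Sum>l\<in>I. Act D X Y h (f l))"
  using assms by (intro clinear_on_sum[OF Act_linear_right]) (auto intro: Hom_subspace)

lemma sum_in_Hom:
  "X \<in> Ob D \<Longrightarrow> Y \<in> Ob D \<Longrightarrow> (\<And>l. l \<in> I \<Longrightarrow> f l \<in> Hom D X Y) \<Longrightarrow> (\<Sum>l\<in>I. f l) \<in> Hom D X Y"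
  by (intro cv.subspace_sum Hom_subspace)

lemma zero_in_Hom: "X \<in> Ob D \<Longrightarrow> Y \<in> Ob D \<Longrightarrow> 0 \<in> Hom D X Y"
  using Hom_subspace cv.subspace_0 by blast

lemma Comp_zero_left:
    "X \<in> Ob D \<Longrightarrow> Y \<in> Ob D \<Longrightarrow> Z \<in> Ob D \<Longrightarrow> f \<in> Hom D X Y \<Longrightarrow> Comp D X Y Z 0 f = 0"
  and Comp_zero_right:
    "X \<in> Ob D \<Longrightarrow> Y \<in> Ob D \<Longrightarrow> Z \<in> Ob D \<Longrightarrow> g \<in> Hom D Y Z \<Longrightarrow> Comp D X Y Z g 0 = 0"
  and Act_zero: "X \<in> Ob D \<Longrightarrow> Y \<in> Ob D \<Longrightarrow> Act D X Y h 0 = 0"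
  using Comp_sum_left[of X Y Z f "{}"] Comp_sum_right[of X Y Z g "{}"] Act_sum[of X Y "{}"] by auto

lemma left_H_category_mat_cat: "left_H_category H (mat_cat D :: ('o, 'f ^ 'i ^ 'i::finite, 'h) hcat)"
proof (rule left_H_category.intro)
  let ?E = "mat_cat D :: ('o, 'f ^ 'i ^ 'i, 'h) hcat"
  fix W X Y Z and f g k :: "'f ^ 'i ^ 'i" and h h'
  show "X \<in> Ob ?E \<Longrightarrow> Y \<in> Ob ?E \<Longrightarrow> cv.subspace (Hom ?E X Y)"
    using Hom_subspace[of X Y] by (auto simp: cv.subspace_def)
  show "\<lbrakk>X \<in> Ob ?E; Y \<in> Ob ?E; Z \<in> Ob ?E; f \<in> Hom ?E X Y; g \<in> Hom ?E Y Z\<rbrakk>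
      \<Longrightarrow> Comp ?E X Y Z g f \<in> Hom ?E X Z"
    by (auto intro!: sum_in_Hom Comp_in_Hom)
  show "\<lbrakk>X \<in> Ob ?E; Y \<in> Ob ?E; Z \<in> Ob ?E; f \<in> Hom ?E X Y\<rbrakk>
      \<Longrightarrow> clinear_on (Hom ?E Y Z) (\<lambda>g. Comp ?E X Y Z g f)"
    unfolding clinear_on_def
    by (auto simp: vec_eq_iff clinear_onD[OF Comp_linear_left] sum.distrib cv.scale_sum_right)
  show "\<lbrakk>X \<in> Ob ?E; Y \<in> Ob ?E; Z \<in> Ob ?E; g \<in> Hom ?E Y Z\<rbrakk>
      \<Longrightarrow> clinear_on (Hom ?E X Y) (\<lambda>f. Comp ?E X Y Z g f)"
    unfolding clinear_on_def
    by (auto simp: vec_eq_iff clinear_onD[OF Comp_linear_right] sum.distrib cv.scale_sum_right)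
  show "Comp ?E W X Z (Comp ?E X Y Z k g) f = Comp ?E W Y Z k (Comp ?E W X Y g f)"
    if "W \<in> Ob ?E" "X \<in> Ob ?E" "Y \<in> Ob ?E" "Z \<in> Ob ?E"
      "f \<in> Hom ?E W X" "g \<in> Hom ?E X Y" "k \<in> Hom ?E Y Z"
  proof -
    have left: "(\<Sum>l\<in>UNIV. Comp D W X Z (\<Sum>n\<in>UNIV. Comp D X Y Z (k $ i $ n) (g $ n $ l)) (f $ l $ j))
        = (\<Sum>l\<in>UNIV. \<Sum>n\<in>UNIV. Comp D W Y Z (k $ i $ n) (Comp D W X Y (g $ n $ l) (f $ l $ j)))" for i j
      using that by (simp add: Comp_sum_left Comp_in_Hom Comp_assoc)
    have right: "(\<Sum>n\<in>UNIV. Comp D W Y Z (k $ i $ n) (\<Sum>l\<in>UNIV. Comp D W X Y (g $ n $ l) (f $ l $ j)))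
        = (\<Sum>n\<in>UNIV. \<Sum>l\<in>UNIV. Comp D W Y Z (k $ i $ n) (Comp D W X Y (g $ n $ l) (f $ l $ j)))" for i j
      using that by (simp add: Comp_sum_right Comp_in_Hom)
    show ?thesis
      unfolding vec_eq_iff mat_cat_simps left right by (intro allI sum.swap)
  qed
  show "X \<in> Ob ?E \<Longrightarrow> Id ?E X \<in> Hom ?E X X"
    by (simp add: Id_in_Hom zero_in_Hom)
  show "\<lbrakk>X \<in> Ob ?E; Y \<in> Ob ?E; f \<in> Hom ?E X Y\<rbrakk> \<Longrightarrow> Comp ?E X Y Y (Id ?E Y) f = f"
    by (simp add: vec_eq_iff if_distrib if_distribR Id_left Comp_zero_left cong: if_cong)
  show "\<lbrakk>X \<in> Ob ?E; Y \<in> Ob ?E; f \<in> Hom ?E X Y\<rbrakk> \<Longrightarrow> Comp ?E X X Y f (Id ?E X) = f"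
    by (simp add: vec_eq_iff if_distrib if_distribR Id_right Comp_zero_right cong: if_cong)
  show "\<lbrakk>X \<in> Ob ?E; Y \<in> Ob ?E; f \<in> Hom ?E X Y\<rbrakk> \<Longrightarrow> Act ?E X Y h f \<in> Hom ?E X Y"
    by (simp add: Act_in_Hom)
  show "\<lbrakk>X \<in> Ob ?E; Y \<in> Ob ?E; f \<in> Hom ?E X Y\<rbrakk> \<Longrightarrow> clinear (\<lambda>h. Act ?E X Y h f)"
    by (simp add: clinear_iff vec_eq_iff clinear_add[OF Act_linear_left] clinear_scale[OF Act_linear_left])
  show "\<lbrakk>X \<in> Ob ?E; Y \<in> Ob ?E\<rbrakk> \<Longrightarrow> clinear_on (Hom ?E X Y) (Act ?E X Y h)"
    unfolding clinear_on_def by (simp add: vec_eq_iff clinear_onD[OF Act_linear_right])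
  show "\<lbrakk>X \<in> Ob ?E; Y \<in> Ob ?E; f \<in> Hom ?E X Y\<rbrakk> \<Longrightarrow> Act ?E X Y 1 f = f"
    by (simp add: vec_eq_iff Act_one)
  show "\<lbrakk>X \<in> Ob ?E; Y \<in> Ob ?E; f \<in> Hom ?E X Y\<rbrakk>
      \<Longrightarrow> Act ?E X Y (h * h') f = Act ?E X Y h (Act ?E X Y h' f)"
    by (simp add: vec_eq_iff Act_mult)
  show "X \<in> Ob ?E \<Longrightarrow> Act ?E X X h (Id ?E X) = counit H h *\<^sub>C Id ?E X"
    by (simp add: vec_eq_iff Act_Id Act_zero)
  show "Act ?E X Z h (Comp ?E X Y Z g f)
      = tensor_lift (\<lambda>h1 h2. Comp ?E X Y Z (Act ?E Y Z h1 g) (Act ?E X Y h2 f)) (comult H h)"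
    if "X \<in> Ob ?E" "Y \<in> Ob ?E" "Z \<in> Ob ?E" "f \<in> Hom ?E X Y" "g \<in> Hom ?E Y Z"
  proof -
    have lin: "clinear (\<lambda>A :: 'f ^ 'i ^ 'i. A $ i $ j)" for i j by (simp add: clinear_iff)
    show ?thesis using that
      by (simp add: vec_eq_iff clinear_tensor_lift_out[OF lin] tensor_lift_add_sum Act_sum Comp_in_Hom Act_Comp)
  qed
qed

end

section \<open>Cyclic words of matrix entries and the generalized trace\<close>

definition entries :: "'i list \<Rightarrow> ('f ^ 'i ^ 'i::finite) list \<Rightarrow> 'f list"
  where "entries is As = map (\<lambda>k. As ! k $ (is ! k) $ (src is k)) [0..<length As]"

lemma length_entries [simp]: "length (entries is As) = length As"
  by (simp add: entries_def)

lemma nth_entries: "k < length As \<Longrightarrow> entries is As ! k = As ! k $ (is ! k) $ (src is k)"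
  by (simp add: entries_def)

abbreviation index_lists :: "nat \<Rightarrow> 'i::finite list set"
  where "index_lists n \<equiv> {is. length is = Suc n}"

lemma finite_index_lists: "finite (index_lists n :: 'i::finite list set)"
  using finite_lists_length_eq[of "UNIV :: 'i set" "Suc n"] by simp

lemma sum_index_lists_rot:
  fixes g :: "'i::finite list \<Rightarrow> complex"
  shows "(\<Sum>is\<in>index_lists n. g (rot_obs is)) = (\<Sum>is\<in>index_lists n. g is)"
proof (rule sum.reindex_bij_witness[of _ rotate1 rot_obs])
  fix xs :: "'i list" assume xs: "xs \<in> index_lists n"
  then show "rotate1 (rot_obs xs) = xs" by (cases xs rule: rev_cases) (auto simp: rot_obs_def)
  show "rot_obs xs \<in> index_lists n" using xs by (simp add: rot_obs_def)
  show "rotate1 xs \<in> index_lists n" using xs by simp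
  show "rot_obs (rotate1 xs) = xs" using xs by (cases xs) (auto simp: rot_obs_def)
qed simp

text \<open>A longer index list is a shorter one together with one extra index. The extra index will
  be the summation index of a matrix product.\<close>

lemma sum_index_lists_split:
  fixes g :: "'i::finite list \<Rightarrow> complex"
  assumes "\<And>js l. length js = Suc p \<Longrightarrow> length (ins js l) = Suc (Suc p) \<and> del (ins js l) = js \<and> pick (ins js l) = l"
    and "\<And>is. length is = Suc (Suc p) \<Longrightarrow> length (del is) = Suc p \<and> ins (del is) (pick is) = is"
  shows "(\<Sum>is\<in>index_lists (Suc p). g is) = (\<Sum>js\<in>index_lists p. \<Sum>l\<in>UNIV. g (ins js l))"
proof -
  have "(\<Sum>js\<in>index_lists p. \<Sum>l\<in>UNIV. g (ins js l)) = (\<Sum>(js, l)\<in>index_lists p \<times> UNIV. g (ins js l))"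
    by (rule sum.cartesian_product)
  also have "\<dots> = (\<Sum>is\<in>index_lists (Suc p). g is)"
    using assms
    by (intro sum.reindex_bij_witness[of _ "\<lambda>is. (del is, pick is)" "\<lambda>(js, l). ins js l"]) auto
  finally show ?thesis by simp
qed

lemma entries_rot:
  assumes "length is = Suc n" "length Xs = Suc n" "length As = Suc n"
  shows "entries (rot_obs is) (rot_mor (mat_cat D) a Xs As) = rot_mor D a Xs (entries is As)"
  using assms
  by (intro nth_equalityI)
    (auto simp: rot_mor nth_entries rot_obs src_eq split: if_splits)

lemma merge_entries:
  assumes "length is = Suc (Suc p)" "length Xs = Suc (Suc p)" "length As = Suc (Suc p)" "k \<le> p"
  shows "merge_mor D k Xs (entries is As) = (entries (merge_obs k is) (merge_mor (mat_cat D) k Xs As))[k :=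
    Comp D (src Xs (Suc k)) (Xs ! Suc k) (Xs ! k) (As ! k $ (is ! k) $ (is ! Suc k))
      (As ! Suc k $ (is ! Suc k) $ (src is (Suc k)))]"
  using assms
  by (intro nth_equalityI)
    (auto simp: merge_mor nth_entries merge_obs src_less nth_list_update)

lemma wrap_entries:
  assumes "length is = Suc (Suc p)" "length Xs = Suc (Suc p)" "length As = Suc (Suc p)"
  shows "wrap_mor D a Xs (entries is As) = (entries (wrap_obs is) (wrap_mor (mat_cat D) a Xs As))[0 :=
    Comp D (src Xs 0) (Xs ! 0) (Xs ! Suc p)
      (Act D (src Xs (Suc p)) (Xs ! Suc p) a (As ! Suc p $ (is ! Suc p) $ (is ! 0)))
      (As ! 0 $ (is ! 0) $ (src is 0))]"
  using assms
  by (intro nth_equalityI)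
    (auto simp: wrap_mor nth_entries wrap_obs src_end nth_list_update)

text \<open>The generalized trace, summing \<open>\<phi>\<close> over the words
  \<open>A^0_(i_0 i_1), A^1_(i_1 i_2), ..., A^n_(i_n i_0)\<close>; the cyclic convention of
  \<open>src\<close> closes the word.\<close>

definition trace_functional :: "('o, 'f::complex_vector, 'h) hcat \<Rightarrow> nat \<Rightarrow> (('m::complex_vector, 'o, 'f) chain \<Rightarrow> complex)
    \<Rightarrow> ('m, 'o, 'f ^ 'i ^ 'i::finite) chain \<Rightarrow> complex"
  where "trace_functional D n \<phi> = (\<lambda>x. \<Sum>is\<in>index_lists n. pull (mat_cat D) n (\<lambda>Xs. Xs) (\<lambda>Xs. entries is) \<phi> x)"

context hopf_cyclic
begin

lemma hopf_cyclic_mat_cat: "hopf_cyclic H (mat_cat D :: ('o, 'f ^ 'i ^ 'i::finite, 'h) hcat) M"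
  by (intro hopf_cyclic.intro hopf_cyclic_axioms.intro hopf left_H_category_mat_cat sayd antipode_bij)

context
  fixes E :: "('o, 'f ^ 'i ^ 'i::finite, 'h) hcat"
  assumes E: "E = mat_cat D"
begin

interpretation E: hopf_cyclic H E M
  unfolding E by (rule hopf_cyclic_mat_cat)

lemma entries_in:
  assumes "(Xs, As) \<in> cyc_strings E n"
  shows "(Xs, entries is As) \<in> cyc_strings D n"
  using cyc_stringsD[OF assms] by (intro cyc_stringsI) (auto simp: nth_entries E)

lemma slot_map_entries: "slot_map E n D n (\<lambda>Xs. Xs) (\<lambda>Xs. entries is)"
proof (rule slot_mapI[where k = "\<lambda>Xs fs j. j" and L = "\<lambda>Xs fs j A. A $ (is ! j) $ (src is j)"])
  fix Xs As assume s: "(Xs, As) \<in> cyc_strings E n"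
  note str = cyc_stringsD[OF s]
  show "(Xs, entries is As) \<in> cyc_strings D n" by (rule entries_in[OF s])
  fix j assume j: "j \<le> n"
  show "j \<le> n \<and> clinear_on (Hom E (src Xs j) (Xs ! j)) (\<lambda>A. A $ (is ! j) $ (src is j))"
    using j by (simp add: clinear_on_def)
  fix A assume A: "A \<in> Hom E (src Xs j) (Xs ! j)"
  then show "A $ (is ! j) $ (src is j) \<in> Hom D (src Xs j) (Xs ! j)" by (simp add: E)
  show "entries is (As[j := A]) = (entries is As)[j := A $ (is ! j) $ (src is j)]"
    using j str(2) by (intro nth_equalityI) (auto simp: nth_entries nth_list_update)
qed

lemma string_map_entries: "string_map H E n D n (\<lambda>Xs. Xs) (\<lambda>Xs. entries is)"
proof -
  have "entries is (act_list E hs Xs As) = act_list D hs Xs (entries is As)" for hs Xs As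
    by (intro nth_equalityI) (auto simp: nth_entries nth_act_list E)
  then show ?thesis
    by (auto simp: string_map_def slot_map_entries string_act_hlists[OF hopf category entries_in])
qed

lemma trace_in: "\<phi> \<in> functionals D n \<Longrightarrow> trace_functional D n \<phi> \<in> functionals E n"
  unfolding trace_functional_def E[symmetric]
  using functionals_sum[of "index_lists n" "\<lambda>is. pull E n (\<lambda>Xs. Xs) (\<lambda>Xs. entries is) \<phi>" E n "\<lambda>_. 1"]
  by (simp add: pull_in[OF E.category slot_map_entries])

lemma trace_gen: "\<phi> \<in> functionals D n \<Longrightarrow> (Xs, As) \<in> cyc_strings E n \<Longrightarrow>
    trace_functional D n \<phi> (word m Xs As) = (\<Sum>is\<in>index_lists n. \<phi> (word m Xs (entries is As)))"
  unfolding trace_functional_def E[symmetric]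
  by (simp add: pull_gen[OF E.category slot_map_entries])

lemma trace_cochain: "\<phi> \<in> cochains H D M n \<Longrightarrow> trace_functional D n \<phi> \<in> cochains H E M n"
  unfolding trace_functional_def E[symmetric]
  using cochains_sum[of "index_lists n" "\<lambda>is. pull E n (\<lambda>Xs. Xs) (\<lambda>Xs. entries is) \<phi>" H E M n "\<lambda>_. 1"]
  by (simp add: pull_cochain[OF hopf E.category string_map_entries])

lemma trace_cyclic:
  assumes \<phi>: "\<phi> \<in> cyclic_cochains H D M n"
  shows "trace_functional D n \<phi> \<in> cyclic_cochains H E M n"
proof (rule E.cyclic_cochainI)
  have coch: "\<phi> \<in> cochains H D M n" using \<phi> by (simp add: cyclic_cochains_def)
  note fn = cochain_functional[OF coch]
  show "trace_functional D n \<phi> \<in> cochains H E M n" by (rule trace_cochain[OF coch])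
  fix m Xs As assume s: "(Xs, As) \<in> cyc_strings E n"
  note str = cyc_stringsD[OF s]
  have rot: "(\<Sum>is\<in>index_lists n. \<phi> (word m0 (rot_obs Xs) (entries is (rot_mor E a Xs As))))
      = (\<Sum>is\<in>index_lists n. \<phi> (word m0 (rot_obs Xs) (rot_mor D a Xs (entries is As))))" for m0 a
    using str(1,2) unfolding E
    by (subst sum_index_lists_rot[symmetric]) (simp add: entries_rot)
  have "cyc_op H E M n (trace_functional D n \<phi>) (word m Xs As)
      = (\<Sum>is\<in>index_lists n. cyc_op H D M n \<phi> (word m Xs (entries is As)))"
    by (simp add: E.cyc_op_gen[OF trace_in[OF fn] s] trace_gen[OF fn slot_map_in[OF E.slot_map_rot s]]
      rot tensor_lift_add_sum cyc_op_gen[OF fn entries_in[OF s]])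
  then show "cyc_op H E M n (trace_functional D n \<phi>) (word m Xs As)
      = (-1) ^ n * trace_functional D n \<phi> (word m Xs As)"
    by (simp add: cyclic_cochain_cyc_op[OF \<phi>] trace_gen[OF fn s] sum_distrib_left)
qed

lemma trace_merge:
  assumes \<phi>: "\<phi> \<in> functionals D p" and k: "k \<le> p" and s: "(Xs, As) \<in> cyc_strings E (Suc p)"
  shows "(\<Sum>js\<in>index_lists p. \<phi> (word m (merge_obs k Xs) (entries js (merge_mor E k Xs As))))
    = (\<Sum>is\<in>index_lists (Suc p). \<phi> (word m (merge_obs k Xs) (merge_mor D k Xs (entries is As))))"
proof -
  note str = cyc_stringsD[OF s]
  let ?ins = "\<lambda>js l. take (Suc k) js @ l # drop (Suc k) js"
  have ins: "length (?ins js l) = Suc (Suc p) \<and> merge_obs k (?ins js l) = js \<and> ?ins js l ! Suc k = l"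
    if "length js = Suc p" for js and l :: 'i
    using that k by (auto simp: merge_obs_def nth_append)
  have "length (merge_obs k is) = Suc p \<and> ?ins (merge_obs k is) (is ! Suc k) = is"
    if "length is = Suc (Suc p)" for "is" :: "'i list"
    using that k by (auto simp: merge_obs_def Cons_nth_drop_Suc)
  note split = sum_index_lists_split[of p ?ins "merge_obs k" "\<lambda>is. is ! Suc k", OF ins this]
  have "(\<Sum>l\<in>UNIV. \<phi> (word m (merge_obs k Xs) (merge_mor D k Xs (entries (?ins js l) As))))
      = \<phi> (word m (merge_obs k Xs) (entries js (merge_mor E k Xs As)))"
    if js: "length js = Suc p" for js
  proof -
    define B where "B = entries js (merge_mor E k Xs As)"
    define c where "c l = Comp D (src Xs (Suc k)) (Xs ! Suc k) (Xs ! k) (As ! k $ (js ! k) $ l)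
      (As ! Suc k $ l $ (src js k))" for l
    have B: "(merge_obs k Xs, B) \<in> cyc_strings D p"
      unfolding B_def by (rule entries_in[OF slot_map_in[OF E.slot_map_merge[OF k] s]])
    have len: "length (?ins js l) = Suc (Suc p)" for l using ins[OF js] by simp
    have "js ! k = ?ins js l ! k" "src js k = src (?ins js l) (Suc k)" for l
      using merge_obs(2,3)[OF len k, of k l] ins[OF js, of l] k by auto
    then have upd: "merge_mor D k Xs (entries (?ins js l) As) = B[k := c l]" for l
      using merge_entries[OF len str(1,2) k, of D l] ins[OF js, of l]
      unfolding B_def c_def E by metis
    have sr: "src Xs k = Xs ! Suc k" using str(1) k by (simp add: src_less)
    have c: "c l \<in> Hom D (src (merge_obs k Xs) k) (merge_obs k Xs ! k)" for l
      using str(3)[of k] str(3)[of "Suc k"] str(4)[of "Suc k"] str(5)[of k] str(5)[of "Suc k"] k sr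
      by (simp add: c_def merge_obs[OF str(1) k] E Comp_in_Hom)
    have Bk: "B ! k = (\<Sum>l\<in>UNIV. c l)"
      using k str(2) by (simp add: B_def c_def nth_entries merge_mor E)
    \<comment> \<open>Linearity in slot \<open>k\<close> collects the sum over the intermediate
      index into the entry of the matrix product.\<close>
    have "(\<Sum>l\<in>UNIV. \<phi> (word m (merge_obs k Xs) (B[k := c l])))
        = \<phi> (word m (merge_obs k Xs) (B[k := \<Sum>l\<in>UNIV. c l]))"
      using cyc_stringsD[OF B] k
      by (intro clinear_on_sum[OF functional_slot[OF \<phi> B k] _ c, symmetric] Hom_subspace) auto
    then show ?thesis by (simp only: upd Bk[symmetric] list_update_id) (simp only: B_def)
  qed
  then show ?thesis by (subst split) (auto intro!: sum.cong)
qed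

lemma trace_wrap:
  assumes \<phi>: "\<phi> \<in> functionals D p" and s: "(Xs, As) \<in> cyc_strings E (Suc p)"
  shows "(\<Sum>js\<in>index_lists p. \<phi> (word m (wrap_obs Xs) (entries js (wrap_mor E a Xs As))))
    = (\<Sum>is\<in>index_lists (Suc p). \<phi> (word m (wrap_obs Xs) (wrap_mor D a Xs (entries is As))))"
proof -
  note str = cyc_stringsD[OF s]
  \<comment> \<open>The wrapping face contracts the index at position 0. The head of the shorter
    list therefore belongs to the last position of the longer one.\<close>
  let ?ins = "\<lambda>js l. l # tl js @ [hd js]"
  have ins: "length (?ins js l) = Suc (Suc p) \<and> wrap_obs (?ins js l) = js \<and> ?ins js l ! 0 = l"
    if "length js = Suc p" for js and l :: 'i
    using that by (cases js) (auto simp: wrap_obs_def)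
  have "length (wrap_obs is) = Suc p \<and> ?ins (wrap_obs is) (is ! 0) = is"
    if "length is = Suc (Suc p)" for "is" :: "'i list"
    using that by (cases "is") (auto simp: wrap_obs_def append_butlast_last_id)
  note split = sum_index_lists_split[of p ?ins wrap_obs "\<lambda>is. is ! 0", OF ins this]
  have "(\<Sum>l\<in>UNIV. \<phi> (word m (wrap_obs Xs) (wrap_mor D a Xs (entries (?ins js l) As))))
      = \<phi> (word m (wrap_obs Xs) (entries js (wrap_mor E a Xs As)))"
    if js: "length js = Suc p" for js
  proof -
    define B where "B = entries js (wrap_mor E a Xs As)"
    define c where "c l = Comp D (src Xs 0) (Xs ! 0) (Xs ! Suc p)
      (Act D (src Xs (Suc p)) (Xs ! Suc p) a (As ! Suc p $ (js ! 0) $ l)) (As ! 0 $ l $ (src js 0))" for l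
    have B: "(wrap_obs Xs, B) \<in> cyc_strings D p"
      unfolding B_def by (rule entries_in[OF slot_map_in[OF E.slot_map_wrap s]])
    have len: "length (?ins js l) = Suc (Suc p)" for l using ins[OF js] by simp
    have "js ! 0 = ?ins js l ! Suc p" "src js 0 = src (?ins js l) 0" for l
      using wrap_obs(2,3)[OF len, of 0 l] ins[OF js, of l] by auto
    then have upd: "wrap_mor D a Xs (entries (?ins js l) As) = B[0 := c l]" for l
      using wrap_entries[OF len str(1,2), of D a l] ins[OF js, of l]
      unfolding B_def c_def E by metis
    have sr: "src Xs (Suc p) = Xs ! 0" using str(1) by (simp add: src_end)
    have c: "c l \<in> Hom D (src (wrap_obs Xs) 0) (wrap_obs Xs ! 0)" for l
      using str(3)[of 0] str(3)[of "Suc p"] str(4)[of 0] str(5)[of 0] str(5)[of "Suc p"] sr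
      by (simp add: c_def wrap_obs[OF str(1)] E Comp_in_Hom Act_in_Hom)
    have B0: "B ! 0 = (\<Sum>l\<in>UNIV. c l)"
      using str(1,2) by (simp add: B_def c_def nth_entries wrap_mor E)
    have "(\<Sum>l\<in>UNIV. \<phi> (word m (wrap_obs Xs) (B[0 := c l])))
        = \<phi> (word m (wrap_obs Xs) (B[0 := \<Sum>l\<in>UNIV. c l]))"
      using cyc_stringsD[OF B]
      by (intro clinear_on_sum[OF functional_slot[OF \<phi> B le0] _ c, symmetric] Hom_subspace) auto
    then show ?thesis by (simp only: upd B0[symmetric] list_update_id) (simp only: B_def)
  qed
  then show ?thesis by (subst split) (auto intro!: sum.cong)
qed

lemma trace_coface_gen:
  assumes \<phi>: "\<phi> \<in> functionals D p" and k: "k \<le> Suc p" and s: "(Xs, As) \<in> cyc_strings E (Suc p)"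
  shows "coface H E M (Suc p) k (trace_functional D p \<phi>) (word m Xs As)
    = (\<Sum>is\<in>index_lists (Suc p). coface H D M (Suc p) k \<phi> (word m Xs (entries is As)))"
proof (cases "k = Suc p")
  case True
  then show ?thesis
    by (simp add: E.coface_wrap_gen[OF trace_in[OF \<phi>] s] coface_wrap_gen[OF \<phi> entries_in[OF s]]
      trace_gen[OF \<phi> slot_map_in[OF E.slot_map_wrap s]] trace_wrap[OF \<phi> s] tensor_lift_add_sum)
next
  case False
  then have "k \<le> p" using k by simp
  then show ?thesis
    by (simp add: E.coface_merge_gen[OF trace_in[OF \<phi>] _ s] coface_merge_gen[OF \<phi> _ entries_in[OF s]]
      trace_gen[OF \<phi> slot_map_in[OF E.slot_map_merge s]] trace_merge[OF \<phi> _ s])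
qed

lemma trace_cocycle:
  assumes \<phi>: "\<phi> \<in> cyclic_cocycles H D M n"
  shows "trace_functional D n \<phi> \<in> cyclic_cocycles H E M n"
proof -
  have cyc: "\<phi> \<in> cyclic_cochains H D M n" using \<phi> by (simp add: cyclic_cocycles_def)
  have fn: "\<phi> \<in> functionals D n"
    using cyc cochain_functional[of \<phi> H D M n] by (simp add: cyclic_cochains_def)
  have "bdiff H E M n (trace_functional D n \<phi>) = (\<lambda>x. 0)"
  proof (rule functionals_eqI[OF E.bdiff_in[OF trace_in[OF fn]] functionals_zero])
    fix m Xs As assume s: "(Xs, As) \<in> cyc_strings E (Suc n)"
    have "bdiff H E M n (trace_functional D n \<phi>) (word m Xs As) = (\<Sum>k\<le>Suc n. \<Sum>is\<in>index_lists (Suc n).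
        (-1) ^ k * coface H D M (Suc n) k \<phi> (word m Xs (entries is As)))"
      by (simp add: bdiff_def trace_coface_gen[OF fn _ s] sum_distrib_left del: sum.atMost_Suc)
    also have "\<dots> = (\<Sum>is\<in>index_lists (Suc n). bdiff H D M n \<phi> (word m Xs (entries is As)))"
      by (subst sum.swap) (simp add: bdiff_def del: sum.atMost_Suc)
    finally show "bdiff H E M n (trace_functional D n \<phi>) (word m Xs As) = 0"
      by (simp add: cyclic_cocycle_bdiff[OF \<phi>])
  qed
  then show ?thesis using trace_cyclic[OF cyc] by (simp add: cyclic_cocycles_def)
qed

end

end

section \<open>Polynomial dependence\<close>

lemma pderiv_sum_poly: "pderiv (\<Sum>i\<in>A. f i) = (\<Sum>i\<in>A. pderiv (f i))"
  by (induction A rule: infinite_finite_induct) (simp_all add: pderiv_add)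

lemma antiderivative_poly:
  fixes p :: "complex poly"
  shows "\<exists>q. pderiv q = p"
proof -
  define q where "q = (\<Sum>i\<le>degree p. monom (coeff p i / of_nat (Suc i)) (Suc i))"
  have "pderiv q = (\<Sum>i\<le>degree p. pderiv (monom (coeff p i / of_nat (Suc i)) (Suc i)))"
    by (simp add: q_def pderiv_sum_poly)
  also have "\<dots> = (\<Sum>i\<le>degree p. monom (coeff p i) i)"
    by (intro sum.cong refl) (simp add: pderiv_monom del: of_nat_Suc)
  finally show ?thesis by (auto simp: poly_as_sum_of_monoms)
qed

text \<open>The basis is fixed before \<open>q\<close>, so it can be integrated once and for all.
  The interpolation error has degree below \<open>card K\<close> and vanishes on
  \<open>K\<close>.\<close>

lemma lagrange_interpolation:
  fixes K :: "complex set"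
  assumes K: "finite K"
  shows "\<exists>l. \<forall>q. degree q < card K \<longrightarrow> q = (\<Sum>t\<in>K. smult (poly q t) (l t))"
proof (intro exI allI impI)
  define l where "l t = (\<Prod>s\<in>K - {t}. smult (1 / (t - s)) [:- s, 1:])" for t
  have deg: "degree (l t) < card K" if "t \<in> K" for t
  proof -
    have "degree (l t) \<le> (\<Sum>s\<in>K - {t}. degree (smult (1 / (t - s)) [:- s, 1:]))"
      using degree_prod_sum_le[of "K - {t}" "\<lambda>s. smult (1 / (t - s)) [:- s, 1:]"] K
      by (simp only: l_def comp_def finite_Diff)
    also have "\<dots> \<le> (\<Sum>s\<in>K - {t}. 1)" by (intro sum_mono) (auto intro: order.trans[OF degree_smult_le])
    also have "\<dots> < card K" using K that by (simp only: sum_constant mult_1_right of_nat_id card_Diff1_less)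
    finally show ?thesis .
  qed
  have val: "poly (l t) x = (if x = t then 1 else 0)" if "x \<in> K" for t x
  proof -
    have "poly (l t) x = (\<Prod>s\<in>K - {t}. (x - s) / (t - s))"
      by (simp only: l_def poly_prod poly_smult poly_pCons poly_0 mult_zero_right add_0_right mult_1_right
          uminus_add_conv_diff times_divide_eq_left mult_1_left)
    moreover have "(\<Prod>s\<in>K - {t}. (t - s) / (t - s)) = 1"
      by (intro prod.neutral) auto
    moreover have "(\<Prod>s\<in>K - {t}. (x - s) / (t - s)) = 0" if "x \<noteq> t"
      using that \<open>x \<in> K\<close> K by (intro prod_zero) auto
    ultimately show ?thesis by simp
  qed
  fix q :: "complex poly" assume q: "degree q < card K"
  let ?r = "q - (\<Sum>t\<in>K. smult (poly q t) (l t))"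
  have "poly ?r x = 0" if "x \<in> K" for x
    using that K by (simp add: poly_sum val if_distrib cong: if_cong)
  then have sub: "K \<subseteq> {x. poly ?r x = 0}" by auto
  have K0: "0 < card K" using q by simp
  have "degree (\<Sum>t\<in>K. smult (poly q t) (l t)) < card K"
    using deg K0 by (intro degree_sum_less) (auto intro: le_less_trans[OF degree_smult_le])
  then have "degree ?r < card K" using q by (intro degree_diff_less)
  moreover have "card K \<le> degree ?r" if "?r \<noteq> 0"
    using card_mono[OF poly_roots_finite[OF that] sub] card_poly_roots_bound[OF that] by simp
  ultimately show "q = (\<Sum>t\<in>K. smult (poly q t) (l t))" by force
qed

text \<open>
  A quadrature rule exact for polynomials of bounded degree replaces integration over \<open>[0, 1]\<close>,
  so that the cochain to be constructed is a finite linear combination.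
\<close>

lemma exact_quadrature:
  "\<exists>K w. finite K \<and> (\<forall>p :: complex poly. degree p \<le> N \<longrightarrow>
    poly p 1 - poly p 0 = (\<Sum>t\<in>K. w t * poly (pderiv p) t))"
proof -
  define K :: "complex set" where "K = of_nat ` {..N}"
  have K: "finite K" "card K = Suc N"
    by (simp_all add: K_def card_image inj_on_def)
  obtain l where l: "\<forall>q. degree q < card K \<longrightarrow> q = (\<Sum>t\<in>K. smult (poly q t) (l t))"
    using lagrange_interpolation[OF K(1)] ..
  define L where "L t = (SOME q. pderiv q = l t)" for t
  have L: "pderiv (L t) = l t" for t
    unfolding L_def by (rule someI_ex[OF antiderivative_poly])
  \<comment> \<open>The weight of a node is the integral over \<open>[0, 1]\<close> of its Lagrange
    polynomial. Interpolation at \<open>N + 1\<close> nodes reproduces the derivative of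
    \<open>p\<close>, so \<open>?r\<close> below is constant.\<close>
  have "poly p 1 - poly p 0 = (\<Sum>t\<in>K. (poly (L t) 1 - poly (L t) 0) * poly (pderiv p) t)"
    if p: "degree p \<le> N" for p
  proof -
    let ?r = "p - (\<Sum>t\<in>K. smult (poly (pderiv p) t) (L t))"
    have "degree (pderiv p) < card K" using p by (simp add: K(2) degree_pderiv)
    have "pderiv ?r = pderiv p - (\<Sum>t\<in>K. smult (poly (pderiv p) t) (l t))"
      by (simp add: pderiv_diff pderiv_sum_poly pderiv_smult L)
    also have "\<dots> = 0" unfolding right_minus_eq by (rule l[rule_format]) fact
    finally have "degree ?r = 0" unfolding pderiv_eq_0_iff .
    then obtain a where "?r = [:a:]" by (rule degree_eq_zeroE)
    then have eq: "poly ?r 1 = poly ?r 0" by (simp only: poly_pCons poly_0 mult_zero_right)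
    define S where "S x = (\<Sum>t\<in>K. poly (L t) x * poly (pderiv p) t)" for x
    have "poly ?r x = poly p x - S x" for x
      unfolding S_def by (simp only: poly_diff poly_sum poly_smult mult.commute)
    with eq have "poly p 1 - S 1 = poly p 0 - S 0" by (simp only:)
    then have "poly p 1 - poly p 0 = S 1 - S 0" by (simp add: algebra_simps)
    then show ?thesis unfolding S_def by (simp only: sum_subtractf[symmetric] left_diff_distrib)
  qed
  then show ?thesis
    by (intro exI[of _ K] exI[of _ "\<lambda>t. poly (L t) 1 - poly (L t) 0"] conjI K(1)) simp
qed

text \<open>A form that is linear in each of \<open>n + 1\<close> slots is, along an affine line, a
  polynomial of degree at most \<open>n + 1\<close>; its derivative is given by the product
  rule.\<close>

lemma functional_polynomial:
  fixes \<phi> :: "('m::complex_vector, 'o, 'f::complex_vector) chain \<Rightarrow> complex"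
  assumes D: "left_H_category H D" and \<phi>: "\<phi> \<in> functionals D n"
    and as: "(Xs, as) \<in> cyc_strings D n" and bs: "(Xs, bs) \<in> cyc_strings D n"
  shows "\<exists>P. degree P \<le> Suc n \<and> (\<forall>t.
    poly P t = \<phi> (word m Xs (map2 (\<lambda>a b. a + t *\<^sub>C b) as bs)) \<and>
    poly (pderiv P) t = (\<Sum>i\<le>n. \<phi> (word m Xs ((map2 (\<lambda>a b. a + t *\<^sub>C b) as bs)[i := bs ! i]))))"
proof -
  interpret D: left_H_category H D by fact
  note a = cyc_stringsD[OF as] and b = cyc_stringsD[OF bs]
  define V where "V fs = \<phi> (word m Xs fs)" for fs
  define mix where "mix k t gs = map (\<lambda>i. if i < k then as ! i + t *\<^sub>C bs ! i else gs ! i) [0..<Suc n]" for k t gs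
  have len: "length (mix k t gs) = Suc n" for k t gs by (simp add: mix_def)
  have nth: "mix k t gs ! i = (if i < k then as ! i + t *\<^sub>C bs ! i else gs ! i)" if "i \<le> n" for k t gs i
    using that by (simp add: mix_def del: upt_Suc)
  have sub: "cv.subspace (Hom D (src Xs i) (Xs ! i))" if "i \<le> n" for i
    using that a by (intro D.Hom_subspace) auto
  have mem: "as ! i + t *\<^sub>C bs ! i \<in> Hom D (src Xs i) (Xs ! i)" if "i \<le> n" for i t
    using that a b by (intro cv.subspace_add[OF sub] cv.subspace_scale[OF sub]) auto
  have mix: "(Xs, mix k t gs) \<in> cyc_strings D n" if "(Xs, gs) \<in> cyc_strings D n" for k t gs
    using a(1,3) cyc_stringsD[OF that] mem by (intro cyc_stringsI) (auto simp: len nth)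
  \<comment> \<open>Only the first \<open>k\<close> slots move along the line. The remaining entries
    \<open>gs\<close> are arbitrary because the step needs both \<open>as ! k\<close> and
    \<open>bs ! k\<close> in slot \<open>k\<close>: the first gives \<open>P\<close>, the second
    gives \<open>Q\<close>, and the new polynomial is \<open>P + t Q\<close>.\<close>
  have "\<exists>P. degree P \<le> k \<and> (\<forall>t. poly P t = V (mix k t gs) \<and>
      poly (pderiv P) t = (\<Sum>i<k. V ((mix k t gs)[i := bs ! i])))"
    if "(Xs, gs) \<in> cyc_strings D n" "k \<le> Suc n" for k gs
    using that
  proof (induction k arbitrary: gs)
    case 0
    have "mix 0 t gs = gs" for t
      using cyc_stringsD(2)[OF 0(1)] by (intro nth_equalityI) (auto simp: len nth)
    then show ?case by (intro exI[of _ "[:V gs:]"]) simp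
  next
    case (Suc k)
    then have k: "k \<le> n" by simp
    have str: "(Xs, gs[k := as ! k]) \<in> cyc_strings D n" "(Xs, gs[k := bs ! k]) \<in> cyc_strings D n"
      using Suc.prems k a b by (auto intro!: cyc_strings_update)
    obtain P where P: "degree P \<le> k" "\<And>t. poly P t = V (mix k t (gs[k := as ! k]))"
        "\<And>t. poly (pderiv P) t = (\<Sum>i<k. V ((mix k t (gs[k := as ! k]))[i := bs ! i]))"
      using Suc.IH[OF str(1)] k by auto
    obtain Q where Q: "degree Q \<le> k" "\<And>t. poly Q t = V (mix k t (gs[k := bs ! k]))"
        "\<And>t. poly (pderiv Q) t = (\<Sum>i<k. V ((mix k t (gs[k := bs ! k]))[i := bs ! i]))"
      using Suc.IH[OF str(2)] k by auto
    have gs: "length gs = Suc n" using Suc.prems cyc_stringsD(2) by blast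
    have split: "V (ks[k := as ! k + t *\<^sub>C bs ! k]) = V (ks[k := as ! k]) + t * V (ks[k := bs ! k])"
      if "(Xs, ks) \<in> cyc_strings D n" for ks t
      using clinear_onD[OF functional_slot[OF \<phi> that k, of m]] a(5)[OF k] b(5)[OF k] cv.subspace_scale[OF sub[OF k]]
      by (simp add: V_def scaleC_complex_def)
    have mixk: "mix k t (gs[k := x]) = (mix k t gs)[k := x]" for t x
      using k gs by (intro nth_equalityI) (auto simp: len nth nth_list_update)
    have mixS: "mix (Suc k) t gs = (mix k t gs)[k := as ! k + t *\<^sub>C bs ! k]" for t
      using k gs by (intro nth_equalityI) (auto simp: len nth nth_list_update less_Suc_eq)
    have val: "poly (P + pCons 0 Q) t = V (mix (Suc k) t gs)" for t
      using split[OF mix[OF Suc.prems(1)]] by (simp add: P(2) Q(2) mixk mixS)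
    have der: "poly (pderiv (P + pCons 0 Q)) t = (\<Sum>i<Suc k. V ((mix (Suc k) t gs)[i := bs ! i]))" for t
    proof -
      have "V ((mix (Suc k) t gs)[i := bs ! i])
          = V ((mix k t gs)[k := as ! k, i := bs ! i]) + t * V ((mix k t gs)[k := bs ! k, i := bs ! i])"
        if "i < k" for i
        using split[OF cyc_strings_update[OF mix[OF Suc.prems(1)] b(5)[of i]], of k t t] that k
        by (simp add: mixS list_update_swap[of k i])
      then show ?thesis
        by (simp add: pderiv_add pderiv_pCons P(3) Q(2,3) mixk mixS sum.distrib sum_distrib_left)
    qed
    have "degree (P + pCons 0 Q) \<le> Suc k"
      using P(1) Q(1) by (intro degree_add_le) (auto intro: order.trans[OF degree_pCons_le])
    then show ?case using val der by (intro exI[of _ "P + pCons 0 Q"]) blast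
  qed
  from this[OF as le_refl] obtain P where P: "degree P \<le> Suc n" "\<And>t. poly P t = V (mix (Suc n) t as)"
    "\<And>t. poly (pderiv P) t = (\<Sum>i<Suc n. V ((mix (Suc n) t as)[i := bs ! i]))" by blast
  have "mix (Suc n) t as = map2 (\<lambda>a b. a + t *\<^sub>C b) as bs" for t
    using a(2) b(2) by (intro nth_equalityI) (auto simp: len nth)
  then show ?thesis using P by (auto simp: V_def lessThan_Suc_atMost intro!: exI[of _ P] simp del: sum.lessThan_Suc sum.atMost_Suc)
qed

section \<open>Linear combinations of coboundaries\<close>

context hopf_cyclic
begin

lemma cyclic_cochain_functional: "\<phi> \<in> cyclic_cochains H D M n \<Longrightarrow> \<phi> \<in> functionals D n"
  using cochain_functional[of \<phi> H D M n] by (simp add: cyclic_cochains_def)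

lemma cyclic_cochains_sum:
  assumes "\<And>k. k \<in> I \<Longrightarrow> \<phi> k \<in> cyclic_cochains H D M n"
  shows "(\<lambda>x. \<Sum>k\<in>I. c k * \<phi> k x) \<in> cyclic_cochains H D M n"
proof (rule cyclic_cochainI[OF cochains_sum])
  show "\<phi> k \<in> cochains H D M n" if "k \<in> I" for k
    using assms[OF that] by (simp add: cyclic_cochains_def)
  show "cyc_op H D M n (\<lambda>x. \<Sum>k\<in>I. c k * \<phi> k x) (word m Xs fs)
      = (-1) ^ n * (\<Sum>k\<in>I. c k * \<phi> k (word m Xs fs))"
    if "(Xs, fs) \<in> cyc_strings D n" for m Xs fs
    by (subst cyc_op_sum_gen[OF cyclic_cochain_functional[OF assms] that])
      (simp_all add: cyclic_cochain_cyc_op[OF assms] sum_distrib_left mult_ac)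
qed

lemma bdiff_sum:
  assumes "\<And>k. k \<in> I \<Longrightarrow> \<phi> k \<in> functionals D p"
  shows "bdiff H D M p (\<lambda>x. \<Sum>k\<in>I. c k * \<phi> k x) = (\<lambda>x. \<Sum>k\<in>I. c k * bdiff H D M p (\<phi> k) x)"
proof (rule functionals_eqI[OF bdiff_in[OF functionals_sum[OF assms]] functionals_sum[OF bdiff_in[OF assms]]])
  fix m Xs fs assume s: "(Xs, fs) \<in> cyc_strings D (Suc p)"
  have "bdiff H D M p (\<lambda>x. \<Sum>k\<in>I. c k * \<phi> k x) (word m Xs fs)
      = (\<Sum>i\<le>Suc p. \<Sum>k\<in>I. (-1) ^ i * (c k * coface H D M (Suc p) i (\<phi> k) (word m Xs fs)))"
    unfolding bdiff_def
    by (simp add: coface_sum_gen[OF assms _ s] sum_distrib_left del: sum.atMost_Suc)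
  also have "\<dots> = (\<Sum>k\<in>I. c k * bdiff H D M p (\<phi> k) (word m Xs fs))"
    by (subst sum.swap) (simp add: bdiff_def sum_distrib_left mult_ac del: sum.atMost_Suc)
  finally show "bdiff H D M p (\<lambda>x. \<Sum>k\<in>I. c k * \<phi> k x) (word m Xs fs)
      = (\<Sum>k\<in>I. c k * bdiff H D M p (\<phi> k) (word m Xs fs))" .
qed

lemma cyclic_coboundaries_sum:
  assumes "\<And>k. k \<in> I \<Longrightarrow> \<phi> k \<in> cyclic_coboundaries H D M n"
  shows "(\<lambda>x. \<Sum>k\<in>I. c k * \<phi> k x) \<in> cyclic_coboundaries H D M n"
proof (cases n)
  case 0
  then show ?thesis using assms by (auto intro!: ext sum.neutral)
next
  case (Suc p)
  then have "\<forall>k\<in>I. \<exists>\<psi>\<in>cyclic_cochains H D M p. \<phi> k = bdiff H D M p \<psi>" using assms by auto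
  then obtain \<psi> where \<psi>: "\<And>k. k \<in> I \<Longrightarrow> \<psi> k \<in> cyclic_cochains H D M p"
    "\<And>k. k \<in> I \<Longrightarrow> \<phi> k = bdiff H D M p (\<psi> k)" by metis
  have "(\<lambda>x. \<Sum>k\<in>I. c k * \<phi> k x) = bdiff H D M p (\<lambda>x. \<Sum>k\<in>I. c k * \<psi> k x)"
    by (subst bdiff_sum[OF cyclic_cochain_functional[OF \<psi>(1)]]) (simp_all add: \<psi>(2))
  then show ?thesis using cyclic_cochains_sum[of I \<psi> p c] \<psi>(1) Suc by auto
qed

lemma cyclic_coboundary_functional:
  "\<phi> \<in> cyclic_coboundaries H D M n \<Longrightarrow> \<phi> \<in> functionals D n"
  by (cases n) (auto simp: functionals_zero intro: bdiff_in cyclic_cochain_functional)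

lemma cyclic_cocycles_sum:
  assumes "\<And>k. k \<in> I \<Longrightarrow> \<phi> k \<in> cyclic_cocycles H D M n"
  shows "(\<lambda>x. \<Sum>k\<in>I. c k * \<phi> k x) \<in> cyclic_cocycles H D M n"
proof -
  have cyc: "\<phi> k \<in> cyclic_cochains H D M n" if "k \<in> I" for k
    using assms[OF that] by (simp add: cyclic_cocycles_def)
  have "bdiff H D M n (\<lambda>x. \<Sum>k\<in>I. c k * \<phi> k x) = (\<lambda>x. 0)"
    by (subst bdiff_sum[OF cyclic_cochain_functional[OF cyc]])
      (simp_all add: cyclic_cocycle_bdiff[OF assms])
  then show ?thesis using cyclic_cochains_sum[of I \<phi> n c] cyc by (simp add: cyclic_cocycles_def)
qed

lemma HC_trivial:
  assumes "\<And>\<phi>. \<phi> \<in> cyclic_cocycles H D M n \<Longrightarrow> \<phi> \<in> cyclic_coboundaries H D M n"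
  shows "HC H D M n = {HC_zero H D M n}"
proof -
  have zero: "(\<lambda>x. 0) \<in> cyclic_cocycles H D M n"
    using cyclic_cocycles_sum[of "{}"] by simp
  \<comment> \<open>A difference is read as a sum over \<open>bool\<close> with coefficients
    \<open>1\<close> and \<open>-1\<close>.\<close>
  have diff: "(\<lambda>x. \<phi> x - \<psi> x) \<in> cyclic_cocycles H D M n"
    if "\<phi> \<in> cyclic_cocycles H D M n" "\<psi> \<in> cyclic_cocycles H D M n" for \<phi> \<psi>
    using that cyclic_cocycles_sum[of "UNIV :: bool set" "\<lambda>k. if k then \<phi> else \<psi>" n "\<lambda>k. if k then 1 else -1"]
    by (simp add: UNIV_bool)
  have cls: "cohomologous H D M n `` {\<phi>} = cyclic_cocycles H D M n"
    if "\<phi> \<in> cyclic_cocycles H D M n" for \<phi>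
    using that diff assms by (auto simp: cohomologous_def)
  show ?thesis
    unfolding HC_def HC_zero_def quotient_def using zero by (auto simp: cls)
qed

section \<open>Invariant morphisms\<close>

text \<open>Since \<open>h_1 c = \<epsilon>(h_1) c\<close>, the counit axiom leaves \<open>h\<close>
  acting on \<open>f\<close> alone. This and its mirror image make the entries of the path
  \<open>H\<close>-linear in \<open>f\<close>.\<close>

lemma Act_Comp_invariant_left:
  assumes ob: "X \<in> Ob D" "Y \<in> Ob D" and f: "f \<in> Hom D X Y" and c: "c \<in> Hom D Y Y"
    "\<And>h. Act D Y Y h c = counit H h *\<^sub>C c"
  shows "Act D X Y h (Comp D X Y Y c f) = Comp D X Y Y c (Act D X Y h f)"
proof -
  have lin: "clinear (\<lambda>x. Comp D X Y Y c (Act D X Y x f))"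
    using clinear_onD[OF Comp_linear_right[OF ob(1,2,2) c(1)]] ob f
    by (simp add: clinear_iff Act_in_Hom clinear_add[OF Act_linear_left] clinear_scale[OF Act_linear_left])
  have "Act D X Y h (Comp D X Y Y c f)
      = tensor_lift (\<lambda>h1 h2. Comp D X Y Y c (Act D X Y (counit H h1 *\<^sub>C h2) f)) (comult H h)"
    using assms clinear_onD(2)[OF Comp_linear_left]
    by (simp add: Act_Comp Act_in_Hom clinear_scale[OF lin])
  then show ?thesis
    by (simp add: clinear_tensor_lift_out[OF lin, symmetric] counit_left)
qed

lemma Act_Comp_invariant_right:
  assumes ob: "X \<in> Ob D" "Y \<in> Ob D" and f: "f \<in> Hom D X Y" and c: "c \<in> Hom D X X"
    "\<And>h. Act D X X h c = counit H h *\<^sub>C c"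
  shows "Act D X Y h (Comp D X X Y f c) = Comp D X X Y (Act D X Y h f) c"
proof -
  have lin: "clinear (\<lambda>x. Comp D X X Y (Act D X Y x f) c)"
    using clinear_onD[OF Comp_linear_left[OF ob(1,1,2) c(1)]] ob f
    by (simp add: clinear_iff Act_in_Hom clinear_add[OF Act_linear_left] clinear_scale[OF Act_linear_left])
  have "Act D X Y h (Comp D X X Y f c)
      = tensor_lift (\<lambda>h1 h2. Comp D X X Y (Act D X Y (counit H h2 *\<^sub>C h1) f) c) (comult H h)"
    using assms clinear_onD(2)[OF Comp_linear_right]
    by (simp add: Act_Comp Act_in_Hom clinear_scale[OF lin])
  then show ?thesis
    by (simp add: clinear_tensor_lift_out[OF lin, symmetric] counit_right)
qed

text \<open>From \<open>h(e) c = h(e c) = \<epsilon>(h) 1\<close>, composing with \<open>e\<close>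
  on the right gives the claim. Membership in \<open>\<U>\<close> asserts invariance only of the
  unit, while the path also uses entries of its inverse.\<close>

lemma inverse_invariant:
  assumes X: "X \<in> Ob D" and c: "c \<in> Hom D X X" "\<And>h. Act D X X h c = counit H h *\<^sub>C c"
    and e: "e \<in> Hom D X X" "Comp D X X X e c = Id D X" "Comp D X X X c e = Id D X"
  shows "Act D X X h e = counit H h *\<^sub>C e"
proof -
  have "Comp D X X X (Act D X X h e) c = counit H h *\<^sub>C Id D X"
    using Act_Comp_invariant_right[OF X X e(1) c, of h] by (simp add: e(2) Act_Id X)
  then have "Comp D X X X (Comp D X X X (Act D X X h e) c) e = counit H h *\<^sub>C e"
    using clinear_onD(2)[OF Comp_linear_left[OF X X X e(1)] Id_in_Hom[OF X]]
    by (simp add: Id_left[OF X X e(1)])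
  moreover have "Comp D X X X (Comp D X X X (Act D X X h e) c) e = Act D X X h e"
    using X c e by (simp add: Comp_assoc Act_in_Hom Id_right)
  ultimately show ?thesis by simp
qed

end

section \<open>Tensors with \<open>2 \<times> 2\<close> matrices as matrices of morphisms\<close>

text \<open>This translates \<open>mat2 D\<close> into \<open>mat_cat D\<close>, compatibly with
  composition, identities and action. It is injective on all tensors, so equations proved for
  matrices can be carried back.\<close>

definition entry_matrix :: "('f::complex_vector, complex ^ 2 ^ 2) tensor \<Rightarrow> 'f ^ 2 ^ 2"
  where "entry_matrix t = (\<chi> i j. entry i j t)"

lemma clinear_entry: "clinear (entry i j)"
proof -
  have "cbilinear (\<lambda>(f::'a) (B::complex^2^2). (B $ i $ j) *\<^sub>C f)"
    by (simp add: cbilinear_def clinear_iff scaleC_add_left scaleC_add_right scaleC_scaleC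
        scaleC_vec_def scaleC_complex_def mult.commute)
  then show ?thesis unfolding entry_def by (rule clinear_tensor_lift)
qed

lemma entry_matrix_unit:
  "entry i j (f \<otimes> matrix_unit k l) = (if k = i then if l = j then f else 0 else 0)"
  by (auto simp: entry_tens matrix_unit_def scaleC_one)

lemma tensor_entries: "t = (\<Sum>i\<in>UNIV. \<Sum>j\<in>UNIV. entry i j t \<otimes> matrix_unit i j)"
proof (induction t rule: tens_induct)
  case zero
  then show ?case by (simp add: clinear_zero[OF clinear_entry] clinear_zero[OF clinear_tens_left])
next
  case (add a b t)
  then show ?case
    by (simp add: clinear_add[OF clinear_entry] clinear_add[OF clinear_tens_left] sum.distrib
        entry_tens sum_tens_matrix_unit)
qed

lemma entry_matrix_inject: "entry_matrix s = entry_matrix t \<longleftrightarrow> s = t"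
proof
  assume "entry_matrix s = entry_matrix t"
  then have "entry i j s = entry i j t" for i j by (simp add: entry_matrix_def vec_eq_iff)
  then show "s = t" using tensor_entries[of s] tensor_entries[of t] by simp
qed simp

lemma sum_if_const: "(\<Sum>l\<in>A. if P then f l else 0) = (if P then \<Sum>l\<in>A. f l else 0)"
  by simp

lemma entry_matrix_Comp:
  "entry_matrix (Comp (mat2 D) X Y Z s t) = Comp (mat_cat D) X Y Z (entry_matrix s) (entry_matrix t)"
  by (simp add: entry_matrix_def vec_eq_iff mat2_def clinear_sum[OF clinear_entry] entry_matrix_unit sum_if_const)

lemma entry_matrix_Act: "entry_matrix (Act (mat2 D) X Y h t) = Act (mat_cat D) X Y h (entry_matrix t)"
  by (simp add: entry_matrix_def vec_eq_iff mat2_def clinear_sum[OF clinear_entry] entry_matrix_unit sum_if_const)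

lemma entry_matrix_Id: "entry_matrix (Id (mat2 D) X) = Id (mat_cat D) X"
  by (simp add: entry_matrix_def vec_eq_iff mat2_def entry_tens mat_def scaleC_one)

lemma (in left_H_category) entry_matrix_in_Hom:
  assumes ob: "X \<in> Ob D" "Y \<in> Ob D" and t: "t \<in> Hom (mat2 D) X Y"
  shows "entry_matrix t \<in> Hom (mat_cat D) X Y"
proof -
  have "t \<in> cv.span {f \<otimes> B | f B. f \<in> Hom D X Y}" using t by (simp add: mat2_def)
  then have "entry i j t \<in> Hom D X Y" for i j
  proof (induction rule: cv.span_induct_alt)
    case base
    then show ?case by (simp add: clinear_zero[OF clinear_entry] zero_in_Hom ob)
  next
    case (step c x y)
    then obtain f B where x: "x = f \<otimes> B" "f \<in> Hom D X Y" by blast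
    note sub = Hom_subspace[OF ob]
    show ?case
      unfolding x(1) clinear_add[OF clinear_entry] clinear_scale[OF clinear_entry] entry_tens
      by (intro cv.subspace_add[OF sub] cv.subspace_scale[OF sub] x(2) step(2))
  qed
  then show ?thesis by (simp add: entry_matrix_def)
qed

section \<open>The path of semifunctors\<close>

definition matrix3 :: "'a \<Rightarrow> 'a \<Rightarrow> 'a \<Rightarrow> 'a \<Rightarrow> 'a \<Rightarrow> 'a \<Rightarrow> 'a \<Rightarrow> 'a \<Rightarrow> 'a \<Rightarrow> 'a::zero ^ 3 ^ 3"
  where "matrix3 a b c d e f g h i = vector [vector [a, b, c], vector [d, e, f], vector [g, h, i]]"

lemma matrix3_nth [simp]:
  "matrix3 a b c d e f g h i $ 1 $ 1 = a" "matrix3 a b c d e f g h i $ 1 $ 2 = b"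
  "matrix3 a b c d e f g h i $ 1 $ 3 = c" "matrix3 a b c d e f g h i $ 2 $ 1 = d"
  "matrix3 a b c d e f g h i $ 2 $ 2 = e" "matrix3 a b c d e f g h i $ 2 $ 3 = f"
  "matrix3 a b c d e f g h i $ 3 $ 1 = g" "matrix3 a b c d e f g h i $ 3 $ 2 = h"
  "matrix3 a b c d e f g h i $ 3 $ 3 = i"
  by (simp_all add: matrix3_def)

lemma vec3_eq_iff: "A = B \<longleftrightarrow> (\<forall>i j. A $ i $ j = B $ i $ j)" for A B :: "'a ^ 3 ^ 3"
  by (simp add: vec_eq_iff)

lemma scaleC_combine:
  "(a + b = c) \<Longrightarrow> a *\<^sub>C x + b *\<^sub>C x = c *\<^sub>C (x :: 'a::complex_vector)"
  by (simp add: scaleC_add_left[symmetric])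

text \<open>
  Here \<open>(u, d)\<close> is the second row of \<open>\<eta>\<close> and \<open>(v, e)\<close> the second column of its inverse;
  the identity \<open>\<upsilon>(f) = u f v + d \<upsilon>(f) e\<close> exhibits \<open>\<upsilon>\<close> as equivalent to \<open>id \<oplus> \<upsilon>\<close>.
\<close>

locale absorbing_semifunctor = hopf_cyclic H D M + H_linear_semifunctor D D "\<lambda>X. X" \<upsilon>
  for H :: "('h::complex_algebra_1) hopf"
    and D :: "('o, 'f::complex_vector, 'h) hcat"
    and M :: "('m::complex_vector, 'h) sayd"
    and \<upsilon> :: "'o \<Rightarrow> 'o \<Rightarrow> 'f \<Rightarrow> 'f" +
  fixes u v d e :: "'o \<Rightarrow> 'f"
  assumes invariant: "invariant_family H D u" "invariant_family H D v"
      "invariant_family H D d" "invariant_family H D e"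
    and vu: "X \<in> Ob D \<Longrightarrow> Comp D X X X (v X) (u X) = Id D X"
    and vd: "X \<in> Ob D \<Longrightarrow> Comp D X X X (v X) (d X) = 0"
    and eu: "X \<in> Ob D \<Longrightarrow> Comp D X X X (e X) (u X) = 0"
    and uv_de: "X \<in> Ob D \<Longrightarrow> Comp D X X X (u X) (v X) + Comp D X X X (d X) (e X) = Id D X"
    and ed: "\<lbrakk>X \<in> Ob D; Y \<in> Ob D; f \<in> Hom D X Y\<rbrakk> \<Longrightarrow>
      Comp D X Y Y (e Y) (Comp D X Y Y (d Y) (\<upsilon> X Y f)) = \<upsilon> X Y f"
    and u_comm: "\<lbrakk>X \<in> Ob D; Y \<in> Ob D; f \<in> Hom D X Y\<rbrakk> \<Longrightarrow>
      Comp D X X Y (\<upsilon> X Y f) (u X) = Comp D X Y Y (u Y) f"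
    and d_comm: "\<lbrakk>X \<in> Ob D; Y \<in> Ob D; f \<in> Hom D X Y\<rbrakk> \<Longrightarrow>
      Comp D X X Y (\<upsilon> X Y f) (d X) = Comp D X Y Y (d Y) (\<upsilon> X Y f)"
    and v_comm: "\<lbrakk>X \<in> Ob D; Y \<in> Ob D; f \<in> Hom D X Y\<rbrakk> \<Longrightarrow>
      Comp D X Y Y (v Y) (\<upsilon> X Y f) = Comp D X X Y f (v X)"
    and e_comm: "\<lbrakk>X \<in> Ob D; Y \<in> Ob D; f \<in> Hom D X Y\<rbrakk> \<Longrightarrow>
      Comp D X Y Y (e Y) (\<upsilon> X Y f) = Comp D X X Y (\<upsilon> X Y f) (e X)"
begin

lemma family_in [simp]:
  assumes "X \<in> Ob D"
  shows "u X \<in> Hom D X X" "v X \<in> Hom D X X" "d X \<in> Hom D X X" "e X \<in> Hom D X X"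
  using invariant assms by (simp_all add: invariant_family_def)

lemma family_act:
  assumes "X \<in> Ob D"
  shows "Act D X X h (u X) = counit H h *\<^sub>C u X" "Act D X X h (v X) = counit H h *\<^sub>C v X"
    "Act D X X h (d X) = counit H h *\<^sub>C d X" "Act D X X h (e X) = counit H h *\<^sub>C e X"
  using invariant assms by (simp_all add: invariant_family_def)

lemma Comp_scale:
  assumes "X \<in> Ob D" "Y \<in> Ob D" "Z \<in> Ob D" "f \<in> Hom D X Y" "g \<in> Hom D Y Z"
  shows "Comp D X Y Z (a *\<^sub>C g) (b *\<^sub>C f) = (a * b) *\<^sub>C Comp D X Y Z g f"
proof -
  have "b *\<^sub>C f \<in> Hom D X Y" using assms Hom_subspace cv.subspace_scale by blast
  then show ?thesis
    using clinear_onD(2)[OF Comp_linear_left] clinear_onD(2)[OF Comp_linear_right] assms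
    by (simp add: scaleC_scaleC)
qed

lemma Comp_scale1:
  assumes "X \<in> Ob D" "Y \<in> Ob D" "Z \<in> Ob D" "f \<in> Hom D X Y" "g \<in> Hom D Y Z"
  shows "Comp D X Y Z (a *\<^sub>C g) f = a *\<^sub>C Comp D X Y Z g f"
    and "Comp D X Y Z g (b *\<^sub>C f) = b *\<^sub>C Comp D X Y Z g f"
  using Comp_scale[OF assms, of a 1] Comp_scale[OF assms, of 1 b] by (simp_all add: scaleC_one)

text \<open>Moving \<open>u\<close> and \<open>d\<close> to the right through
  \<open>\<upsilon>(f)\<close> turns the left side into
  \<open>\<upsilon>(f) (u v + d e)\<close>.\<close>

lemma uv_de_left:
  assumes ob: "X \<in> Ob D" "Y \<in> Ob D" and f: "f \<in> Hom D X Y"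
  shows "Comp D X Y Y (u Y) (Comp D X X Y f (v X)) + Comp D X Y Y (d Y) (Comp D X X Y (\<upsilon> X Y f) (e X)) = \<upsilon> X Y f"
proof -
  have F: "\<upsilon> X Y f \<in> Hom D X Y" using F_hom[OF ob f] .
  have "Comp D X Y Y (u Y) (Comp D X X Y f (v X)) = Comp D X X Y (\<upsilon> X Y f) (Comp D X X X (u X) (v X))"
    using ob f F by (simp add: Comp_assoc[symmetric] u_comm)
  moreover have "Comp D X Y Y (d Y) (Comp D X X Y (\<upsilon> X Y f) (e X)) = Comp D X X Y (\<upsilon> X Y f) (Comp D X X X (d X) (e X))"
    using ob f F by (simp add: Comp_assoc[symmetric] d_comm)
  ultimately show ?thesis
    using clinear_onD(1)[OF Comp_linear_right[OF ob(1,1,2) F], of "Comp D X X X (u X) (v X)" "Comp D X X X (d X) (e X)"] ob F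
    by (simp add: Comp_in_Hom uv_de Id_right)
qed

text \<open>
  Writing \<open>\<gamma>\<^sub>t\<close> for \<open>path t\<close>, this is \<open>f \<mapsto> C diag(f, \<upsilon>(f)) R\<^sub>t\<close> for the column
  \<open>C = (1; \<eta>')\<close> and the row \<open>R\<^sub>t = ((1 - t) 1, t \<eta>'')\<close>, where \<open>\<eta>' = (u, d)\<close> and
  \<open>\<eta>'' = (v; e)\<close>; it is multiplicative because \<open>R\<^sub>t C\<close> acts as the identity on \<open>diag(f, \<upsilon>(f))\<close>.
  Its derivative is the commutator of the constant \<open>generator = C (1, - \<eta>'')\<close> with it.
\<close>

definition path :: "complex \<Rightarrow> 'o \<Rightarrow> 'o \<Rightarrow> 'f \<Rightarrow> 'f ^ 3 ^ 3"
  where "path t X Y f = matrix3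
    ((1 - t) *\<^sub>C f) 0 (t *\<^sub>C Comp D X X Y f (v X))
    0 ((1 - t) *\<^sub>C \<upsilon> X Y f) (t *\<^sub>C Comp D X X Y (\<upsilon> X Y f) (e X))
    ((1 - t) *\<^sub>C Comp D X Y Y (u Y) f) ((1 - t) *\<^sub>C Comp D X Y Y (d Y) (\<upsilon> X Y f)) (t *\<^sub>C \<upsilon> X Y f)"

definition path_deriv :: "'o \<Rightarrow> 'o \<Rightarrow> 'f \<Rightarrow> 'f ^ 3 ^ 3"
  where "path_deriv X Y f = matrix3
    (- f) 0 (Comp D X X Y f (v X))
    0 (- \<upsilon> X Y f) (Comp D X X Y (\<upsilon> X Y f) (e X))
    (- Comp D X Y Y (u Y) f) (- Comp D X Y Y (d Y) (\<upsilon> X Y f)) (\<upsilon> X Y f)"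

definition generator :: "'o \<Rightarrow> 'f ^ 3 ^ 3"
  where "generator X = matrix3 (Id D X) 0 (- v X) 0 (Id D X) (- e X) (u X) (d X) (- Id D X)"

lemma uminus_in_Hom: "X \<in> Ob D \<Longrightarrow> Y \<in> Ob D \<Longrightarrow> f \<in> Hom D X Y \<Longrightarrow> - f \<in> Hom D X Y"
  using Hom_subspace cv.subspace_neg by blast

lemma scale_in_Hom: "X \<in> Ob D \<Longrightarrow> Y \<in> Ob D \<Longrightarrow> f \<in> Hom D X Y \<Longrightarrow> a *\<^sub>C f \<in> Hom D X Y"
  using Hom_subspace cv.subspace_scale by blast

lemma Act_scale: "X \<in> Ob D \<Longrightarrow> Y \<in> Ob D \<Longrightarrow> f \<in> Hom D X Y \<Longrightarrow> Act D X Y h (a *\<^sub>C f) = a *\<^sub>C Act D X Y h f"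
  using clinear_onD(2)[OF Act_linear_right] by blast

lemma path_semifunctor: "H_linear_semifunctor D (mat_cat D) (\<lambda>X. X) (path t)"
proof
  fix X Y Z f g h assume ob: "X \<in> Ob D" "Y \<in> Ob D"
  note F_hom' = F_hom[OF ob, simplified]
  show "X \<in> Ob (mat_cat D)" using ob by simp
  show "clinear_on (Hom D X Y) (path t X Y)"
    using ob F_hom' clinear_onD[OF F_linear[OF ob]]
      clinear_onD[OF Comp_linear_left[OF ob(1,1,2)]] clinear_onD[OF Comp_linear_right[OF ob(1,2,2)]]
    by (simp add: clinear_on_def path_def vec3_eq_iff forall_3 scaleC_add_right scaleC_scaleC mult.commute)
  assume f: "f \<in> Hom D X Y"
  show "path t X Y f \<in> Hom (mat_cat D) X Y"
    using ob f F_hom' by (simp add: path_def forall_3 scale_in_Hom zero_in_Hom Comp_in_Hom)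
  show "path t X Y (Act D X Y h f) = Act (mat_cat D) X Y h (path t X Y f)"
    using ob f F_hom' F_act[OF ob f]
    by (simp add: path_def vec3_eq_iff forall_3 Act_scale Act_zero Comp_in_Hom family_act
        Act_Comp_invariant_left Act_Comp_invariant_right)
next
  fix X Y Z f g
  assume ob: "X \<in> Ob D" "Y \<in> Ob D" "Z \<in> Ob D" and f: "f \<in> Hom D X Y" and g: "g \<in> Hom D Y Z"
  define F G where "F = \<upsilon> X Y f" and "G = \<upsilon> Y Z g"
  have FG: "F \<in> Hom D X Y" "G \<in> Hom D Y Z"
    using F_hom[OF ob(1,2) f] F_hom[OF ob(2,3) g] by (simp_all add: F_def G_def)
  have GF: "\<upsilon> X Z (Comp D X Y Z g f) = Comp D X Y Z G F"
    using F_comp[OF ob f g] by (simp add: F_def G_def)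
  note homs = f g FG ob family_in Comp_in_Hom
  \<comment> \<open>\<open>m1\<close>, \<open>m2\<close>, \<open>m4\<close> and \<open>m5\<close>
    are the four entries of \<open>\<eta>'' \<eta>' = 1\<close> between the diagonals of
    \<open>g\<close> and \<open>f\<close>. The last of them, \<open>e d = 1\<close>, holds only in
    front of a value of \<open>\<upsilon>\<close>.\<close>
  have m1: "Comp D X Y Z (Comp D Y Y Z g (v Y)) (Comp D X Y Y (u Y) f) = Comp D X Y Z g f"
  proof -
    have "Comp D X Y Z (Comp D Y Y Z g (v Y)) (Comp D X Y Y (u Y) f)
        = Comp D X Y Z g (Comp D X Y Y (Comp D Y Y Y (v Y) (u Y)) f)"
      using homs by (simp add: Comp_assoc)
    then show ?thesis using homs by (simp add: vu Id_left)
  qed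
  have m2: "Comp D X Y Z (Comp D Y Y Z g (v Y)) (Comp D X Y Y (d Y) F) = 0"
  proof -
    have "Comp D X Y Z (Comp D Y Y Z g (v Y)) (Comp D X Y Y (d Y) F)
        = Comp D X Y Z g (Comp D X Y Y (Comp D Y Y Y (v Y) (d Y)) F)"
      using homs by (simp add: Comp_assoc)
    then show ?thesis using homs by (simp add: vd Comp_zero_left Comp_zero_right)
  qed
  have m3: "Comp D X Y Z (Comp D Y Y Z g (v Y)) F = Comp D X X Z (Comp D X Y Z g f) (v X)"
    using homs v_comm[OF ob(1,2) f] by (simp add: Comp_assoc F_def[symmetric])
  have m4: "Comp D X Y Z (Comp D Y Y Z G (e Y)) (Comp D X Y Y (u Y) f) = 0"
  proof -
    have "Comp D X Y Z (Comp D Y Y Z G (e Y)) (Comp D X Y Y (u Y) f)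
        = Comp D X Y Z G (Comp D X Y Y (Comp D Y Y Y (e Y) (u Y)) f)"
      using homs by (simp add: Comp_assoc)
    then show ?thesis using homs by (simp add: eu Comp_zero_left Comp_zero_right)
  qed
  have m5: "Comp D X Y Z (Comp D Y Y Z G (e Y)) (Comp D X Y Y (d Y) F) = Comp D X Y Z G F"
    using homs ed[OF ob(1,2) f] by (simp add: Comp_assoc F_def[symmetric])
  have m6: "Comp D X Y Z (Comp D Y Y Z G (e Y)) F = Comp D X X Z (Comp D X Y Z G F) (e X)"
    using homs e_comm[OF ob(1,2) f] by (simp add: Comp_assoc F_def[symmetric])
  have m6b: "Comp D X Y Z G (Comp D X X Y F (e X)) = Comp D X X Z (Comp D X Y Z G F) (e X)"
    using homs by (simp add: Comp_assoc)
  have m7: "Comp D X Y Z (Comp D Y Z Z (u Z) g) f = Comp D X Z Z (u Z) (Comp D X Y Z g f)"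
    using homs by (simp add: Comp_assoc)
  have m7b: "Comp D X Y Z G (Comp D X Y Y (u Y) f) = Comp D X Z Z (u Z) (Comp D X Y Z g f)"
    using homs u_comm[OF ob(2,3) g] by (simp add: Comp_assoc[symmetric] G_def[symmetric])
  have m8: "Comp D X Y Z (Comp D Y Z Z (d Z) G) F = Comp D X Z Z (d Z) (Comp D X Y Z G F)"
    using homs by (simp add: Comp_assoc)
  have m8b: "Comp D X Y Z G (Comp D X Y Y (d Y) F) = Comp D X Z Z (d Z) (Comp D X Y Z G F)"
    using homs d_comm[OF ob(2,3) g] by (simp add: Comp_assoc[symmetric] G_def[symmetric])
  have m9: "Comp D X Y Z (Comp D Y Z Z (u Z) g) (Comp D X X Y f (v X))
      + Comp D X Y Z (Comp D Y Z Z (d Z) G) (Comp D X X Y F (e X)) = Comp D X Y Z G F"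
    using homs uv_de_left[OF ob(1,3), of "Comp D X Y Z g f"] by (simp add: Comp_assoc GF)
  have m10: "Comp D X Y Z g (Comp D X X Y f (v X)) = Comp D X X Z (Comp D X Y Z g f) (v X)"
    using homs by (simp add: Comp_assoc)
  \<comment> \<open>In the entry \<open>(3, 3)\<close> two terms of weight \<open>(1 - t) t\<close>
    combine by \<open>m9\<close> and join a third of weight \<open>t t\<close>. With
    \<open>a = 1 - t\<close> and \<open>b = t\<close> the total weight is \<open>t\<close>.\<close>
  have m33: "(a * b) *\<^sub>C Comp D X Y Z (Comp D Y Z Z (u Z) g) (Comp D X X Y f (v X))
      + ((a * b) *\<^sub>C Comp D X Y Z (Comp D Y Z Z (d Z) G) (Comp D X X Y F (e X)) + (b * b) *\<^sub>C Comp D X Y Z G F)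
      = ((a + b) * b) *\<^sub>C Comp D X Y Z G F" for a b
    unfolding add.assoc[symmetric] scaleC_add_right[symmetric] m9 by (simp add: scaleC_add_left distrib_right)
  define s where "s = 1 - t"
  have s: "t * s = s * t" "s * s + s * t = s" "s * t + t * t = t" "(s + t) * t = t"
    by (simp_all add: s_def algebra_simps)
  have zero: "Comp D X Y Z 0 0 = 0" using ob by (intro Comp_zero_left zero_in_Hom)
  show "path t X Z (Comp D X Y Z g f) = Comp (mat_cat D) X Y Z (path t Y Z g) (path t X Y f)"
    unfolding path_def vec3_eq_iff forall_3 mat_cat_simps sum_3 matrix3_nth F_def[symmetric] G_def[symmetric] GF
      s_def[symmetric]
    using homs m33[of s t]
    by (simp add: Comp_scale Comp_scale1 Comp_zero_left Comp_zero_right scale_in_Hom zero s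
        m1 m2 m3 m4 m5 m6 m6b m7 m7b m8 m8b m10 scaleC_combine add.assoc)
qed

end

context absorbing_semifunctor
begin

lemma Comp_minus:
  assumes "X \<in> Ob D" "Y \<in> Ob D" "Z \<in> Ob D" "f \<in> Hom D X Y" "g \<in> Hom D Y Z"
  shows "Comp D X Y Z (- g) f = - Comp D X Y Z g f" "Comp D X Y Z g (- f) = - Comp D X Y Z g f"
  using Comp_scale1[OF assms, of "-1"] by (simp_all add: cv.scale_minus_left scaleC_one)

lemma generator_invariant: "invariant_family H (mat_cat D) generator"
proof -
  have "generator X \<in> Hom (mat_cat D) X X \<and>
      (\<forall>h. Act (mat_cat D) X X h (generator X) = counit H h *\<^sub>C generator X)" if X: "X \<in> Ob D" for X
  proof -
    have neg: "Act D X X h (- f) = - Act D X X h f" if "f \<in> Hom D X X" for f h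
      using Act_scale[OF X X that, of h "-1"] by (simp add: scaleC_one)
    show ?thesis using X
      by (simp add: generator_def forall_3 vec3_eq_iff Id_in_Hom zero_in_Hom uminus_in_Hom
          family_act Act_Id Act_zero neg)
  qed
  then show ?thesis by (simp add: invariant_family_def)
qed

lemma path_affine:
  "path t X Y f = path 0 X Y f + t *\<^sub>C path_deriv X Y f"
  by (simp add: path_def path_deriv_def vec3_eq_iff forall_3 cv.scale_left_diff_distrib scaleC_one)

lemma path_deriv_in:
  assumes "X \<in> Ob D" "Y \<in> Ob D" "f \<in> Hom D X Y"
  shows "path_deriv X Y f \<in> Hom (mat_cat D) X Y"
  using assms F_hom[OF assms]
  by (simp add: path_deriv_def forall_3 uminus_in_Hom zero_in_Hom Comp_in_Hom)

text \<open>On \<open>diag(f, \<upsilon>(f))\<close> the product \<open>R\<^sub>t C\<close> acts as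
  the identity, while \<open>(1, - \<eta>'') C = 1 - \<eta>'' \<eta>'\<close> annihilates it. Of the
  two terms of the commutator only \<open>C diag(f, \<upsilon>(f)) (1, - \<eta>'')\<close> remains,
  which is minus the derivative.\<close>

lemma path_commutator:
  assumes ob: "X \<in> Ob D" "Y \<in> Ob D" and f: "f \<in> Hom D X Y"
  shows "commutator (mat_cat D) generator X Y (path t X Y f) = - path_deriv X Y f"
proof -
  define F where "F = \<upsilon> X Y f"
  have F: "F \<in> Hom D X Y" using F_hom[OF ob f] by (simp add: F_def)
  note homs = f F ob family_in Comp_in_Hom Id_in_Hom
  note comm = u_comm[OF ob f] d_comm[OF ob f] v_comm[OF ob f] e_comm[OF ob f]
  note comm' = comm[folded F_def]
  have m1: "Comp D X X Y (Comp D X X Y f (v X)) (u X) = f"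
    using homs by (simp add: Comp_assoc vu Id_right)
  have m2: "Comp D X X Y (Comp D X X Y f (v X)) (d X) = 0"
    using homs by (simp add: Comp_assoc vd Comp_zero_right)
  have m3: "Comp D X X Y (Comp D X X Y F (e X)) (u X) = 0"
    using homs by (simp add: Comp_assoc eu Comp_zero_right)
  have m4: "Comp D X X Y (Comp D X X Y F (e X)) (d X) = F"
  proof -
    have "Comp D X X Y (Comp D X X Y F (e X)) (d X) = Comp D X Y Y (e Y) (Comp D X X Y F (d X))"
      using homs by (simp add: Comp_assoc comm'(4)[symmetric])
    then show ?thesis using ed[OF ob f] comm' by (simp add: F_def)
  qed
  have m5: "Comp D X Y Y (v Y) (Comp D X Y Y (u Y) f) = f"
    using homs by (simp add: Comp_assoc[symmetric] vu Id_left)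
  have m6: "Comp D X Y Y (v Y) (Comp D X Y Y (d Y) F) = 0"
    using homs by (simp add: Comp_assoc[symmetric] vd Comp_zero_left)
  have m7: "Comp D X Y Y (e Y) (Comp D X Y Y (u Y) f) = 0"
    using homs by (simp add: Comp_assoc[symmetric] eu Comp_zero_left)
  have m8: "Comp D X Y Y (e Y) (Comp D X Y Y (d Y) F) = F"
    using ed[OF ob f] by (simp add: F_def)
  have m9: "Comp D X X Y (Comp D X Y Y (u Y) f) (v X) = Comp D X Y Y (u Y) (Comp D X X Y f (v X))"
    "Comp D X X Y (Comp D X Y Y (d Y) F) (e X) = Comp D X Y Y (d Y) (Comp D X X Y F (e X))"
    using homs by (simp_all add: Comp_assoc)
  have m10: "Comp D X Y Y (d Y) (Comp D X X Y F (e X)) = F - Comp D X Y Y (u Y) (Comp D X X Y f (v X))"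
    using uv_de_left[OF ob f] by (simp add: F_def eq_diff_eq add.commute)
  have zero: "Comp D X X Y 0 0 = 0" "Comp D X Y Y 0 0 = 0"
    using ob by (auto intro!: Comp_zero_left zero_in_Hom)
  define s where "s = 1 - t"
  show ?thesis
    unfolding commutator_def path_def path_deriv_def generator_def vec3_eq_iff forall_3 mat_cat_simps sum_3 matrix3_nth
      F_def[symmetric] vector_minus_component vector_uminus_component s_def[symmetric]
    using homs
    apply (simp add: Comp_scale1 Comp_minus Comp_zero_left Comp_zero_right scale_in_Hom uminus_in_Hom zero
        m1 m2 m3 m4 m5 m6 m7 m8 m9 m10 comm' Id_left Id_right)
    apply (simp add: s_def cv.scale_left_diff_distrib cv.scale_right_diff_distrib scaleC_one)
    done
qed

lemma path_string_in:
  assumes s: "(Xs, fs) \<in> cyc_strings D n"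
  shows "(Xs, map_string (path t) Xs fs) \<in> cyc_strings (mat_cat D) n"
proof -
  interpret P: H_linear_semifunctor D "mat_cat D" "\<lambda>X. X" "path t" by (rule path_semifunctor)
  show ?thesis
    using cyc_stringsD[OF s] P.F_hom
    by (intro cyc_stringsI) (auto simp: nth_map_string simp del: mat_cat_simps(2))
qed

lemma functional_zero_entry:
  fixes \<phi> :: "('n::complex_vector, 'o, 'f) chain \<Rightarrow> complex"
  assumes \<phi>: "\<phi> \<in> functionals D n" and s: "(Xs, fs) \<in> cyc_strings D n" and k: "k \<le> n" "fs ! k = 0"
  shows "\<phi> (word m Xs fs) = 0"
proof -
  have "fs[k := 0] = fs" using k by (metis list_update_id)
  moreover have "cv.subspace (Hom D (src Xs k) (Xs ! k))"
    using cyc_stringsD[OF s] k by (intro Hom_subspace) auto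
  ultimately show ?thesis
    using clinear_on_zero[OF functional_slot[OF \<phi> s k(1)], of m] by simp
qed

lemma path_entry_nonzero:
  fixes \<phi> :: "('n::complex_vector, 'o, 'f) chain \<Rightarrow> complex"
  assumes \<phi>: "\<phi> \<in> functionals D n" and s: "(Xs, fs) \<in> cyc_strings D n" and k: "k \<le> n"
    and nz: "\<phi> (word m Xs (entries is (map_string (path t) Xs fs))) \<noteq> 0"
  shows "path t (src Xs k) (Xs ! k) (fs ! k) $ (is ! k) $ (src is k) \<noteq> 0"
proof
  assume "path t (src Xs k) (Xs ! k) (fs ! k) $ (is ! k) $ (src is k) = 0"
  then have "entries is (map_string (path t) Xs fs) ! k = 0"
    using k cyc_stringsD(2)[OF s] by (simp add: nth_entries nth_map_string)
  from functional_zero_entry[OF \<phi> entries_in[OF refl path_string_in[OF s]] k this]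
  show False using nz by simp
qed

lemma constant_index_list:
  assumes "length is = Suc n" "\<And>k. k < n \<Longrightarrow> is ! Suc k = is ! k"
  shows "is = replicate (Suc n) (is ! 0)"
proof -
  define a where "a = is ! 0"
  have "is ! k = a" if "k \<le> n" for k
    using that by (induction k) (auto simp: assms(2) a_def)
  then show ?thesis
    unfolding a_def[symmetric] using assms(1) by (intro nth_equalityI) (auto simp del: replicate_Suc)
qed

lemma entries_replicate:
  "length As = Suc n \<Longrightarrow> entries (replicate (Suc n) i) As = map (\<lambda>A. A $ i $ i) As"
  by (intro nth_equalityI) (auto simp: nth_entries src_eq simp del: replicate_Suc)

text \<open>
  A cyclic word in \<open>path 0\<close> can avoid zero entries only if its indices are constantly 1 or
  constantly 2, because \<open>path 0\<close> is block triangular with vanishing third column; in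
  \<open>path 1\<close> only the third column survives.
\<close>

lemma path_at_0:
  fixes \<phi> :: "('n::complex_vector, 'o, 'f) chain \<Rightarrow> complex"
  assumes \<phi>: "\<phi> \<in> functionals D n" and s: "(Xs, fs) \<in> cyc_strings D n"
  shows "trace_functional D n \<phi> (word m Xs (map_string (path 0) Xs fs))
    = \<phi> (word m Xs fs) + \<phi> (word m Xs (map_string \<upsilon> Xs fs))"
proof -
  note str = cyc_stringsD[OF s]
  let ?As = "map_string (path 0) Xs fs"
  have van: "\<phi> (word m Xs (entries is ?As)) = 0"
    if "is \<in> index_lists n - {replicate (Suc n) 1, replicate (Suc n) 2}" for "is" :: "3 list"
  proof (rule ccontr)
    assume nz: "\<phi> (word m Xs (entries is ?As)) \<noteq> 0"
    have l: "length is = Suc n" using that by simp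
    \<comment> \<open>Read off from \<open>path 0\<close>: the third column is zero, and outside the
      third row only diagonal entries survive.\<close>
    have ent: "src is k \<noteq> 3 \<and> (is ! k = src is k \<or> is ! k = 3)" if k: "k \<le> n" for k
      using path_entry_nonzero[OF \<phi> s k nz] exhaust_3[of "is ! k"] exhaust_3[of "src is k"]
      by (auto simp: path_def)
    \<comment> \<open>Each row index is the column index of the cyclically preceding slot, so the
      zero third column also excludes 3 as a row index.\<close>
    have ne3: "is ! k \<noteq> 3" if "k \<le> n" for k
    proof (cases k)
      case 0
      then show ?thesis using ent[of n] src_end[of n "is"] l by simp
    next
      case (Suc j)
      then show ?thesis using ent[of j] src_less[of j "is"] l that by simp
    qed
    have "is ! Suc k = is ! k" if "k < n" for k
      using ent[of k] ne3[of k] src_less[of k "is"] l that by simp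
    from constant_index_list[OF l this] have "is = replicate (Suc n) (is ! 0)" .
    then show False using that ne3[of 0] exhaust_3[of "is ! 0"] by (metis DiffD2 insertCI le0)
  qed
  have "trace_functional D n \<phi> (word m Xs ?As)
      = (\<Sum>is\<in>index_lists n. \<phi> (word m Xs (entries is ?As)))"
    by (rule trace_gen[OF refl \<phi> path_string_in[OF s]])
  also have "\<dots> = (\<Sum>is\<in>{replicate (Suc n) 1, replicate (Suc n) (2::3)}. \<phi> (word m Xs (entries is ?As)))"
    using van by (intro sum.mono_neutral_right finite_index_lists) auto
  also have "\<dots> = \<phi> (word m Xs (entries (replicate (Suc n) 1) ?As))
      + \<phi> (word m Xs (entries (replicate (Suc n) 2) ?As))"
    by simp
  also have "entries (replicate (Suc n) 1) ?As = fs"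
    unfolding entries_replicate[of ?As n 1, simplified str(2) length_map_string, OF refl]
    using str(2) by (intro nth_equalityI) (auto simp: nth_map_string path_def scaleC_one)
  also have "entries (replicate (Suc n) 2) ?As = map_string \<upsilon> Xs fs"
    unfolding entries_replicate[of ?As n 2, simplified str(2) length_map_string, OF refl]
    using str(2) by (intro nth_equalityI) (auto simp: nth_map_string path_def scaleC_one)
  finally show ?thesis .
qed

lemma path_at_1:
  fixes \<phi> :: "('n::complex_vector, 'o, 'f) chain \<Rightarrow> complex"
  assumes \<phi>: "\<phi> \<in> functionals D n" and s: "(Xs, fs) \<in> cyc_strings D n"
  shows "trace_functional D n \<phi> (word m Xs (map_string (path 1) Xs fs))
    = \<phi> (word m Xs (map_string \<upsilon> Xs fs))"
proof -
  note str = cyc_stringsD[OF s]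
  let ?As = "map_string (path 1) Xs fs"
  have van: "\<phi> (word m Xs (entries is ?As)) = 0"
    if "is \<in> index_lists n - {replicate (Suc n) 3}" for "is" :: "3 list"
  proof (rule ccontr)
    assume nz: "\<phi> (word m Xs (entries is ?As)) \<noteq> 0"
    have l: "length is = Suc n" using that by simp
    have ent: "src is k = 3" if k: "k \<le> n" for k
      using path_entry_nonzero[OF \<phi> s k nz] exhaust_3[of "is ! k"] exhaust_3[of "src is k"]
      by (auto simp: path_def)
    have eq3: "is ! k = 3" if "k \<le> n" for k
    proof (cases k)
      case 0
      then show ?thesis using ent[of n] src_end[of n "is"] l by simp
    next
      case (Suc j)
      then show ?thesis using ent[of j] src_less[of j "is"] l that by simp
    qed
    have "is = replicate (Suc n) 3"
      using l eq3 by (intro nth_equalityI) (auto simp del: replicate_Suc)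
    then show False using that by simp
  qed
  have "trace_functional D n \<phi> (word m Xs ?As)
      = (\<Sum>is\<in>index_lists n. \<phi> (word m Xs (entries is ?As)))"
    by (rule trace_gen[OF refl \<phi> path_string_in[OF s]])
  also have "\<dots> = (\<Sum>is\<in>{replicate (Suc n) (3::3)}. \<phi> (word m Xs (entries is ?As)))"
    using van by (intro sum.mono_neutral_right finite_index_lists) auto
  also have "\<dots> = \<phi> (word m Xs (entries (replicate (Suc n) 3) ?As))"
    by simp
  also have "entries (replicate (Suc n) 3) ?As = map_string \<upsilon> Xs fs"
    unfolding entries_replicate[of ?As n 3, simplified str(2) length_map_string, OF refl]
    using str(2) by (intro nth_equalityI) (auto simp: nth_map_string path_def scaleC_one)
  finally show ?thesis .
qed

section \<open>Vanishing of cyclic cohomology\<close>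

theorem cyclic_cocycle_coboundary:
  assumes \<phi>: "\<phi> \<in> cyclic_cocycles H D M n"
  shows "\<phi> \<in> cyclic_coboundaries H D M n"
proof -
  define E where "E = (mat_cat D :: ('o, 'f ^ 3 ^ 3, 'h) hcat)"
  interpret E: hopf_cyclic H E M unfolding E_def by (rule hopf_cyclic_mat_cat)
  interpret P: hopf_cyclic_semifunctor H D E M "path t" for t
    unfolding E_def
    by (intro hopf_cyclic_semifunctor.intro hopf_cyclic_mat_cat hopf_cyclic_axioms path_semifunctor)
  have fn: "\<phi> \<in> functionals D n"
    using \<phi> by (intro cyclic_cochain_functional) (simp add: cyclic_cocycles_def)
  define T where "T = (trace_functional D n \<phi> :: ('m, 'o, 'f ^ 3 ^ 3) chain \<Rightarrow> complex)"
  have T: "T \<in> functionals E n" unfolding T_def E_def by (rule trace_in[OF refl fn])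
  have cocycle: "T \<in> cyclic_cocycles H E M n" unfolding T_def E_def by (rule trace_cocycle[OF refl \<phi>])
  have "invariant_family H E generator" unfolding E_def by (rule generator_invariant)
  \<comment> \<open>Neither \<open>T\<close> nor \<open>generator\<close> depends on
    \<open>t\<close>, so one coboundary \<open>\<xi>\<close> over the matrix category serves for the
    whole path; only its pullbacks vary.\<close>
  from E.inner_derivation_coboundary[OF this cocycle] obtain \<xi> where
    \<xi>: "\<xi> \<in> cyclic_coboundaries H E M n" and
    \<xi>_gen: "\<And>m Xs As. (Xs, As) \<in> cyc_strings E n \<Longrightarrow> \<xi> (word m Xs As) = (\<Sum>i\<le>n. T (word m Xs (As[i :=
      commutator E generator (src Xs i) (Xs ! i) (As ! i)])))"
    by blast
  obtain K w where K: "finite K" and w: "\<And>p :: complex poly. degree p \<le> Suc n \<Longrightarrow>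
      poly p 1 - poly p 0 = (\<Sum>t\<in>K. w t * poly (pderiv p) t)"
    using exact_quadrature[of "Suc n"] by blast
  have cob: "(\<lambda>x. \<Sum>t\<in>K. w t * P.pullback t n \<xi> x) \<in> cyclic_coboundaries H D M n"
    by (intro cyclic_coboundaries_sum P.pullback_coboundary \<xi>)
  have "\<phi> = (\<lambda>x. \<Sum>t\<in>K. w t * P.pullback t n \<xi> x)"
  proof (rule functionals_eqI[OF fn cyclic_coboundary_functional[OF cob]])
    fix m Xs fs assume s: "(Xs, fs) \<in> cyc_strings D n"
    note str = cyc_stringsD[OF s]
    \<comment> \<open>Starting point and direction of the path through the given string, so that
      \<open>functional_polynomial\<close> yields the function of \<open>t\<close> to be
      integrated.\<close>
    define as bs where "as = map_string (path 0) Xs fs" and "bs = map_string path_deriv Xs fs"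
    have as: "(Xs, as) \<in> cyc_strings E n" unfolding as_def E_def by (rule path_string_in[OF s])
    have bs: "(Xs, bs) \<in> cyc_strings E n"
      unfolding bs_def E_def using str path_deriv_in
      by (intro cyc_stringsI) (auto simp: nth_map_string simp del: mat_cat_simps(2))
    have affine: "map2 (\<lambda>a b. a + t *\<^sub>C b) as bs = map_string (path t) Xs fs" for t
      by (intro nth_equalityI) (auto simp: as_def bs_def nth_map_string path_affine[of t])
    obtain p where p: "degree p \<le> Suc n"
      "\<And>t. poly p t = T (word m Xs (map_string (path t) Xs fs))"
      "\<And>t. poly (pderiv p) t = (\<Sum>i\<le>n. T (word m Xs ((map_string (path t) Xs fs)[i := bs ! i])))"
      using functional_polynomial[OF E.category T as bs, of m] unfolding affine by blast
    have "P.pullback t n \<xi> (word m Xs fs) = - poly (pderiv p) t" for t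
    proof -
      let ?As = "map_string (path t) Xs fs"
      have As: "(Xs, ?As) \<in> cyc_strings E n" unfolding E_def by (rule path_string_in[OF s])
      have "P.pullback t n \<xi> (word m Xs fs) = \<xi> (word m Xs ?As)"
        by (rule P.pullback_gen[OF E.cyclic_coboundary_functional[OF \<xi>] s])
      also have "\<dots> = (\<Sum>i\<le>n. T (word m Xs (?As[i := - bs ! i])))"
        unfolding \<xi>_gen[OF As]
      proof (intro sum.cong refl)
        fix i assume "i \<in> {..n}"
        then have "commutator E generator (src Xs i) (Xs ! i) (?As ! i) = - bs ! i"
          using str by (simp add: E_def bs_def nth_map_string path_commutator)
        then show "T (word m Xs (?As[i :=
          commutator E generator (src Xs i) (Xs ! i) (?As ! i)]))
          = T (word m Xs (?As[i := - bs ! i]))" by simp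
      qed
      also have "\<dots> = - poly (pderiv p) t"
        unfolding p(3) sum_negf[symmetric]
      proof (intro sum.cong refl)
        fix i assume "i \<in> {..n}"
        then have i: "i \<le> n" by simp
        show "T (word m Xs (?As[i := - bs ! i])) = - T (word m Xs (?As[i := bs ! i]))"
          using clinear_onD(2)[OF functional_slot[OF T As i, of m] cyc_stringsD(5)[OF bs i], of "-1"]
          by (simp add: scaleC_one)
      qed
      finally show ?thesis .
    qed
    \<comment> \<open>The minus sign of \<open>path_commutator\<close> reverses the integral: the
      start value \<open>\<phi> + \<upsilon>\<^sup>*\<phi>\<close> comes with a plus sign and the
      end value \<open>\<upsilon>\<^sup>*\<phi>\<close> is subtracted.\<close>
    then have "(\<Sum>t\<in>K. w t * P.pullback t n \<xi> (word m Xs fs)) = poly p 0 - poly p 1"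
      using w[OF p(1)] by (simp add: sum_negf algebra_simps)
    also have "\<dots> = \<phi> (word m Xs fs)"
      unfolding p(2) T_def path_at_0[OF fn s] path_at_1[OF fn s] by simp
    finally show "\<phi> (word m Xs fs) = (\<Sum>t\<in>K. w t * P.pullback t n \<xi> (word m Xs fs))"
      by simp
  qed
  then show ?thesis using cob by simp
qed

end

section \<open>Extracting the data from the invariant unit\<close>

lemma (in hopf_cyclic) invariant_unit_matrix:
  fixes \<eta> :: "'o \<Rightarrow> ('f, complex ^ 2 ^ 2) tensor"
  assumes \<eta>: "\<eta> \<in> \<U> H (mat2 D)" and X: "X \<in> Ob D"
  defines "N \<equiv> entry_matrix (\<eta> X)" and "N' \<equiv> entry_matrix (inverse_mor (mat2 D) X (\<eta> X))"
  shows "N \<in> Hom (mat_cat D) X X" "N' \<in> Hom (mat_cat D) X X"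
    and "Comp (mat_cat D) X X X N' N = Id (mat_cat D) X" "Comp (mat_cat D) X X X N N' = Id (mat_cat D) X"
    and "Act (mat_cat D) X X h N = counit H h *\<^sub>C N" (is ?E) "Act (mat_cat D) X X h N' = counit H h *\<^sub>C N'" (is ?F)
proof -
  interpret C: hopf_cyclic H "mat_cat D :: ('o, 'f ^ 2 ^ 2, 'h) hcat" M by (rule hopf_cyclic_mat_cat)
  have X': "X \<in> Ob (mat_cat D :: ('o, 'f ^ 2 ^ 2, 'h) hcat)" "X \<in> Ob (mat2 D)"
    using X by (simp_all add: mat2_def)
  have aut: "\<eta> X \<in> Aut (mat2 D) X" and act: "Act (mat2 D) X X h (\<eta> X) = counit H h *\<^sub>C \<eta> X" for h
    using \<eta> X' by (auto simp: invariant_units_def)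
  let ?inv = "\<lambda>g. g \<in> Hom (mat2 D) X X \<and> Comp (mat2 D) X X X g (\<eta> X) = Id (mat2 D) X
    \<and> Comp (mat2 D) X X X (\<eta> X) g = Id (mat2 D) X"
  have N: "N \<in> Hom (mat_cat D) X X"
    unfolding N_def using aut X by (intro entry_matrix_in_Hom) (auto simp: Aut_def)
  then show "N \<in> Hom (mat_cat D) X X" .
  have mat: "entry_matrix g \<in> Hom (mat_cat D) X X \<and>
      Comp (mat_cat D) X X X (entry_matrix g) N = Id (mat_cat D) X \<and>
      Comp (mat_cat D) X X X N (entry_matrix g) = Id (mat_cat D) X" if "?inv g" for g
    unfolding N_def using that X
    by (auto simp only: entry_matrix_Comp[symmetric] entry_matrix_Id intro: entry_matrix_in_Hom)
  \<comment> \<open>\<open>inverse_mor\<close> is a definite description, so uniqueness has to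
    precede any statement about it. The usual argument is carried out among matrices and transferred
    by injectivity.\<close>
  have unique: "g = g'" if "?inv g" "?inv g'" for g g'
  proof -
    have "entry_matrix g = Comp (mat_cat D) X X X (entry_matrix g) (Comp (mat_cat D) X X X N (entry_matrix g'))"
      using mat[OF that(1)] mat[OF that(2)] X' by (simp only: C.Id_right)
    also have "\<dots> = Comp (mat_cat D) X X X (Comp (mat_cat D) X X X (entry_matrix g) N) (entry_matrix g')"
      by (rule C.Comp_assoc[OF X'(1) X'(1) X'(1) X'(1) mat[OF that(2), THEN conjunct1] N
            mat[OF that(1), THEN conjunct1], symmetric])
    also have "\<dots> = entry_matrix g'"
      using mat[OF that(1)] mat[OF that(2)] X' by (simp only: C.Id_left)
    finally show ?thesis by (simp only: entry_matrix_inject)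
  qed
  obtain g where "?inv g" using aut by (auto simp: Aut_def)
  then have "\<exists>!g. ?inv g" using unique by blast
  from mat[OF theI'[OF this, folded inverse_mor_def]]
  show N': "N' \<in> Hom (mat_cat D) X X" "Comp (mat_cat D) X X X N' N = Id (mat_cat D) X"
    "Comp (mat_cat D) X X X N N' = Id (mat_cat D) X"
    unfolding N'_def by blast+
  have N_act: "Act (mat_cat D) X X h N = counit H h *\<^sub>C N" for h
    unfolding N_def entry_matrix_Act[symmetric] act
    by (simp add: entry_matrix_def vec_eq_iff clinear_scale[OF clinear_entry])
  then show ?E .
  show ?F
    by (rule C.inverse_invariant[OF X'(1) N N_act N'])
qed

lemma (in hopf_cyclic) absorbing_semifunctor_exists:
  fixes \<eta> :: "'o \<Rightarrow> ('f, complex ^ 2 ^ 2) tensor"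
  assumes \<upsilon>: "H_linear_semifunctor D D (\<lambda>X. X) \<upsilon>" and \<eta>: "\<eta> \<in> \<U> H (mat2 D)"
    and \<Phi>: "\<And>X Y f. \<lbrakk>X \<in> Ob D; Y \<in> Ob D; f \<in> Hom D X Y\<rbrakk> \<Longrightarrow>
      \<Phi> (mat2 D) \<eta> X Y (f \<otimes> matrix_unit 1 1 + \<upsilon> X Y f \<otimes> matrix_unit 2 2)
        = \<upsilon> X Y f \<otimes> matrix_unit 2 2"
  shows "\<exists>u v d e. absorbing_semifunctor H D M \<upsilon> u v d e"
proof -
  interpret \<upsilon>: H_linear_semifunctor D D "\<lambda>X. X" \<upsilon> by fact
  interpret C: hopf_cyclic H "mat_cat D :: ('o, 'f ^ 2 ^ 2, 'h) hcat" M by (rule hopf_cyclic_mat_cat)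
  define N N' where "N X = entry_matrix (\<eta> X)" and "N' X = entry_matrix (inverse_mor (mat2 D) X (\<eta> X))" for X
  note unit = invariant_unit_matrix[OF \<eta>, folded N_def N'_def]
  define A B where "A X Y f = entry_matrix (f \<otimes> matrix_unit 1 1 + \<upsilon> X Y f \<otimes> matrix_unit 2 2)"
    and "B X Y f = entry_matrix (\<upsilon> X Y f \<otimes> matrix_unit 2 2)" for X Y f
  have A: "A X Y f $ 1 $ 1 = f" "A X Y f $ 1 $ 2 = 0" "A X Y f $ 2 $ 1 = 0" "A X Y f $ 2 $ 2 = \<upsilon> X Y f"
    and B: "B X Y f $ 1 $ 1 = 0" "B X Y f $ 1 $ 2 = 0" "B X Y f $ 2 $ 1 = 0" "B X Y f $ 2 $ 2 = \<upsilon> X Y f"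
    for X Y f
    by (simp_all add: A_def B_def entry_matrix_def clinear_add[OF clinear_entry] entry_matrix_unit)
  have AB_in: "A X Y f \<in> Hom (mat_cat D) X Y" "B X Y f \<in> Hom (mat_cat D) X Y"
    if "X \<in> Ob D" "Y \<in> Ob D" "f \<in> Hom D X Y" for X Y f
    using that \<upsilon>.F_hom[OF that] by (simp_all add: forall_2 A B zero_in_Hom)
  have conj: "Comp (mat_cat D) X Y Y (N Y) (Comp (mat_cat D) X X Y (A X Y f) (N' X)) = B X Y f"
    if "X \<in> Ob D" "Y \<in> Ob D" "f \<in> Hom D X Y" for X Y f
    using \<Phi>[OF that] by (simp only: inner_functor_def A_def B_def N_def N'_def entry_matrix_Comp[symmetric])
  \<comment> \<open>Cancelling one factor of the conjugation gives relations that involve either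
    \<open>N\<close> or \<open>N'\<close> alone and can be compared entry by entry.\<close>
  have left: "Comp (mat_cat D) X Y Y (N Y) (A X Y f) = Comp (mat_cat D) X X Y (B X Y f) (N X)"
    if "X \<in> Ob D" "Y \<in> Ob D" "f \<in> Hom D X Y" for X Y f
  proof -
    note in' = AB_in[OF that] unit(1-4)[OF that(1)] unit(1-4)[OF that(2)]
    have ob: "X \<in> Ob (mat_cat D :: ('o, 'f ^ 2 ^ 2, 'h) hcat)" "Y \<in> Ob (mat_cat D :: ('o, 'f ^ 2 ^ 2, 'h) hcat)"
      using that by simp_all
    have "Comp (mat_cat D) X X Y (B X Y f) (N X)
        = Comp (mat_cat D) X Y Y (N Y) (Comp (mat_cat D) X X Y (A X Y f) (Comp (mat_cat D) X X X (N' X) (N X)))"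
      unfolding conj[OF that, symmetric] using in' ob by (simp only: C.Comp_assoc C.Comp_in_Hom)
    then show ?thesis using in' ob by (simp only: C.Id_right)
  qed
  have right: "Comp (mat_cat D) X X Y (A X Y f) (N' X) = Comp (mat_cat D) X Y Y (N' Y) (B X Y f)"
    if "X \<in> Ob D" "Y \<in> Ob D" "f \<in> Hom D X Y" for X Y f
  proof -
    note in' = AB_in[OF that] unit(1-4)[OF that(1)] unit(1-4)[OF that(2)]
    have ob: "X \<in> Ob (mat_cat D :: ('o, 'f ^ 2 ^ 2, 'h) hcat)" "Y \<in> Ob (mat_cat D :: ('o, 'f ^ 2 ^ 2, 'h) hcat)"
      using that by simp_all
    have "Comp (mat_cat D) X Y Y (N' Y) (B X Y f)
        = Comp (mat_cat D) X Y Y (Comp (mat_cat D) Y Y Y (N' Y) (N Y)) (Comp (mat_cat D) X X Y (A X Y f) (N' X))"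
      unfolding conj[OF that, symmetric]
      by (rule C.Comp_assoc[OF ob(1,2,2,2) C.Comp_in_Hom[OF ob(1,1,2) in'(4,1)] in'(7,8), symmetric])
    then show ?thesis using in' ob by (simp only: C.Id_left C.Comp_in_Hom)
  qed
  have N_in: "N X $ i $ j \<in> Hom D X X" "N' X $ i $ j \<in> Hom D X X" if "X \<in> Ob D" for X i j
    using unit(1,2)[OF that] by simp_all
  have N_act: "Act D X X h (N X $ i $ j) = counit H h *\<^sub>C (N X $ i $ j)"
    "Act D X X h (N' X $ i $ j) = counit H h *\<^sub>C (N' X $ i $ j)" if "X \<in> Ob D" for X h i j
    using unit(5,6)[OF that, of h] by (simp_all add: vec_eq_iff)
  have left': "(\<Sum>l\<in>UNIV. Comp D X Y Y (N Y $ i $ l) (A X Y f $ l $ j)) = (\<Sum>l\<in>UNIV. Comp D X X Y (B X Y f $ i $ l) (N X $ l $ j))"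
    and right': "(\<Sum>l\<in>UNIV. Comp D X X Y (A X Y f $ i $ l) (N' X $ l $ j)) = (\<Sum>l\<in>UNIV. Comp D X Y Y (N' Y $ i $ l) (B X Y f $ l $ j))"
    if "X \<in> Ob D" "Y \<in> Ob D" "f \<in> Hom D X Y" for X Y f i j
    using left[OF that] right[OF that] by (simp_all add: vec_eq_iff)
  have inv1: "(\<Sum>l\<in>UNIV. Comp D X X X (N' X $ i $ l) (N X $ l $ j)) = (if i = j then Id D X else 0)"
    and inv2: "(\<Sum>l\<in>UNIV. Comp D X X X (N X $ i $ l) (N' X $ l $ j)) = (if i = j then Id D X else 0)"
    if "X \<in> Ob D" for X i j
    using unit(3,4)[OF that] by (simp_all add: vec_eq_iff)
  note simps = sum_2 A B N_in Comp_zero_left Comp_zero_right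
  \<comment> \<open>The first row and the first column of \<open>B\<close> vanish, whereas
    \<open>A\<close> has \<open>f\<close> as its \<open>(1, 1)\<close> entry; the choice of the
    identity for \<open>f\<close> isolates the matrix entry.\<close>
  have N11: "N X $ 1 $ 1 = 0" and N'11: "N' X $ 1 $ 1 = 0" if X: "X \<in> Ob D" for X
    using left'[OF X X Id_in_Hom[OF X], of 1 1] right'[OF X X Id_in_Hom[OF X], of 1 1] X
    by (simp_all add: simps Id_left Id_right)
  \<comment> \<open>The same comparison in column 2 shows only that the entry annihilates values of
    \<open>\<upsilon>\<close>, since \<open>\<upsilon>\<close> of an identity may fail to be
    one.\<close>
  have N12: "Comp D X Y Y (N Y $ 1 $ 2) (\<upsilon> X Y f) = 0"
    if "X \<in> Ob D" "Y \<in> Ob D" "f \<in> Hom D X Y" for X Y f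
    using left'[OF that, of 1 2] that by (simp add: simps)
  show ?thesis
  proof (intro exI)
    show "absorbing_semifunctor H D M \<upsilon> (\<lambda>X. N X $ 2 $ 1) (\<lambda>X. N' X $ 1 $ 2) (\<lambda>X. N X $ 2 $ 2) (\<lambda>X. N' X $ 2 $ 2)"
    proof (intro absorbing_semifunctor.intro absorbing_semifunctor_axioms.intro hopf_cyclic_axioms \<upsilon>)
      show "invariant_family H D (\<lambda>X. N X $ 2 $ 1)" "invariant_family H D (\<lambda>X. N' X $ 1 $ 2)"
        "invariant_family H D (\<lambda>X. N X $ 2 $ 2)" "invariant_family H D (\<lambda>X. N' X $ 2 $ 2)"
        by (simp_all add: invariant_family_def N_in N_act)
    next
      fix X assume X: "X \<in> Ob D"
      show "Comp D X X X (N' X $ 1 $ 2) (N X $ 2 $ 1) = Id D X"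
        using inv1[OF X, of 1 1] X by (simp add: simps N11 N'11 zero_in_Hom)
      show "Comp D X X X (N' X $ 1 $ 2) (N X $ 2 $ 2) = 0"
        using inv1[OF X, of 1 2] X by (simp add: simps N11 N'11)
      show "Comp D X X X (N' X $ 2 $ 2) (N X $ 2 $ 1) = 0"
        using inv1[OF X, of 2 1] X by (simp add: simps N11 N'11)
      show "Comp D X X X (N X $ 2 $ 1) (N' X $ 1 $ 2) + Comp D X X X (N X $ 2 $ 2) (N' X $ 2 $ 2) = Id D X"
        using inv2[OF X, of 2 2] X by (simp add: simps)
    next
      fix X Y f assume ob: "X \<in> Ob D" "Y \<in> Ob D" and f: "f \<in> Hom D X Y"
      note F = \<upsilon>.F_hom[OF ob f]
      show "Comp D X X Y (\<upsilon> X Y f) (N X $ 2 $ 1) = Comp D X Y Y (N Y $ 2 $ 1) f"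
        using left'[OF ob f, of 2 1] ob f F by (simp add: simps)
      show "Comp D X X Y (\<upsilon> X Y f) (N X $ 2 $ 2) = Comp D X Y Y (N Y $ 2 $ 2) (\<upsilon> X Y f)"
        using left'[OF ob f, of 2 2] ob f F by (simp add: simps)
      show "Comp D X Y Y (N' Y $ 1 $ 2) (\<upsilon> X Y f) = Comp D X X Y f (N' X $ 1 $ 2)"
        using right'[OF ob f, of 1 2] ob f F by (simp add: simps)
      show "Comp D X Y Y (N' Y $ 2 $ 2) (\<upsilon> X Y f) = Comp D X X Y (\<upsilon> X Y f) (N' X $ 2 $ 2)"
        using right'[OF ob f, of 2 2] ob f F by (simp add: simps)
      \<comment> \<open>The \<open>(2, 2)\<close> entry of \<open>N' N = 1\<close> is applied to
        \<open>\<upsilon>(f)\<close>, where \<open>N12\<close> removes the unwanted summand.\<close>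
      have "\<upsilon> X Y f = Comp D X Y Y (Comp D Y Y Y (N' Y $ 2 $ 1) (N Y $ 1 $ 2) + Comp D Y Y Y (N' Y $ 2 $ 2) (N Y $ 2 $ 2)) (\<upsilon> X Y f)"
        using inv1[OF ob(2), of 2 2] ob F by (simp add: sum_2 Id_left)
      also have "\<dots> = Comp D X Y Y (N' Y $ 2 $ 1) (Comp D X Y Y (N Y $ 1 $ 2) (\<upsilon> X Y f))
          + Comp D X Y Y (N' Y $ 2 $ 2) (Comp D X Y Y (N Y $ 2 $ 2) (\<upsilon> X Y f))"
        using ob F N_in by (simp add: clinear_onD(1)[OF Comp_linear_left] Comp_in_Hom Comp_assoc)
      finally show "Comp D X Y Y (N' Y $ 2 $ 2) (Comp D X Y Y (N Y $ 2 $ 2) (\<upsilon> X Y f)) = \<upsilon> X Y f"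
        using N12[OF ob f] ob N_in by (simp add: Comp_zero_right)
    qed
  qed
qed

theorem proposition7p5:
  fixes H :: "('h::complex_algebra_1) hopf"
    and D :: "('o, 'f::complex_vector, 'h) hcat"
    and M :: "('m::complex_vector, 'h) sayd"
    and \<upsilon>\<^sub>o :: "'o \<Rightarrow> 'o"
    and \<upsilon> :: "'o \<Rightarrow> 'o \<Rightarrow> 'f \<Rightarrow> 'f"
    and \<eta> :: "'o \<Rightarrow> ('f, complex ^ 2 ^ 2) tensor"
  assumes "hopf_algebra H" and "bij (antipode H)"
    and "left_H_category H D"
    and "sayd_module H M"
    and "H_linear_semifunctor D D \<upsilon>\<^sub>o \<upsilon>"
    and "\<eta> \<in> \<U> H (mat2 D)"
    and "\<And>X. X \<in> Ob D \<Longrightarrow> \<upsilon>\<^sub>o X = X"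
    and "\<And>X Y f. \<lbrakk>X \<in> Ob D; Y \<in> Ob D; f \<in> Hom D X Y\<rbrakk> \<Longrightarrow>
      \<Phi> (mat2 D) \<eta> X Y (f \<otimes> matrix_unit 1 1 + \<upsilon> X Y f \<otimes> matrix_unit 2 2)
        = \<upsilon> X Y f \<otimes> matrix_unit 2 2"
  shows "\<forall>n. HC H D M n = {HC_zero H D M n}"
proof -
  interpret hopf_cyclic H D M
    using assms(1-4) by (intro hopf_cyclic.intro hopf_cyclic_axioms.intro)
  interpret S: H_linear_semifunctor D D \<upsilon>\<^sub>o \<upsilon> by fact
  \<comment> \<open>The object map agrees with the identity only on the objects of \<open>D\<close>;
    replacing it by the identity function brings the semifunctor into the form of the
    locale.\<close>
  have "H_linear_semifunctor D D (\<lambda>X. X) \<upsilon>"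
    using S.F_hom S.F_linear S.F_act S.F_comp assms(7)
    by (intro H_linear_semifunctor.intro) auto
  from absorbing_semifunctor_exists[OF this assms(6,8)] obtain u v d e
    where "absorbing_semifunctor H D M \<upsilon> u v d e" by blast
  then interpret absorbing_semifunctor H D M \<upsilon> u v d e .
  show ?thesis using HC_trivial[OF cyclic_cocycle_coboundary] by blast
qed

end
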